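(* The functor $\mathbb T:\square_S^{op}\mathbf{Set}\downarrow{!^S\Sigma}\to\mathbf{WHDTS}$ factors uniquely (up to isomorphism of functors) as a composite $$\square_S^{op}\mathbf{Set}\downarrow{!^S\Sigma}\xrightarrow{\ \mathrm{Sh}_\Sigma\ }\mathbf{HDA}^\Sigma\xrightarrow{\ \overline{\mathbb T}\ }\mathbf{WHDTS}.$$ Moreover, the functor $\overline{\mathbb T}$ is a left adjoint.
   Context: $\Sigma$ is a fixed nonempty set of labels. A weak higher dimensional transition system is a triple $(S,\mu:L\to\Sigma,T=\bigcup_{n\ge1}T_n)$ with $S$ a set (states), $L$ a set (actions), $\mu$ a set map (labelling map) and $T_n\subset S\times L^n\times S$ ($n$-transitions) such that: - (Multiset axiom) for every permutation $\sigma$ of $\{1,\dots,n\}$, $n\ge2$, if $(\alpha,u_1,\dots,u_n,\beta)\in T$ then $(\alpha,u_{\sigma(1)},\dots,u_{\sigma(n)},\beta)\in T$; - (Coherence axiom) for $n\ge3$, $p,q\ge1$ with $p+q<n$, if $(\alpha,u_1,\dots,u_n,\beta)$, $(\alpha,u_1,\dots,u_p,\nu_1)$, $(\nu_1,u_{p+1},\dots,u_n,\beta)$, $(\alpha,u_1,\dots,u_{p+q},\nu_2)$, $(\nu_2,u_{p+q+1},\dots,u_n,\beta)$ are transitions, then $(\nu_1,u_{p+1},\dots,u_{p+q},\nu_2)$ is a transition. A morphism $f$ consists of a map $f_0$ on states and a map $\widetilde f$ on actions commuting with the labelling maps, such that $(f_0(\alpha),\widetilde f(u_1),\dots,\widetilde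 f(u_n),f_0(\beta))$ is a transition whenever $(\alpha,u_1,\dots,u_n,\beta)$ is. The category is $\mathbf{WHDTS}$. $C_n[a_1,\dots,a_n]$ ($n\ge0$, $a_i\in\Sigma$) has set of states $\{0,1\}^n$, set of actions $\{(a_1,1),\dots,(a_n,n)\}$, labelling $\mu(a_i,i)=a_i$, and its $d$-transitions ($d\ge1$) are the tuples $((\epsilon_1,\dots,\epsilon_n),(a_{i_1},i_1),\dots,(a_{i_d},i_d),(\epsilon_1',\dots,\epsilon_n'))$ with $i_1,\dots,i_d$ pairwise distinct, $\epsilon_i\le\epsilon_i'$ for all $i$, and $\epsilon_i\ne\epsilon_i'$ iff $i\in\{i_1,\dots,i_d\}$. $\square_S$ is the category with objects $[n]=\{0,1\}^n$, $n\ge0$, whose morphisms are the set maps generated by the face maps $\delta_i^\alpha(\epsilon_1,\dots,\epsilon_{n-1})=(\epsilon_1,\dots,\epsilon_{i-1},\alpha,\epsilon_i,\dots,\epsilon_{n-1})$ ($\alpha\in\{0,1\}$) and the symmetry maps $\sigma_i:[n]\to[n]$ exchanging coordinates $i$ and $i+1$. A symmetric precubical set is a presheaf on $\square_S$; $\square_S[n]=\square_S(-,[n])$; $\partial\square_S[n]\subset\square_S[n]$ has the same $k$-cubes for $k<n$ and none for $k\ge n$. The symmetric precubical set $!^S\Sigma$ has $(!^S\Sigma)_n=\Sigma^n$, where $(\delta_i^0)^*=(\delta_i^1)^*$ removes the $i$-th letter and $\sigma_i^*$ exchanges letters $i$ and $i+1$. A labelled symmetric precubical set is an object of the comma category $\square_S^{op}\mathbf{Set}\downarrow{!^S\Sigma}$.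 The labelled cube $\square_S[a_1,\dots,a_n]$ is $\square_S[n]\to{!^S\Sigma}$ corresponding to $(a_1,\dots,a_n)\in\Sigma^n$. $\mathbb T:\square_S^{op}\mathbf{Set}\downarrow{!^S\Sigma}\to\mathbf{WHDTS}$ is the colimit-preserving functor (unique up to isomorphism) with $\mathbb T(\square_S[a_1,\dots,a_n])=C_n[a_1,\dots,a_n]$ and defined on a map of cubes $f:\square_S[a_1,\dots,a_m]\to\square_S[b_1,\dots,b_n]$ as follows: on states it is $f_0:[m]\to[n]$; there is a unique $\widehat f:\{1,\dots,n\}\to\{1,\dots,m\}\cup\{-\infty,+\infty\}$ with $f_0(\epsilon_1,\dots,\epsilon_m)=(\epsilon_{\widehat f(1)},\dots,\epsilon_{\widehat f(n)})$ (with $\epsilon_{-\infty}=0$, $\epsilon_{+\infty}=1$), each $i\in\{1,\dots,m\}$ has exactly one preimage $j$ under $\widehat f$, and on actions $(a_i,i)\mapsto(b_j,j)=(a_i,j)$. A labelled symmetric precubical set $K\to{!^S\Sigma}$ satisfies the HDA paradigm if for every $p\ge2$, every commutative square with sides $\partial\square_S[p]\subset\square_S[p]$, $\partial\square_S[p]\to K$, $\square_S[p]\to{!^S\Sigma}$ and $K\to{!^S\Sigma}$ admits at most one lift $k:\square_S[p]\to K$ making the two triangles commutative. $\mathbf{HDA}^\Sigma$ is the full subcategory of such objects; it is reflective, and $\mathrm{Sh}_\Sigma$ is the left adjoint of the inclusion functor. *)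

theory Defs
  imports "HOL-Library.FuncSet" "HOL-Combinatorics.Permutations"
begin

section \<open>Small sets\<close>

text \<open>The category of sets is rendered as the category of the subsets of a type that belong to
  a fixed collection \<open>U\<close> of small sets. Instances are the collection of all subsets of an arbitrary
  infinite type, and the collection of the subsets of cardinality below an uncountable regular
  (for instance inaccessible) cardinal. Closure under power sets is not required.\<close>

definition universe :: "'u set set \<Rightarrow> bool" where
  "universe U \<longleftrightarrow>
     (\<exists>A\<in>U. infinite A) \<and>
     (\<forall>A\<in>U. \<forall>B. B \<subseteq> A \<longrightarrow> B \<in> U) \<and>
     (\<forall>A\<in>U. \<forall>f. f ` A \<in> U) \<and>
     (\<forall>I\<in>U. \<forall>A. (\<forall>i\<in>I. A i \<in> U) \<longrightarrow> (\<Union>i\<in>I. A i) \<in> U)"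

definition small_type :: "'u set set \<Rightarrow> 'l itself \<Rightarrow> bool" where
  "small_type U (_ :: 'l itself) \<longleftrightarrow> (\<exists>e :: 'l \<Rightarrow> 'u. inj e \<and> range e \<in> U)"


section \<open>Categories\<close>

text \<open>\<open>Cmp C g f\<close> is the composite of \<open>f\<close> followed by \<open>g\<close>.\<close>

record ('o, 'a) cat =
  Obj :: "'o set"
  Arr :: "'a set"
  Src :: "'a \<Rightarrow> 'o"
  Tgt :: "'a \<Rightarrow> 'o"
  Idn :: "'o \<Rightarrow> 'a"
  Cmp :: "'a \<Rightarrow> 'a \<Rightarrow> 'a"

definition hom :: "('o, 'a) cat \<Rightarrow> 'o \<Rightarrow> 'o \<Rightarrow> 'a set" where
  "hom C X Y = {f \<in> Arr C. Src C f = X \<and> Tgt C f = Y}"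

definition category :: "('o, 'a) cat \<Rightarrow> bool" where
  "category C \<longleftrightarrow>
     (\<forall>f\<in>Arr C. Src C f \<in> Obj C \<and> Tgt C f \<in> Obj C) \<and>
     (\<forall>X\<in>Obj C. Idn C X \<in> hom C X X) \<and>
     (\<forall>X Y Z f g. f \<in> hom C X Y \<longrightarrow> g \<in> hom C Y Z \<longrightarrow> Cmp C g f \<in> hom C X Z) \<and>
     (\<forall>X Y f. f \<in> hom C X Y \<longrightarrow> Cmp C f (Idn C X) = f \<and> Cmp C (Idn C Y) f = f) \<and>
     (\<forall>W X Y Z f g h. f \<in> hom C W X \<longrightarrow> g \<in> hom C X Y \<longrightarrow> h \<in> hom C Y Z \<longrightarrow>
        Cmp C h (Cmp C g f) = Cmp C (Cmp C h g) f)"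

definition full_subcategory :: "('o, 'a) cat \<Rightarrow> ('o \<Rightarrow> bool) \<Rightarrow> ('o, 'a) cat" where
  "full_subcategory C P =
     C\<lparr>Obj := {X \<in> Obj C. P X}, Arr := {f \<in> Arr C. P (Src C f) \<and> P (Tgt C f)}\<rparr>"

definition iso_arr :: "('o, 'a) cat \<Rightarrow> 'o \<Rightarrow> 'o \<Rightarrow> 'a \<Rightarrow> bool" where
  "iso_arr C X Y f \<longleftrightarrow> f \<in> hom C X Y \<and>
     (\<exists>g\<in>hom C Y X. Cmp C g f = Idn C X \<and> Cmp C f g = Idn C Y)"

record ('o, 'a, 'p, 'b) ftor =
  fobj :: "'o \<Rightarrow> 'p"
  farr :: "'a \<Rightarrow> 'b"

definition is_functor :: "('o, 'a) cat \<Rightarrow> ('p, 'b) cat \<Rightarrow> ('o, 'a, 'p, 'b) ftor \<Rightarrow> bool" where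
  "is_functor C D F \<longleftrightarrow>
     (\<forall>X\<in>Obj C. fobj F X \<in> Obj D) \<and>
     (\<forall>X Y f. f \<in> hom C X Y \<longrightarrow> farr F f \<in> hom D (fobj F X) (fobj F Y)) \<and>
     (\<forall>X\<in>Obj C. farr F (Idn C X) = Idn D (fobj F X)) \<and>
     (\<forall>X Y Z f g. f \<in> hom C X Y \<longrightarrow> g \<in> hom C Y Z \<longrightarrow>
        farr F (Cmp C g f) = Cmp D (farr F g) (farr F f))"

definition ftor_comp :: "('p, 'b, 'q, 'c) ftor \<Rightarrow> ('o, 'a, 'p, 'b) ftor \<Rightarrow> ('o, 'a, 'q, 'c) ftor" where
  "ftor_comp G F = \<lparr>fobj = fobj G \<circ> fobj F, farr = farr G \<circ> farr F\<rparr>"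

definition inclusion :: "('o, 'a, 'o, 'a) ftor" where
  "inclusion = \<lparr>fobj = id, farr = id\<rparr>"

definition naturally_isomorphic ::
    "('o, 'a) cat \<Rightarrow> ('p, 'b) cat \<Rightarrow> ('o, 'a, 'p, 'b) ftor \<Rightarrow> ('o, 'a, 'p, 'b) ftor \<Rightarrow> bool" where
  "naturally_isomorphic C D F G \<longleftrightarrow>
     (\<exists>\<tau>. (\<forall>X\<in>Obj C. iso_arr D (fobj F X) (fobj G X) (\<tau> X)) \<and>
          (\<forall>X Y f. f \<in> hom C X Y \<longrightarrow> Cmp D (\<tau> Y) (farr F f) = Cmp D (farr G f) (\<tau> X)))"

text \<open>\<open>adjunction C D F G\<close>: the functor \<open>F\<close> from \<open>C\<close> to \<open>D\<close> is left adjoint to \<open>G\<close>.\<close>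

definition adjunction ::
    "('o, 'a) cat \<Rightarrow> ('p, 'b) cat \<Rightarrow> ('o, 'a, 'p, 'b) ftor \<Rightarrow> ('p, 'b, 'o, 'a) ftor \<Rightarrow> bool" where
  "adjunction C D F G \<longleftrightarrow> is_functor C D F \<and> is_functor D C G \<and>
     (\<exists>\<phi>. (\<forall>X\<in>Obj C. \<forall>Y\<in>Obj D.
             bij_betw (\<phi> X Y) (hom D (fobj F X) Y) (hom C X (fobj G Y))) \<and>
          (\<forall>X\<in>Obj C. \<forall>X'\<in>Obj C. \<forall>Y\<in>Obj D. \<forall>Y'\<in>Obj D.
           \<forall>f\<in>hom C X' X. \<forall>h\<in>hom D (fobj F X) Y. \<forall>g\<in>hom D Y Y'.
             \<phi> X' Y' (Cmp D (Cmp D g h) (farr F f)) = Cmp C (Cmp C (farr G g) (\<phi> X Y h)) f))"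

definition is_left_adjoint ::
    "('o, 'a) cat \<Rightarrow> ('p, 'b) cat \<Rightarrow> ('o, 'a, 'p, 'b) ftor \<Rightarrow> bool" where
  "is_left_adjoint C D F \<longleftrightarrow> (\<exists>G. adjunction C D F G)"

definition cocone ::
    "('o, 'a) cat \<Rightarrow> ('i, 'j) cat \<Rightarrow> ('i, 'j, 'o, 'a) ftor \<Rightarrow> 'o \<Rightarrow> ('i \<Rightarrow> 'a) \<Rightarrow> bool" where
  "cocone C J D c \<iota> \<longleftrightarrow> c \<in> Obj C \<and>
     (\<forall>j\<in>Obj J. \<iota> j \<in> hom C (fobj D j) c) \<and>
     (\<forall>i j f. f \<in> hom J i j \<longrightarrow> Cmp C (\<iota> j) (farr D f) = \<iota> i)"

definition is_colimit ::
    "('o, 'a) cat \<Rightarrow> ('i, 'j) cat \<Rightarrow> ('i, 'j, 'o, 'a) ftor \<Rightarrow> 'o \<Rightarrow> ('i \<Rightarrow> 'a) \<Rightarrow> bool" where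
  "is_colimit C J D c \<iota> \<longleftrightarrow> cocone C J D c \<iota> \<and>
     (\<forall>c' \<iota>'. cocone C J D c' \<iota>' \<longrightarrow>
        (\<exists>!h. h \<in> hom C c c' \<and> (\<forall>j\<in>Obj J. Cmp C h (\<iota> j) = \<iota>' j)))"

definition preserves_small_colimits ::
    "'u set set \<Rightarrow> ('o, 'a) cat \<Rightarrow> ('p, 'b) cat \<Rightarrow> ('o, 'a, 'p, 'b) ftor \<Rightarrow> bool" where
  "preserves_small_colimits U C E F \<longleftrightarrow>
     (\<forall>(J :: ('u, 'u) cat) D c \<iota>.
        category J \<longrightarrow> Obj J \<in> U \<longrightarrow> Arr J \<in> U \<longrightarrow> is_functor J C D \<longrightarrow>
        is_colimit C J D c \<iota> \<longrightarrow>
        is_colimit E J (ftor_comp F D) (fobj F c) (\<lambda>j. farr F (\<iota> j)))"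


section \<open>Weak higher dimensional transition systems\<close>

record ('s, 'a, 'l) ts =
  states :: "'s set"
  actions :: "'a set"
  lab :: "'a \<Rightarrow> 'l"
  trans :: "('s \<times> 'a list \<times> 's) set"

definition whdts :: "('s, 'a, 'l) ts \<Rightarrow> bool" where
  "whdts X \<longleftrightarrow>
     trans X \<subseteq> {(\<alpha>, us, \<beta>). \<alpha> \<in> states X \<and> \<beta> \<in> states X \<and> us \<in> lists (actions X) \<and> length us \<ge> 1} \<and>
     (\<forall>\<alpha> us \<beta> \<sigma>. length us \<ge> 2 \<longrightarrow> \<sigma> permutes {..<length us} \<longrightarrow>
        (\<alpha>, us, \<beta>) \<in> trans X \<longrightarrow> (\<alpha>, permute_list \<sigma> us, \<beta>) \<in> trans X) \<and>
     (\<forall>\<alpha> us \<beta> \<nu>1 \<nu>2 p q. length us \<ge> 3 \<longrightarrow> p \<ge> 1 \<longrightarrow> q \<ge> 1 \<longrightarrow> p + q < length us \<longrightarrow>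
        (\<alpha>, us, \<beta>) \<in> trans X \<longrightarrow>
        (\<alpha>, take p us, \<nu>1) \<in> trans X \<longrightarrow> (\<nu>1, drop p us, \<beta>) \<in> trans X \<longrightarrow>
        (\<alpha>, take (p + q) us, \<nu>2) \<in> trans X \<longrightarrow> (\<nu>2, drop (p + q) us, \<beta>) \<in> trans X \<longrightarrow>
        (\<nu>1, take q (drop p us), \<nu>2) \<in> trans X)"

text \<open>Morphisms, here and below, are extensional functions, so that equality of morphisms is
  equality on the carriers. Source and target may have different carrier types.\<close>

definition whdts_hom ::
    "('s, 'a, 'l) ts \<Rightarrow> ('t, 'b, 'l) ts \<Rightarrow> ('s \<Rightarrow> 't) \<times> ('a \<Rightarrow> 'b) \<Rightarrow> bool" where
  "whdts_hom X Y f \<longleftrightarrow>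
     fst f \<in> states X \<rightarrow>\<^sub>E states Y \<and> snd f \<in> actions X \<rightarrow>\<^sub>E actions Y \<and>
     (\<forall>u\<in>actions X. lab Y (snd f u) = lab X u) \<and>
     (\<forall>\<alpha> us \<beta>. (\<alpha>, us, \<beta>) \<in> trans X \<longrightarrow> (fst f \<alpha>, map (snd f) us, fst f \<beta>) \<in> trans Y)"

definition whdts_iso ::
    "('s, 'a, 'l) ts \<Rightarrow> ('t, 'b, 'l) ts \<Rightarrow> ('s \<Rightarrow> 't) \<times> ('a \<Rightarrow> 'b) \<Rightarrow> bool" where
  "whdts_iso X Y f \<longleftrightarrow> whdts_hom X Y f \<and>
     (\<exists>g. whdts_hom Y X g \<and>
        (\<forall>s\<in>states X. fst g (fst f s) = s) \<and> (\<forall>u\<in>actions X. snd g (snd f u) = u) \<and>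
        (\<forall>s\<in>states Y. fst f (fst g s) = s) \<and> (\<forall>u\<in>actions Y. snd f (snd g u) = u))"

type_synonym ('u, 'l) ts_arr =
  "('u, 'u, 'l) ts \<times> (('u \<Rightarrow> 'u) \<times> ('u \<Rightarrow> 'u)) \<times> ('u, 'u, 'l) ts"

definition WHDTS :: "'u set set \<Rightarrow> (('u, 'u, 'l) ts, ('u, 'l) ts_arr) cat" where
  "WHDTS U = (let Ob = {X. whdts X \<and> states X \<in> U \<and> actions X \<in> U} in
     \<lparr>Obj = Ob,
      Arr = {(X, f, Y). X \<in> Ob \<and> Y \<in> Ob \<and> whdts_hom X Y f},
      Src = (\<lambda>(X, f, Y). X),
      Tgt = (\<lambda>(X, f, Y). Y),
      Idn = (\<lambda>X. (X, (\<lambda>s\<in>states X. s, \<lambda>u\<in>actions X. u), X)),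
      Cmp = (\<lambda>(_, g, Z) (X, f, _).
        (X, (compose (states X) (fst g) (fst f), compose (actions X) (snd g) (snd f)), Z))\<rparr>)"


section \<open>Symmetric precubical sets\<close>

text \<open>Coordinates of cubes and letters of words are numbered from \<open>0\<close>. A morphism
  from \<open>[m]\<close> to \<open>[n]\<close> is a triple \<open>(m, f, n)\<close>.\<close>

type_synonym box_arr = "nat \<times> (bool list \<Rightarrow> bool list) \<times> nat"

definition vert :: "nat \<Rightarrow> bool list set" where
  "vert n = {\<epsilon>. length \<epsilon> = n}"

definition face :: "nat \<Rightarrow> nat \<Rightarrow> bool \<Rightarrow> bool list \<Rightarrow> bool list" where
  "face n i \<alpha> = (\<lambda>\<epsilon>\<in>vert n. take i \<epsilon> @ [\<alpha>] @ drop i \<epsilon>)"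

definition swap :: "nat \<Rightarrow> nat \<Rightarrow> bool list \<Rightarrow> bool list" where
  "swap n i = (\<lambda>\<epsilon>\<in>vert n. \<epsilon>[i := \<epsilon> ! Suc i, Suc i := \<epsilon> ! i])"

inductive_set box :: "box_arr set" where
  box_id: "(n, \<lambda>\<epsilon>\<in>vert n. \<epsilon>, n) \<in> box"
| box_face: "i \<le> n \<Longrightarrow> (n, face n i \<alpha>, Suc n) \<in> box"
| box_swap: "Suc i < n \<Longrightarrow> (n, swap n i, n) \<in> box"
| box_comp: "(l, f, m) \<in> box \<Longrightarrow> (m, g, n) \<in> box \<Longrightarrow> (l, compose (vert l) g f, n) \<in> box"

record 'a psh =
  cells :: "nat \<Rightarrow> 'a set"
  act :: "box_arr \<Rightarrow> 'a \<Rightarrow> 'a"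

definition sym_precubical_set :: "'a psh \<Rightarrow> bool" where
  "sym_precubical_set K \<longleftrightarrow>
     (\<forall>m f n. (m, f, n) \<in> box \<longrightarrow> act K (m, f, n) \<in> cells K n \<rightarrow> cells K m) \<and>
     (\<forall>n. \<forall>x\<in>cells K n. act K (n, \<lambda>\<epsilon>\<in>vert n. \<epsilon>, n) x = x) \<and>
     (\<forall>l m n f g. (l, f, m) \<in> box \<longrightarrow> (m, g, n) \<in> box \<longrightarrow>
        (\<forall>x\<in>cells K n. act K (l, compose (vert l) g f, n) x = act K (l, f, m) (act K (m, g, n) x)))"

definition psh_hom :: "'a psh \<Rightarrow> 'b psh \<Rightarrow> (nat \<Rightarrow> 'a \<Rightarrow> 'b) \<Rightarrow> bool" where
  "psh_hom K L \<eta> \<longleftrightarrow>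
     (\<forall>n. \<eta> n \<in> cells K n \<rightarrow>\<^sub>E cells L n) \<and>
     (\<forall>m f n. (m, f, n) \<in> box \<longrightarrow>
        (\<forall>x\<in>cells K n. \<eta> m (act K (m, f, n) x) = act L (m, f, n) (\<eta> n x)))"

definition psh_comp :: "'a psh \<Rightarrow> (nat \<Rightarrow> 'b \<Rightarrow> 'c) \<Rightarrow> (nat \<Rightarrow> 'a \<Rightarrow> 'b) \<Rightarrow> nat \<Rightarrow> 'a \<Rightarrow> 'c" where
  "psh_comp K \<theta> \<eta> = (\<lambda>n. compose (cells K n) (\<theta> n) (\<eta> n))"

definition std_cube :: "nat \<Rightarrow> (bool list \<Rightarrow> bool list) psh" where
  "std_cube n = \<lparr>cells = (\<lambda>m. {f. (m, f, n) \<in> box}), act = (\<lambda>(l, g, m) f. compose (vert l) f g)\<rparr>"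

definition boundary :: "nat \<Rightarrow> (bool list \<Rightarrow> bool list) psh" where
  "boundary n = (std_cube n)\<lparr>cells := (\<lambda>k. if k < n then cells (std_cube n) k else {})\<rparr>"

text \<open>For a morphism \<open>f\<close> from \<open>[m]\<close> to \<open>[n]\<close>, the \<open>j\<close>-th coordinate of \<open>f \<epsilon>\<close> is either constant
  or a coordinate of \<open>\<epsilon>\<close>; \<open>hat m f j\<close> tells which. Every coordinate \<open>i < m\<close> is used exactly once,
  in position \<open>hat_inv m f n i\<close>.\<close>

datatype coord = Minus_Inf | Plus_Inf | Coord nat

primrec coord_val :: "bool list \<Rightarrow> coord \<Rightarrow> bool" where
  "coord_val \<epsilon> Minus_Inf = False"
| "coord_val \<epsilon> Plus_Inf = True"
| "coord_val \<epsilon> (Coord i) = \<epsilon> ! i"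

definition hat :: "nat \<Rightarrow> (bool list \<Rightarrow> bool list) \<Rightarrow> nat \<Rightarrow> coord" where
  "hat m f j = (THE c. c \<in> {Minus_Inf, Plus_Inf} \<union> Coord ` {..<m} \<and>
                       (\<forall>\<epsilon>\<in>vert m. f \<epsilon> ! j = coord_val \<epsilon> c))"

definition hat_inv :: "nat \<Rightarrow> (bool list \<Rightarrow> bool list) \<Rightarrow> nat \<Rightarrow> nat \<Rightarrow> nat" where
  "hat_inv m f n i = (THE j. j < n \<and> hat m f j = Coord i)"

text \<open>The presheaf of words. The lemmas \<open>act_words_face\<close> and \<open>act_words_swap\<close> below show that the
  faces remove a letter and the symmetries exchange two consecutive letters.\<close>

definition words :: "'l list psh" where
  "words = \<lparr>cells = (\<lambda>n. {w. length w = n}),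
            act = (\<lambda>(m, f, n) w. map (\<lambda>i. w ! hat_inv m f n i) [0..<m])\<rparr>"

lemma hat_eqI:
  assumes c: "c \<in> {Minus_Inf, Plus_Inf} \<union> Coord ` {..<m}"
    and eq: "\<And>\<epsilon>. length \<epsilon> = m \<Longrightarrow> f \<epsilon> ! j = coord_val \<epsilon> c"
  shows "hat m f j = c"
  unfolding hat_def
proof (rule the_equality)
  show "c \<in> {Minus_Inf, Plus_Inf} \<union> Coord ` {..<m} \<and> (\<forall>\<epsilon>\<in>vert m. f \<epsilon> ! j = coord_val \<epsilon> c)"
    using c eq by (simp add: vert_def)
next
  fix d
  assume d: "d \<in> {Minus_Inf, Plus_Inf} \<union> Coord ` {..<m} \<and> (\<forall>\<epsilon>\<in>vert m. f \<epsilon> ! j = coord_val \<epsilon> d)"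
  have val: "coord_val \<epsilon> d = coord_val \<epsilon> c" if "length \<epsilon> = m" for \<epsilon>
    using d eq that by (simp add: vert_def)
  note F = val[of "replicate m False"] and T = val[of "replicate m True"]
  have "k = i" if "c = Coord i" "d = Coord k" "i < m" "k < m" for i k
    using val[of "(replicate m False)[i := True]"] that by (cases "k = i") auto
  then show "d = c"
    using c d F T by (cases c; cases d) auto
qed

lemma act_words_face:
  assumes "i \<le> n" "length w = Suc n"
  shows "act words (n, face n i \<alpha>, Suc n) w = take i w @ drop (Suc i) w"
proof -
  have h: "hat n (face n i \<alpha>) j =
      (if j < i then Coord j else if j = i then (if \<alpha> then Plus_Inf else Minus_Inf)
       else Coord (j - 1))" if "j < Suc n" for j
    by (rule hat_eqI) (use that assms in \<open>auto simp: face_def vert_def nth_append nth_Cons'\<close>)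
  have "hat_inv n (face n i \<alpha>) (Suc n) k = (if k < i then k else Suc k)" if "k < n" for k
    unfolding hat_inv_def
    by (rule the_equality) (use that assms in \<open>auto simp: h split: if_splits\<close>)
  then show ?thesis
    using assms by (auto simp: words_def nth_append intro!: nth_equalityI)
qed

lemma act_words_swap:
  assumes "Suc i < n" "length w = n"
  shows "act words (n, swap n i, n) w = w[i := w ! Suc i, Suc i := w ! i]"
proof -
  have h: "hat n (swap n i) j = Coord (if j = i then Suc i else if j = Suc i then i else j)"
    if "j < n" for j
    by (rule hat_eqI) (use that assms in \<open>auto simp: swap_def vert_def nth_list_update\<close>)
  have "hat_inv n (swap n i) n k = (if k = i then Suc i else if k = Suc i then i else k)"
    if "k < n" for k
    unfolding hat_inv_def
    by (rule the_equality) (use that assms(1) in \<open>auto simp: h split: if_splits\<close>)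
  then show ?thesis
    using assms by (auto simp: words_def nth_list_update intro!: nth_equalityI)
qed


section \<open>Labelled symmetric precubical sets\<close>

type_synonym ('a, 'l) lps = "'a psh \<times> (nat \<Rightarrow> 'a \<Rightarrow> 'l list)"

definition labelled_sps :: "('a, 'l) lps \<Rightarrow> bool" where
  "labelled_sps X \<longleftrightarrow> sym_precubical_set (fst X) \<and> psh_hom (fst X) words (snd X)"

definition lps_hom :: "('a, 'l) lps \<Rightarrow> ('b, 'l) lps \<Rightarrow> (nat \<Rightarrow> 'a \<Rightarrow> 'b) \<Rightarrow> bool" where
  "lps_hom X Y \<eta> \<longleftrightarrow> psh_hom (fst X) (fst Y) \<eta> \<and> psh_comp (fst X) (snd Y) \<eta> = snd X"

definition lps_iso :: "('a, 'l) lps \<Rightarrow> ('b, 'l) lps \<Rightarrow> (nat \<Rightarrow> 'a \<Rightarrow> 'b) \<Rightarrow> bool" where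
  "lps_iso X Y \<eta> \<longleftrightarrow> lps_hom X Y \<eta> \<and>
     (\<exists>\<theta>. lps_hom Y X \<theta> \<and> (\<forall>n. \<forall>x\<in>cells (fst X) n. \<theta> n (\<eta> n x) = x) \<and>
          (\<forall>n. \<forall>y\<in>cells (fst Y) n. \<eta> n (\<theta> n y) = y))"

type_synonym ('u, 'l) lps_arr = "('u, 'l) lps \<times> (nat \<Rightarrow> 'u \<Rightarrow> 'u) \<times> ('u, 'l) lps"

definition LPS :: "'u set set \<Rightarrow> (('u, 'l) lps, ('u, 'l) lps_arr) cat" where
  "LPS U = (let Ob = {X. labelled_sps X \<and> (\<forall>n. cells (fst X) n \<in> U)} in
     \<lparr>Obj = Ob,
      Arr = {(X, \<eta>, Y). X \<in> Ob \<and> Y \<in> Ob \<and> lps_hom X Y \<eta>},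
      Src = (\<lambda>(X, \<eta>, Y). X),
      Tgt = (\<lambda>(X, \<eta>, Y). Y),
      Idn = (\<lambda>X. (X, \<lambda>n. \<lambda>x\<in>cells (fst X) n. x, X)),
      Cmp = (\<lambda>(_, \<theta>, Z) (X, \<eta>, _). (X, psh_comp (fst X) \<theta> \<eta>, Z))\<rparr>)"

definition HDA_paradigm :: "('a, 'l) lps \<Rightarrow> bool" where
  "HDA_paradigm X \<longleftrightarrow>
     (\<forall>p\<ge>2. \<forall>a b. psh_hom (boundary p) (fst X) a \<longrightarrow> psh_hom (std_cube p) words b \<longrightarrow>
        (\<forall>n. \<forall>x\<in>cells (boundary p) n. snd X n (a n x) = b n x) \<longrightarrow>
        (\<forall>k k'.
           psh_hom (std_cube p) (fst X) k \<and>
           (\<forall>n. \<forall>x\<in>cells (boundary p) n. k n x = a n x) \<and>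
           (\<forall>n. \<forall>x\<in>cells (std_cube p) n. snd X n (k n x) = b n x) \<longrightarrow>
           psh_hom (std_cube p) (fst X) k' \<and>
           (\<forall>n. \<forall>x\<in>cells (boundary p) n. k' n x = a n x) \<and>
           (\<forall>n. \<forall>x\<in>cells (std_cube p) n. snd X n (k' n x) = b n x) \<longrightarrow>
           k = k'))"

definition HDA :: "'u set set \<Rightarrow> (('u, 'l) lps, ('u, 'l) lps_arr) cat" where
  "HDA U = full_subcategory (LPS U) HDA_paradigm"

definition labelled_cube :: "'l list \<Rightarrow> (bool list \<Rightarrow> bool list, 'l) lps" where
  "labelled_cube a = (std_cube (length a),
     \<lambda>m. \<lambda>f\<in>cells (std_cube (length a)) m. act words (m, f, length a) a)"


section \<open>Realization as weak higher dimensional transition systems\<close>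

definition ts_cube :: "'l list \<Rightarrow> (bool list, 'l \<times> nat, 'l) ts" where
  "ts_cube a =
     \<lparr>states = vert (length a),
      actions = {(a ! i, i) | i. i < length a},
      lab = fst,
      trans = {(\<epsilon>, map (\<lambda>i. (a ! i, i)) is, \<epsilon>') | \<epsilon> is \<epsilon>'.
        \<epsilon> \<in> vert (length a) \<and> \<epsilon>' \<in> vert (length a) \<and>
        length is \<ge> 1 \<and> distinct is \<and> set is \<subseteq> {..<length a} \<and>
        (\<forall>i<length a. \<epsilon> ! i \<le> \<epsilon>' ! i \<and> (\<epsilon> ! i \<noteq> \<epsilon>' ! i \<longleftrightarrow> i \<in> set is))}\<rparr>"

definition box_map :: "nat \<Rightarrow> (nat \<Rightarrow> (bool list \<Rightarrow> bool list) \<Rightarrow> (bool list \<Rightarrow> bool list))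
    \<Rightarrow> bool list \<Rightarrow> bool list" where
  "box_map m F = F m (\<lambda>\<epsilon>\<in>vert m. \<epsilon>)"

definition ts_cube_map :: "'l list \<Rightarrow> 'l list \<Rightarrow> (bool list \<Rightarrow> bool list)
    \<Rightarrow> (bool list \<Rightarrow> bool list) \<times> ('l \<times> nat \<Rightarrow> 'l \<times> nat)" where
  "ts_cube_map a b f =
     (f, \<lambda>(x, i)\<in>actions (ts_cube a). (x, hat_inv (length a) f (length b) i))"

text \<open>The functor \<open>T\<close> preserves small colimits, and its restriction to the labelled cubes is
  naturally isomorphic to the functor given by \<open>ts_cube\<close> and \<open>ts_cube_map\<close>. As the labelled cubes
  do not have their cells in the type \<open>'u\<close>, the functor \<open>T\<close> is evaluated on isomorphic copies \<open>Q a\<close>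
  of them. A map \<open>F\<close> of labelled cubes corresponds by the Yoneda lemma to the morphism
  \<open>box_map (length a) F\<close>, its value on the identity.\<close>

definition is_realization :: "'u set set \<Rightarrow>
    (('u, 'l) lps, ('u, 'l) lps_arr, ('u, 'u, 'l) ts, ('u, 'l) ts_arr) ftor \<Rightarrow> bool" where
  "is_realization U T \<longleftrightarrow>
     is_functor (LPS U) (WHDTS U) T \<and>
     preserves_small_colimits U (LPS U) (WHDTS U) T \<and>
     (\<exists>Q q \<theta>.
        (\<forall>a. Q a \<in> Obj (LPS U) \<and> lps_iso (labelled_cube a) (Q a) (q a) \<and>
             whdts_iso (ts_cube a) (fobj T (Q a)) (\<theta> a)) \<and>
        (\<forall>a b F G t0 t1.
           lps_hom (labelled_cube a) (labelled_cube b) F \<longrightarrow>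
           (Q a, G, Q b) \<in> Arr (LPS U) \<longrightarrow>
           (\<forall>n. \<forall>x\<in>cells (fst (labelled_cube a)) n. G n (q a n x) = q b n (F n x)) \<longrightarrow>
           farr T (Q a, G, Q b) = (fobj T (Q a), (t0, t1), fobj T (Q b)) \<longrightarrow>
           (\<forall>\<epsilon>\<in>states (ts_cube a).
              t0 (fst (\<theta> a) \<epsilon>) = fst (\<theta> b) (fst (ts_cube_map a b (box_map (length a) F)) \<epsilon>)) \<and>
           (\<forall>u\<in>actions (ts_cube a).
              t1 (snd (\<theta> a) u) = snd (\<theta> b) (snd (ts_cube_map a b (box_map (length a) F)) u))))"

end

theory Submission
  imports Defs "HOL-Library.Countable_Set"
begin

text \<open>The functor \<open>T\<close> has a right adjoint whose values satisfy the HDA paradigm, and this is all that the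
  factorization needs.

  The right adjoint is a nerve: an \<open>n\<close>-cell of \<open>nerve Y\<close> is a word \<open>a\<close> of length \<open>n\<close> together with an
  arrow from the realized cube of \<open>a\<close> to \<open>Y\<close>. By the Yoneda lemma, arrows from a labelled cube to
  \<open>nerve Y\<close> are arrows from its realization to \<open>Y\<close>. Every labelled symmetric precubical set is the
  canonical colimit of labelled cubes (\<open>dense_cubes\<close>), and \<open>T\<close> preserves this colimit, so the same
  correspondence holds for all objects (\<open>couniversal_arrow_if_dense\<close>, \<open>nerve_couniversal\<close>).

  The nerve satisfies the paradigm (\<open>HDA_paradigm_nerve\<close>): as a word is part of a cell, two fillings of
  the same boundary are two arrows \<open>g\<close> and \<open>h\<close> from one realized cube that agree on its faces. In
  dimension at least \<open>2\<close> each state and each action of the cube lies on a face, so \<open>g = h\<close>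
  (\<open>determined_on_faces\<close>).

  The rest is formal (\<open>factorization_through_reflection\<close>). Arrows from \<open>T X\<close> to \<open>Y\<close> are arrows from
  \<open>X\<close> to \<open>nerve Y\<close>. As \<open>nerve Y\<close> lies in the reflective subcategory, they are arrows from \<open>Sh X\<close> to
  \<open>nerve Y\<close>, hence arrows from \<open>T (Sh X)\<close> to \<open>Y\<close>. So \<open>T\<close> inverts the unit of the reflection, and the
  restriction of \<open>T\<close> composed with \<open>Sh\<close> is isomorphic to \<open>T\<close>. The nerve is right adjoint to this
  restriction as well. If also \<open>T\<close> is isomorphic to \<open>F\<close> composed with \<open>Sh\<close>, then restricting this
  isomorphism to the subcategory, where the unit is invertible, identifies \<open>F\<close> with the restriction
  of \<open>T\<close>.\<close>

section \<open>Adjunctions and reflections\<close>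

lemma hom_objs:
  assumes "category C" "f \<in> hom C X Y"
  shows "X \<in> Obj C" "Y \<in> Obj C"
  using assms unfolding category_def hom_def by auto

lemma Idn_hom: "category C \<Longrightarrow> X \<in> Obj C \<Longrightarrow> Idn C X \<in> hom C X X"
  unfolding category_def by blast

lemma Cmp_hom: "category C \<Longrightarrow> f \<in> hom C X Y \<Longrightarrow> g \<in> hom C Y Z \<Longrightarrow> Cmp C g f \<in> hom C X Z"
  unfolding category_def by blast

lemma Cmp_Idn_right: "category C \<Longrightarrow> f \<in> hom C X Y \<Longrightarrow> Cmp C f (Idn C X) = f"
  unfolding category_def by blast

lemma Cmp_Idn_left: "category C \<Longrightarrow> f \<in> hom C X Y \<Longrightarrow> Cmp C (Idn C Y) f = f"
  unfolding category_def by blast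

lemma Cmp_assoc:
  "category C \<Longrightarrow> f \<in> hom C W X \<Longrightarrow> g \<in> hom C X Y \<Longrightarrow> h \<in> hom C Y Z \<Longrightarrow>
     Cmp C h (Cmp C g f) = Cmp C (Cmp C h g) f"
  unfolding category_def by blast

lemma functor_obj: "is_functor C D F \<Longrightarrow> X \<in> Obj C \<Longrightarrow> fobj F X \<in> Obj D"
  unfolding is_functor_def by blast

lemma functor_hom: "is_functor C D F \<Longrightarrow> f \<in> hom C X Y \<Longrightarrow> farr F f \<in> hom D (fobj F X) (fobj F Y)"
  unfolding is_functor_def by blast

lemma functor_Idn: "is_functor C D F \<Longrightarrow> X \<in> Obj C \<Longrightarrow> farr F (Idn C X) = Idn D (fobj F X)"
  unfolding is_functor_def by blast

lemma functor_Cmp: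
  "is_functor C D F \<Longrightarrow> f \<in> hom C X Y \<Longrightarrow> g \<in> hom C Y Z \<Longrightarrow>
     farr F (Cmp C g f) = Cmp D (farr F g) (farr F f)"
  unfolding is_functor_def by blast

lemma ftor_comp_simps [simp]:
  "fobj (ftor_comp G F) X = fobj G (fobj F X)" "farr (ftor_comp G F) f = farr G (farr F f)"
  by (simp_all add: ftor_comp_def)

lemma ftor_comp_functor:
  assumes F: "is_functor C D F" and G: "is_functor D E G"
  shows "is_functor C E (ftor_comp G F)"
  unfolding is_functor_def ftor_comp_simps
proof (intro conjI ballI allI impI)
  show "farr G (farr F (Cmp C g f)) = Cmp E (farr G (farr F g)) (farr G (farr F f))"
    if "f \<in> hom C X Y" "g \<in> hom C Y Z" for X Y Z f g
    using functor_Cmp[OF F that] functor_Cmp[OF G functor_hom[OF F that(1)] functor_hom[OF F that(2)]]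
    by simp
qed (use functor_obj[OF G functor_obj[OF F]] functor_hom[OF G functor_hom[OF F]]
      functor_Idn[OF F] functor_Idn[OF G functor_obj[OF F]] in auto)

lemma full_subcategory_simps [simp]:
  "X \<in> Obj (full_subcategory C P) \<longleftrightarrow> X \<in> Obj C \<and> P X"
  "Idn (full_subcategory C P) = Idn C" "Cmp (full_subcategory C P) = Cmp C"
  by (simp_all add: full_subcategory_def)

lemma hom_full_subcategory:
  "f \<in> hom (full_subcategory C P) X Y \<longleftrightarrow> f \<in> hom C X Y \<and> P X \<and> P Y"
  by (auto simp: full_subcategory_def hom_def)

lemma category_full_subcategory:
  assumes "category C" shows "category (full_subcategory C P)"
  unfolding category_def hom_full_subcategory full_subcategory_simps
proof (intro conjI ballI allI impI)
  fix f assume "f \<in> Arr (full_subcategory C P)"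
  then show "Src (full_subcategory C P) f \<in> Obj C" "Tgt (full_subcategory C P) f \<in> Obj C"
    "P (Src (full_subcategory C P) f)" "P (Tgt (full_subcategory C P) f)"
    using assms by (auto simp: full_subcategory_def category_def)
qed (use assms in \<open>auto intro: Idn_hom Cmp_hom simp: Cmp_Idn_left Cmp_Idn_right Cmp_assoc\<close>)

lemma functor_full_subcategory:
  "is_functor C D F \<Longrightarrow> is_functor (full_subcategory C P) D F"
  by (auto simp: is_functor_def hom_full_subcategory)

subsection \<open>Natural isomorphisms\<close>

lemma iso_arr_comp:
  assumes "category C" "iso_arr C X Y f" "iso_arr C Y Z g"
  shows "iso_arr C X Z (Cmp C g f)"
proof -
  obtain f' g' where f: "f \<in> hom C X Y" "f' \<in> hom C Y X" "Cmp C f' f = Idn C X" "Cmp C f f' = Idn C Y"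
    and g: "g \<in> hom C Y Z" "g' \<in> hom C Z Y" "Cmp C g' g = Idn C Y" "Cmp C g g' = Idn C Z"
    using assms unfolding iso_arr_def by blast
  have gf: "Cmp C g f \<in> hom C X Z" "Cmp C f' g' \<in> hom C Z X"
    using assms(1) f g by (auto intro: Cmp_hom)
  have "Cmp C (Cmp C f' g') (Cmp C g f) = Cmp C f' (Cmp C (Cmp C g' g) f)"
    using Cmp_assoc[OF assms(1) f(1) g(1,2)] Cmp_assoc[OF assms(1) gf(1) g(2) f(2)] by simp
  also have "\<dots> = Idn C X" using assms(1) f g by (simp add: Cmp_Idn_left)
  finally have 1: "Cmp C (Cmp C f' g') (Cmp C g f) = Idn C X" .
  have "Cmp C (Cmp C g f) (Cmp C f' g') = Cmp C g (Cmp C (Cmp C f f') g')"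
    using Cmp_assoc[OF assms(1) g(2) f(2,1)] Cmp_assoc[OF assms(1) gf(2) f(1) g(1)] by simp
  also have "\<dots> = Idn C Z" using assms(1) f g by (simp add: Cmp_Idn_left)
  finally show ?thesis using 1 gf unfolding iso_arr_def by blast
qed

lemma iso_arr_functor:
  assumes "is_functor C D F" "category C" "iso_arr C X Y f"
  shows "iso_arr D (fobj F X) (fobj F Y) (farr F f)"
proof -
  obtain g where g: "f \<in> hom C X Y" "g \<in> hom C Y X" "Cmp C g f = Idn C X" "Cmp C f g = Idn C Y"
    using assms(3) unfolding iso_arr_def by blast
  have "X \<in> Obj C" "Y \<in> Obj C" using assms(2) g(1) by (auto dest: hom_objs)
  then have "Cmp D (farr F g) (farr F f) = Idn D (fobj F X)" "Cmp D (farr F f) (farr F g) = Idn D (fobj F Y)"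
    using assms(1) g functor_Cmp[OF assms(1)] functor_Idn[OF assms(1)] by metis+
  then show ?thesis using g functor_hom[OF assms(1)] unfolding iso_arr_def by blast
qed

lemma naturally_isomorphic_sym:
  assumes D: "category D" and F: "is_functor C D F" and G: "is_functor C D G"
    and C: "category C" and iso: "naturally_isomorphic C D F G"
  shows "naturally_isomorphic C D G F"
proof -
  obtain \<tau> where \<tau>: "\<And>X. X \<in> Obj C \<Longrightarrow> iso_arr D (fobj F X) (fobj G X) (\<tau> X)"
    and nat: "\<And>X Y f. f \<in> hom C X Y \<Longrightarrow> Cmp D (\<tau> Y) (farr F f) = Cmp D (farr G f) (\<tau> X)"
    using iso unfolding naturally_isomorphic_def by blast
  have "\<forall>X\<in>Obj C. \<exists>s. s \<in> hom D (fobj G X) (fobj F X) \<and>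
      Cmp D s (\<tau> X) = Idn D (fobj F X) \<and> Cmp D (\<tau> X) s = Idn D (fobj G X)"
    using \<tau> unfolding iso_arr_def by blast
  then obtain s where s: "\<And>X. X \<in> Obj C \<Longrightarrow> s X \<in> hom D (fobj G X) (fobj F X)"
    "\<And>X. X \<in> Obj C \<Longrightarrow> Cmp D (s X) (\<tau> X) = Idn D (fobj F X)"
    "\<And>X. X \<in> Obj C \<Longrightarrow> Cmp D (\<tau> X) (s X) = Idn D (fobj G X)"
    by metis
  have t: "\<tau> X \<in> hom D (fobj F X) (fobj G X)" if "X \<in> Obj C" for X
    using \<tau>[OF that] unfolding iso_arr_def by blast
  have "iso_arr D (fobj G X) (fobj F X) (s X)" if "X \<in> Obj C" for X
    using s that t[OF that] unfolding iso_arr_def by blast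
  moreover have "Cmp D (s Y) (farr G f) = Cmp D (farr F f) (s X)" if f: "f \<in> hom C X Y" for X Y f
  proof -
    have XY: "X \<in> Obj C" "Y \<in> Obj C" using hom_objs[OF C f] .
    have Gf: "farr G f \<in> hom D (fobj G X) (fobj G Y)" and Ff: "farr F f \<in> hom D (fobj F X) (fobj F Y)"
      using f F G by (auto intro: functor_hom)
    note h = s(1)[OF XY(1)] s(1)[OF XY(2)] t[OF XY(1)] t[OF XY(2)]
    have "Cmp D (s Y) (farr G f) = Cmp D (s Y) (Cmp D (Cmp D (farr G f) (\<tau> X)) (s X))"
      using Cmp_assoc[OF D h(1,3) Gf] Cmp_Idn_right[OF D Gf] s(3)[OF XY(1)] by simp
    also have "\<dots> = Cmp D (Cmp D (s Y) (Cmp D (\<tau> Y) (farr F f))) (s X)"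
      using Cmp_assoc[OF D h(1) Cmp_hom[OF D Ff h(4)] h(2)] nat[OF f] by simp
    also have "\<dots> = Cmp D (farr F f) (s X)"
      using Cmp_assoc[OF D Ff h(4,2)] Cmp_Idn_left[OF D Ff] s(2)[OF XY(2)] by simp
    finally show ?thesis .
  qed
  ultimately show ?thesis unfolding naturally_isomorphic_def by blast
qed

lemma naturally_isomorphic_trans:
  assumes D: "category D" and C: "category C"
    and F: "is_functor C D F" and G: "is_functor C D G" and H: "is_functor C D H"
    and "naturally_isomorphic C D F G" "naturally_isomorphic C D G H"
  shows "naturally_isomorphic C D F H"
proof -
  obtain \<sigma> where \<sigma>: "\<And>X. X \<in> Obj C \<Longrightarrow> iso_arr D (fobj F X) (fobj G X) (\<sigma> X)"
    and nat\<sigma>: "\<And>X Y f. f \<in> hom C X Y \<Longrightarrow> Cmp D (\<sigma> Y) (farr F f) = Cmp D (farr G f) (\<sigma> X)"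
    using assms(6) unfolding naturally_isomorphic_def by blast
  obtain \<tau> where \<tau>: "\<And>X. X \<in> Obj C \<Longrightarrow> iso_arr D (fobj G X) (fobj H X) (\<tau> X)"
    and nat\<tau>: "\<And>X Y f. f \<in> hom C X Y \<Longrightarrow> Cmp D (\<tau> Y) (farr G f) = Cmp D (farr H f) (\<tau> X)"
    using assms(7) unfolding naturally_isomorphic_def by blast
  have "Cmp D (Cmp D (\<tau> Y) (\<sigma> Y)) (farr F f) = Cmp D (farr H f) (Cmp D (\<tau> X) (\<sigma> X))"
    if f: "f \<in> hom C X Y" for X Y f
  proof -
    have XY: "X \<in> Obj C" "Y \<in> Obj C" using hom_objs[OF C f] .
    have h: "\<sigma> X \<in> hom D (fobj F X) (fobj G X)" "\<sigma> Y \<in> hom D (fobj F Y) (fobj G Y)"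
      "\<tau> X \<in> hom D (fobj G X) (fobj H X)" "\<tau> Y \<in> hom D (fobj G Y) (fobj H Y)"
      using \<sigma> \<tau> XY unfolding iso_arr_def by auto
    note fh = functor_hom[OF F f] functor_hom[OF G f] functor_hom[OF H f]
    show ?thesis
      using Cmp_assoc[OF D fh(1) h(2) h(4)] Cmp_assoc[OF D h(1) fh(2) h(4)]
        Cmp_assoc[OF D h(1) h(3) fh(3)] nat\<sigma>[OF f] nat\<tau>[OF f] by simp
  qed
  then show ?thesis using \<sigma> \<tau> iso_arr_comp[OF D] unfolding naturally_isomorphic_def
    by (intro exI[of _ "\<lambda>X. Cmp D (\<tau> X) (\<sigma> X)"]) blast
qed

lemma naturally_isomorphic_full_subcategory:
  assumes "naturally_isomorphic C D F G"
  shows "naturally_isomorphic (full_subcategory C P) D F G"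
proof -
  obtain \<tau> where "\<forall>X\<in>Obj C. iso_arr D (fobj F X) (fobj G X) (\<tau> X)"
    "\<forall>X Y f. f \<in> hom C X Y \<longrightarrow> Cmp D (\<tau> Y) (farr F f) = Cmp D (farr G f) (\<tau> X)"
    using assms unfolding naturally_isomorphic_def by blast
  then show ?thesis unfolding naturally_isomorphic_def
    by (intro exI[of _ \<tau>]) (simp add: hom_full_subcategory)
qed

subsection \<open>Couniversal arrows\<close>

text \<open>The pair \<open>(G, \<epsilon>)\<close> is a terminal object of the category of arrows from the image of \<open>F\<close> to \<open>Y\<close>: the
  value at \<open>Y\<close> of a right adjoint of \<open>F\<close>, with its counit.\<close>

definition couniversal_arrow ::
    "('o, 'a) cat \<Rightarrow> ('p, 'b) cat \<Rightarrow> ('o, 'a, 'p, 'b) ftor \<Rightarrow> 'p \<Rightarrow> 'o \<Rightarrow> 'b \<Rightarrow> bool" where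
  "couniversal_arrow C D F Y G \<epsilon> \<longleftrightarrow> G \<in> Obj C \<and> \<epsilon> \<in> hom D (fobj F G) Y \<and>
     (\<forall>X\<in>Obj C. \<forall>h\<in>hom D (fobj F X) Y. \<exists>!g. g \<in> hom C X G \<and> Cmp D \<epsilon> (farr F g) = h)"

text \<open>The right adjoint sends \<open>k\<close> to the unique factorization of \<open>k \<circ> \<epsilon>\<close> through the couniversal arrow.\<close>

lemma left_adjoint_if_couniversal_arrows:
  assumes C: "category C" and D: "category D" and F: "is_functor C D F"
    and ex: "\<And>Y. Y \<in> Obj D \<Longrightarrow> \<exists>G \<epsilon>. couniversal_arrow C D F Y G \<epsilon>"
  shows "is_left_adjoint C D F"
proof -
  obtain G \<epsilon> where cu: "\<And>Y. Y \<in> Obj D \<Longrightarrow> couniversal_arrow C D F Y (G Y) (\<epsilon> Y)"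
    using ex by metis
  have G: "G Y \<in> Obj C" and \<epsilon>: "\<epsilon> Y \<in> hom D (fobj F (G Y)) Y" if "Y \<in> Obj D" for Y
    using cu[OF that] unfolding couniversal_arrow_def by auto
  define tr where "tr X Y h = (THE g. g \<in> hom C X (G Y) \<and> Cmp D (\<epsilon> Y) (farr F g) = h)" for X Y h
  have ex1: "\<exists>!g. g \<in> hom C X (G Y) \<and> Cmp D (\<epsilon> Y) (farr F g) = h"
    if "Y \<in> Obj D" "X \<in> Obj C" "h \<in> hom D (fobj F X) Y" for X Y h
    using cu[OF that(1)] that(2,3) unfolding couniversal_arrow_def by blast
  have tr: "tr X Y h \<in> hom C X (G Y)" "Cmp D (\<epsilon> Y) (farr F (tr X Y h)) = h"
    if "Y \<in> Obj D" "X \<in> Obj C" "h \<in> hom D (fobj F X) Y" for X Y h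
    using theI'[OF ex1[OF that]] unfolding tr_def by auto
  have trI: "tr X Y h = g"
    if "Y \<in> Obj D" "g \<in> hom C X (G Y)" "Cmp D (\<epsilon> Y) (farr F g) = h" for X Y h g
  proof -
    have "h \<in> hom D (fobj F X) Y"
      using Cmp_hom[OF D functor_hom[OF F that(2)] \<epsilon>[OF that(1)]] that(3) by simp
    from ex1[OF that(1) hom_objs(1)[OF C that(2)] this] show ?thesis
      unfolding tr_def using that by (intro the1_equality) auto
  qed
  define R where "R = \<lparr>fobj = G, farr = \<lambda>k. tr (G (Src D k)) (Tgt D k) (Cmp D k (\<epsilon> (Src D k)))\<rparr>"
  have R: "farr R k \<in> hom C (G Y) (G Z)" "Cmp D (\<epsilon> Z) (farr F (farr R k)) = Cmp D k (\<epsilon> Y)"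
    if k: "k \<in> hom D Y Z" for k Y Z
  proof -
    have YZ: "Y \<in> Obj D" "Z \<in> Obj D" using hom_objs[OF D k] .
    have "Src D k = Y" "Tgt D k = Z" using k by (auto simp: hom_def)
    then show "farr R k \<in> hom C (G Y) (G Z)" "Cmp D (\<epsilon> Z) (farr F (farr R k)) = Cmp D k (\<epsilon> Y)"
      using tr[OF YZ(2) G[OF YZ(1)] Cmp_hom[OF D \<epsilon>[OF YZ(1)] k]] by (auto simp: R_def)
  qed
  have uniq: "g = g'" if "Y \<in> Obj D" "g \<in> hom C X (G Y)" "g' \<in> hom C X (G Y)"
    "Cmp D (\<epsilon> Y) (farr F g) = Cmp D (\<epsilon> Y) (farr F g')" for X Y g g'
    using trI[OF that(1,2) that(4)] trI[OF that(1,3) refl] by simp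
  \<comment> \<open>Every equation between arrows into \<open>G Z\<close> follows by comparing the composites with \<open>\<epsilon> Z\<close>.\<close>
  have R_nat: "Cmp D (\<epsilon> Z) (farr F (Cmp C (farr R k) g)) = Cmp D k (Cmp D (\<epsilon> Y) (farr F g))"
    if k: "k \<in> hom D Y Z" and g: "g \<in> hom C X (G Y)" for k Y Z X g
  proof -
    have YZ: "Y \<in> Obj D" "Z \<in> Obj D" using hom_objs[OF D k] .
    note Rk = R[OF k] and Fg = functor_hom[OF F g]
    have "Cmp D (\<epsilon> Z) (farr F (Cmp C (farr R k) g)) = Cmp D (Cmp D (\<epsilon> Z) (farr F (farr R k))) (farr F g)"
      using functor_Cmp[OF F g Rk(1)] Cmp_assoc[OF D Fg functor_hom[OF F Rk(1)] \<epsilon>[OF YZ(2)]] by simp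
    also have "\<dots> = Cmp D k (Cmp D (\<epsilon> Y) (farr F g))"
      using Cmp_assoc[OF D Fg \<epsilon>[OF YZ(1)] k] Rk(2) by simp
    finally show ?thesis .
  qed
  have R_functor: "is_functor D C R"
    unfolding is_functor_def
  proof (intro conjI ballI allI impI)
    show "fobj R Y \<in> Obj C" if "Y \<in> Obj D" for Y using G[OF that] by (simp add: R_def)
    show "farr R k \<in> hom C (fobj R Y) (fobj R Z)" if "k \<in> hom D Y Z" for k Y Z
      using R(1)[OF that] by (simp add: R_def)
  next
    fix Y assume Y: "Y \<in> Obj D"
    have "Cmp D (\<epsilon> Y) (farr F (Idn C (G Y))) = \<epsilon> Y"
      using functor_Idn[OF F G[OF Y]] Cmp_Idn_right[OF D \<epsilon>[OF Y]] by simp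
    moreover have "Cmp D (\<epsilon> Y) (farr F (farr R (Idn D Y))) = \<epsilon> Y"
      using R(2)[OF Idn_hom[OF D Y]] Cmp_Idn_left[OF D \<epsilon>[OF Y]] by simp
    ultimately show "farr R (Idn D Y) = Idn C (fobj R Y)"
      using uniq[OF Y R(1)[OF Idn_hom[OF D Y]] Idn_hom[OF C G[OF Y]]] by (simp add: R_def)
  next
    fix Y Z W k l assume k: "k \<in> hom D Y Z" and l: "l \<in> hom D Z W"
    have YZW: "Y \<in> Obj D" "Z \<in> Obj D" "W \<in> Obj D" using hom_objs[OF D k] hom_objs[OF D l] by auto
    have "Cmp D (\<epsilon> W) (farr F (Cmp C (farr R l) (farr R k))) = Cmp D (Cmp D l k) (\<epsilon> Y)"
      using R_nat[OF l R(1)[OF k]] R(2)[OF k] Cmp_assoc[OF D \<epsilon>[OF YZW(1)] k l] by simp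
    then show "farr R (Cmp D l k) = Cmp C (farr R l) (farr R k)"
      using uniq[OF YZW(3) R(1)[OF Cmp_hom[OF D k l]] Cmp_hom[OF C R(1)[OF k] R(1)[OF l]]]
        R(2)[OF Cmp_hom[OF D k l]] by simp
  qed
  have "bij_betw (tr X Y) (hom D (fobj F X) Y) (hom C X (fobj R Y))"
    if X: "X \<in> Obj C" and Y: "Y \<in> Obj D" for X Y
  proof (rule bij_betw_byWitness[where f' = "\<lambda>g. Cmp D (\<epsilon> Y) (farr F g)"])
    show "\<forall>h\<in>hom D (fobj F X) Y. Cmp D (\<epsilon> Y) (farr F (tr X Y h)) = h"
      using tr(2)[OF Y X] by blast
    show "\<forall>g\<in>hom C X (fobj R Y). tr X Y (Cmp D (\<epsilon> Y) (farr F g)) = g"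
      using trI[OF Y] by (simp add: R_def)
    show "tr X Y ` hom D (fobj F X) Y \<subseteq> hom C X (fobj R Y)"
      using tr(1)[OF Y X] by (auto simp: R_def)
    show "(\<lambda>g. Cmp D (\<epsilon> Y) (farr F g)) ` hom C X (fobj R Y) \<subseteq> hom D (fobj F X) Y"
      using Cmp_hom[OF D functor_hom[OF F] \<epsilon>[OF Y]] by (auto simp: R_def)
  qed
  moreover have "tr X' Y' (Cmp D (Cmp D k h) (farr F f)) = Cmp C (Cmp C (farr R k) (tr X Y h)) f"
    if X: "X \<in> Obj C" and Y: "Y \<in> Obj D" and f: "f \<in> hom C X' X"
      and h: "h \<in> hom D (fobj F X) Y" and k: "k \<in> hom D Y Y'" for X X' Y Y' f h k
  proof (rule trI)
    show Y': "Y' \<in> Obj D" using hom_objs[OF D k] by simp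
    note th = tr[OF Y X h]
    have Rth: "Cmp C (farr R k) (tr X Y h) \<in> hom C X (G Y')" using Cmp_hom[OF C th(1) R(1)[OF k]] .
    then show "Cmp C (Cmp C (farr R k) (tr X Y h)) f \<in> hom C X' (G Y')" using Cmp_hom[OF C f] by blast
    show "Cmp D (\<epsilon> Y') (farr F (Cmp C (Cmp C (farr R k) (tr X Y h)) f)) = Cmp D (Cmp D k h) (farr F f)"
      using functor_Cmp[OF F f Rth] Cmp_assoc[OF D functor_hom[OF F f] functor_hom[OF F Rth] \<epsilon>[OF Y']]
        R_nat[OF k th(1)] th(2) by simp
  qed
  ultimately have "adjunction C D F R"
    unfolding adjunction_def using F R_functor by blast
  then show ?thesis unfolding is_left_adjoint_def ..
qed

subsection \<open>Reflections\<close>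

text \<open>The unit is the transpose of the identity of \<open>S X\<close>. Naturality of the transposition makes it
  composition with the unit, which is where the universal property comes from.\<close>

lemma reflection_unit:
  assumes C: "category C" and adj: "adjunction C (full_subcategory C P) S inclusion"
  obtains \<eta> where "\<And>X. X \<in> Obj C \<Longrightarrow> \<eta> X \<in> hom C X (fobj S X)"
    and "\<And>X Z g. X \<in> Obj C \<Longrightarrow> Z \<in> Obj C \<Longrightarrow> P Z \<Longrightarrow> g \<in> hom C X Z \<Longrightarrow>
           \<exists>!k. k \<in> hom C (fobj S X) Z \<and> Cmp C k (\<eta> X) = g"
    and "\<And>X Y f. f \<in> hom C X Y \<Longrightarrow> Cmp C (\<eta> Y) f = Cmp C (farr S f) (\<eta> X)"
proof -
  let ?B = "full_subcategory C P"
  have B: "category ?B" using category_full_subcategory[OF C] .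
  have S: "is_functor C ?B S" using adj unfolding adjunction_def by blast
  obtain \<phi> where bij0: "\<forall>X\<in>Obj C. \<forall>Y\<in>Obj ?B.
      bij_betw (\<phi> X Y) (hom ?B (fobj S X) Y) (hom C X Y)"
    and nat0: "\<forall>X\<in>Obj C. \<forall>X'\<in>Obj C. \<forall>Y\<in>Obj ?B. \<forall>Y'\<in>Obj ?B.
       \<forall>f\<in>hom C X' X. \<forall>h\<in>hom ?B (fobj S X) Y. \<forall>g\<in>hom ?B Y Y'.
       \<phi> X' Y' (Cmp ?B (Cmp ?B g h) (farr S f)) = Cmp C (Cmp C g (\<phi> X Y h)) f"
    using adj unfolding adjunction_def inclusion_def ftor.select_convs id_apply by blast
  note bij = bij0[rule_format] and nat = nat0[rule_format]
  define \<eta> where "\<eta> X = \<phi> X (fobj S X) (Idn C (fobj S X))" for X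
  have SX: "fobj S X \<in> Obj ?B" "Idn C (fobj S X) \<in> hom ?B (fobj S X) (fobj S X)" if "X \<in> Obj C" for X
    using functor_obj[OF S that] Idn_hom[OF B functor_obj[OF S that]] by auto
  have \<eta>: "\<eta> X \<in> hom C X (fobj S X)" if "X \<in> Obj C" for X
    using bij_betwE[OF bij[OF that SX(1)[OF that]]] SX(2)[OF that] by (simp add: \<eta>_def inclusion_def)
  have \<phi>: "\<phi> X Z k = Cmp C k (\<eta> X)" if X: "X \<in> Obj C" and k: "k \<in> hom ?B (fobj S X) Z" for X Z k
  proof -
    have Z: "Z \<in> Obj ?B" using hom_objs[OF B k] by simp
    have kC: "k \<in> hom C (fobj S X) Z" using k by (simp add: hom_full_subcategory)
    note SIdn = functor_Idn[OF S X]
    show ?thesis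
      using nat[OF X X SX(1)[OF X] Z Idn_hom[OF C X] SX(2)[OF X] k]
        Cmp_Idn_right[OF C Cmp_hom[OF C \<eta>[OF X] kC]] SIdn Cmp_Idn_right[OF C kC]
      by (simp add: \<eta>_def inclusion_def)
  qed
  have univ: "\<exists>!k. k \<in> hom C (fobj S X) Z \<and> Cmp C k (\<eta> X) = g"
    if X: "X \<in> Obj C" and Z: "Z \<in> Obj C" "P Z" and g: "g \<in> hom C X Z" for X Z g
  proof -
    have "Z \<in> Obj ?B" using Z by simp
    from bij[OF X this] have b: "bij_betw (\<phi> X Z) (hom ?B (fobj S X) Z) (hom C X Z)"
      by (simp add: inclusion_def)
    have same: "k \<in> hom ?B (fobj S X) Z \<longleftrightarrow> k \<in> hom C (fobj S X) Z" for k
      using SX(1)[OF X] Z by (simp add: hom_full_subcategory)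
    have "g \<in> \<phi> X Z ` hom ?B (fobj S X) Z" using b g by (simp add: bij_betw_def)
    then obtain k where k: "k \<in> hom ?B (fobj S X) Z" "\<phi> X Z k = g" by (elim imageE) simp
    show ?thesis
    proof (rule ex1I)
      show "k \<in> hom C (fobj S X) Z \<and> Cmp C k (\<eta> X) = g" using same[of k] \<phi>[OF X k(1)] k by simp
      fix k' assume k': "k' \<in> hom C (fobj S X) Z \<and> Cmp C k' (\<eta> X) = g"
      then have k'B: "k' \<in> hom ?B (fobj S X) Z" using same[of k'] by simp
      then have "\<phi> X Z k' = \<phi> X Z k" using \<phi>[OF X k'B] k k' by simp
      then show "k' = k" using b k'B k(1) by (auto simp: bij_betw_def dest: inj_onD)
    qed
  qed
  have "Cmp C (\<eta> Y) f = Cmp C (farr S f) (\<eta> X)" if f: "f \<in> hom C X Y" for X Y f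
  proof -
    have XY: "X \<in> Obj C" "Y \<in> Obj C" using hom_objs[OF C f] .
    have Sf: "farr S f \<in> hom ?B (fobj S X) (fobj S Y)" using functor_hom[OF S f] .
    have SfC: "farr S f \<in> hom C (fobj S X) (fobj S Y)" using Sf by (simp add: hom_full_subcategory)
    have I: "Idn C (fobj S Y) \<in> hom C (fobj S Y) (fobj S Y)"
      using SX(2)[OF XY(2)] by (simp add: hom_full_subcategory)
    have "\<phi> X (fobj S Y) (Cmp C (Cmp C (Idn C (fobj S Y)) (Idn C (fobj S Y))) (farr S f)) =
        Cmp C (Cmp C (Idn C (fobj S Y)) (\<eta> Y)) f"
      using nat[OF XY(2,1) SX(1)[OF XY(2)] SX(1)[OF XY(2)] f SX(2)[OF XY(2)] SX(2)[OF XY(2)]]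
      by (simp add: \<eta>_def inclusion_def)
    then show ?thesis
      using \<phi>[OF XY(1) Sf] Cmp_Idn_left[OF C I] Cmp_Idn_left[OF C SfC] Cmp_Idn_left[OF C \<eta>[OF XY(2)]]
      by simp
  qed
  then show thesis using that[of \<eta>, OF \<eta> univ] by simp
qed

text \<open>If the objects \<open>G\<close> that represent the arrows from \<open>T\<close> to the objects of \<open>D\<close> all satisfy \<open>P\<close>,
  then \<open>T\<close> cannot tell \<open>X\<close> from its reflection: arrows from \<open>T X\<close> to \<open>Y\<close> are arrows from \<open>X\<close> to
  \<open>G\<close>, hence arrows from \<open>S X\<close> to \<open>G\<close>, hence arrows from \<open>T (S X)\<close> to \<open>Y\<close>. So \<open>T\<close> inverts the unit,
  and the factorization of \<open>T\<close> is its own restriction. The restriction has the same couniversal arrows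
  as \<open>T\<close>. Uniqueness holds since the unit is already invertible on the subcategory.\<close>

theorem factorization_through_reflection:
  fixes C :: "('o, 'a) cat" and D :: "('p, 'b) cat"
  assumes C: "category C" and D: "category D" and T: "is_functor C D T"
    and adj: "adjunction C (full_subcategory C P) S inclusion"
    and cu: "\<And>Y. Y \<in> Obj D \<Longrightarrow> \<exists>G \<epsilon>. P G \<and> couniversal_arrow C D T Y G \<epsilon>"
  defines "B \<equiv> full_subcategory C P"
  shows "is_functor B D T"
    and "naturally_isomorphic C D T (ftor_comp T S)"
    and "\<And>F. is_functor B D F \<Longrightarrow> naturally_isomorphic C D T (ftor_comp F S) \<Longrightarrow>
           naturally_isomorphic B D F T"
    and "is_left_adjoint B D T"
proof -
  have B: "category B" unfolding B_def using category_full_subcategory[OF C] .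
  show TB: "is_functor B D T" unfolding B_def using functor_full_subcategory[OF T] .
  have S: "is_functor C B S" using adj unfolding adjunction_def B_def by blast
  obtain \<eta> where \<eta>: "\<And>X. X \<in> Obj C \<Longrightarrow> \<eta> X \<in> hom C X (fobj S X)"
    and univ: "\<And>X Z g. X \<in> Obj C \<Longrightarrow> Z \<in> Obj C \<Longrightarrow> P Z \<Longrightarrow> g \<in> hom C X Z \<Longrightarrow>
           \<exists>!k. k \<in> hom C (fobj S X) Z \<and> Cmp C k (\<eta> X) = g"
    and nat: "\<And>X Y f. f \<in> hom C X Y \<Longrightarrow> Cmp C (\<eta> Y) f = Cmp C (farr S f) (\<eta> X)"
    using reflection_unit[OF C adj] by blast
  have SX: "fobj S X \<in> Obj C" "P (fobj S X)" if "X \<in> Obj C" for X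
    using functor_obj[OF S that] by (auto simp: B_def)

  \<comment> \<open>Arrows out of \<open>T X\<close> extend uniquely along \<open>T \<eta>\<close>, because they correspond to arrows from \<open>X\<close>
    into an object that satisfies \<open>P\<close>.\<close>
  have ext: "\<exists>!h. h \<in> hom D (fobj T (fobj S X)) Y \<and> Cmp D h (farr T (\<eta> X)) = k"
    if X: "X \<in> Obj C" and k: "k \<in> hom D (fobj T X) Y" for X Y k
  proof -
    have Y: "Y \<in> Obj D" using hom_objs[OF D k] by simp
    obtain G \<epsilon> where PG: "P G" and G: "couniversal_arrow C D T Y G \<epsilon>" using cu[OF Y] by blast
    have GC: "G \<in> Obj C" and \<epsilon>: "\<epsilon> \<in> hom D (fobj T G) Y"
      and Gu: "\<And>X h. X \<in> Obj C \<Longrightarrow> h \<in> hom D (fobj T X) Y \<Longrightarrow>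
        \<exists>!g. g \<in> hom C X G \<and> Cmp D \<epsilon> (farr T g) = h"
      using G unfolding couniversal_arrow_def by auto
    have comp: "Cmp D (Cmp D \<epsilon> (farr T g)) (farr T (\<eta> X)) = Cmp D \<epsilon> (farr T (Cmp C g (\<eta> X)))"
      if "g \<in> hom C (fobj S X) G" for g
      using functor_Cmp[OF T \<eta>[OF X] that]
        Cmp_assoc[OF D functor_hom[OF T \<eta>[OF X]] functor_hom[OF T that] \<epsilon>] by simp
    obtain g where g: "g \<in> hom C X G" "Cmp D \<epsilon> (farr T g) = k" using Gu[OF X k] by blast
    obtain g' where g': "g' \<in> hom C (fobj S X) G" "Cmp C g' (\<eta> X) = g" using univ[OF X GC PG g(1)] by blast
    show ?thesis
    proof (rule ex1I)
      show "Cmp D \<epsilon> (farr T g') \<in> hom D (fobj T (fobj S X)) Y \<and>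
          Cmp D (Cmp D \<epsilon> (farr T g')) (farr T (\<eta> X)) = k"
        using comp[OF g'(1)] g' g Cmp_hom[OF D functor_hom[OF T g'(1)] \<epsilon>] by simp
      fix h assume h: "h \<in> hom D (fobj T (fobj S X)) Y \<and> Cmp D h (farr T (\<eta> X)) = k"
      then obtain l where l: "l \<in> hom C (fobj S X) G" "Cmp D \<epsilon> (farr T l) = h"
        using Gu[OF SX(1)[OF X]] by blast
      have "Cmp D \<epsilon> (farr T (Cmp C l (\<eta> X))) = k" using comp[OF l(1)] l(2) h by simp
      then have "Cmp C l (\<eta> X) = g" using Gu[OF X k] g Cmp_hom[OF C \<eta>[OF X] l(1)] by blast
      then have "l = g'" using univ[OF X GC PG g(1)] l(1) g' by blast
      then show "h = Cmp D \<epsilon> (farr T g')" using l by simp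
    qed
  qed
  have Tiso: "iso_arr D (fobj T X) (fobj T (fobj S X)) (farr T (\<eta> X))" if X: "X \<in> Obj C" for X
  proof -
    note TX = functor_obj[OF T X] and TSX = functor_obj[OF T SX(1)[OF X]] and T\<eta> = functor_hom[OF T \<eta>[OF X]]
    obtain r where r: "r \<in> hom D (fobj T (fobj S X)) (fobj T X)"
      "Cmp D r (farr T (\<eta> X)) = Idn D (fobj T X)"
      using ext[OF X Idn_hom[OF D TX]] by blast
    have "Cmp D (Cmp D (farr T (\<eta> X)) r) (farr T (\<eta> X)) = farr T (\<eta> X)"
      using Cmp_assoc[OF D T\<eta> r(1) T\<eta>] r(2) Cmp_Idn_right[OF D T\<eta>] by simp
    then have "Cmp D (farr T (\<eta> X)) r = Idn D (fobj T (fobj S X))"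
      using ext[OF X T\<eta>] Cmp_hom[OF D r(1) T\<eta>] Idn_hom[OF D TSX] Cmp_Idn_left[OF D T\<eta>] by blast
    then show ?thesis using r T\<eta> unfolding iso_arr_def by blast
  qed
  show TTS: "naturally_isomorphic C D T (ftor_comp T S)"
  proof -
    have "Cmp D (farr T (\<eta> Y)) (farr T f) = Cmp D (farr T (farr S f)) (farr T (\<eta> X))"
      if f: "f \<in> hom C X Y" for X Y f
    proof -
      have XY: "X \<in> Obj C" "Y \<in> Obj C" using hom_objs[OF C f] .
      have "farr S f \<in> hom C (fobj S X) (fobj S Y)"
        using functor_hom[OF S f] by (simp add: B_def hom_full_subcategory)
      then show ?thesis
        using functor_Cmp[OF T f \<eta>[OF XY(2)]] functor_Cmp[OF T \<eta>[OF XY(1)]] nat[OF f] by metis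
    qed
    then show ?thesis using Tiso unfolding naturally_isomorphic_def
      by (intro exI[of _ "\<lambda>X. farr T (\<eta> X)"]) simp
  qed

  \<comment> \<open>On an object of the subcategory, the identity extends along the unit to an inverse of it.\<close>
  have \<eta>iso: "iso_arr B Z (fobj S Z) (\<eta> Z)" if Z: "Z \<in> Obj B" for Z
  proof -
    have ZC: "Z \<in> Obj C" "P Z" using Z by (auto simp: B_def)
    note SZ = SX[OF ZC(1)] and \<eta>Z = \<eta>[OF ZC(1)]
    obtain r where r: "r \<in> hom C (fobj S Z) Z" "Cmp C r (\<eta> Z) = Idn C Z"
      using univ[OF ZC(1) ZC Idn_hom[OF C ZC(1)]] by blast
    have "Cmp C (Cmp C (\<eta> Z) r) (\<eta> Z) = \<eta> Z"
      using Cmp_assoc[OF C \<eta>Z r(1) \<eta>Z] r(2) Cmp_Idn_right[OF C \<eta>Z] by simp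
    then have "Cmp C (\<eta> Z) r = Idn C (fobj S Z)"
      using univ[OF ZC(1) SZ \<eta>Z] Cmp_hom[OF C r(1) \<eta>Z] Idn_hom[OF C SZ(1)] Cmp_Idn_left[OF C \<eta>Z] by blast
    then show ?thesis using r \<eta>Z SZ ZC unfolding iso_arr_def B_def by (auto simp: hom_full_subcategory)
  qed
  show "naturally_isomorphic B D F T"
    if F: "is_functor B D F" and TF: "naturally_isomorphic C D T (ftor_comp F S)" for F
  proof -
    note FS = ftor_comp_functor[OF S F]
    have FSB: "is_functor B D (ftor_comp F S)" unfolding B_def using functor_full_subcategory[OF FS] .
    have "naturally_isomorphic C D (ftor_comp F S) T" using naturally_isomorphic_sym[OF D T FS C TF] .
    then have FST: "naturally_isomorphic B D (ftor_comp F S) T"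
      unfolding B_def by (rule naturally_isomorphic_full_subcategory)
    have "Cmp D (farr F (\<eta> Y)) (farr F f) = Cmp D (farr F (farr S f)) (farr F (\<eta> X))"
      if f: "f \<in> hom B X Y" for X Y f
    proof -
      have XY: "X \<in> Obj B" "Y \<in> Obj B" using hom_objs[OF B f] .
      have fC: "f \<in> hom C X Y" using f by (simp add: B_def hom_full_subcategory)
      have \<eta>B: "\<eta> X \<in> hom B X (fobj S X)" "\<eta> Y \<in> hom B Y (fobj S Y)"
        using \<eta>iso XY unfolding iso_arr_def by auto
      have "Cmp B (\<eta> Y) f = Cmp B (farr S f) (\<eta> X)" using nat[OF fC] by (simp add: B_def)
      then show ?thesis
        using functor_Cmp[OF F f \<eta>B(2)] functor_Cmp[OF F \<eta>B(1) functor_hom[OF S fC]] by simp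
    qed
    then have "naturally_isomorphic B D F (ftor_comp F S)"
      using iso_arr_functor[OF F B \<eta>iso] unfolding naturally_isomorphic_def
      by (intro exI[of _ "\<lambda>X. farr F (\<eta> X)"]) simp
    then show ?thesis using naturally_isomorphic_trans[OF D B F FSB TB _ FST] by blast
  qed

  show "is_left_adjoint B D T"
  proof (rule left_adjoint_if_couniversal_arrows[OF B D TB])
    fix Y assume "Y \<in> Obj D"
    then obtain G \<epsilon> where "P G" "couniversal_arrow C D T Y G \<epsilon>" using cu by blast
    then have "couniversal_arrow B D T Y G \<epsilon>"
      unfolding couniversal_arrow_def B_def by (auto simp: hom_full_subcategory)
    then show "\<exists>G \<epsilon>. couniversal_arrow B D T Y G \<epsilon>" by blast
  qed
qed

section \<open>Small sets\<close>

lemma universe_infinite: "universe U \<Longrightarrow> \<exists>N\<in>U. infinite N"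
  unfolding universe_def by (elim conjE)

lemma universe_subset: "universe U \<Longrightarrow> A \<in> U \<Longrightarrow> B \<subseteq> A \<Longrightarrow> B \<in> U"
  unfolding universe_def by (elim conjE) simp

lemma universe_UN: "universe U \<Longrightarrow> I \<in> U \<Longrightarrow> (\<And>i. i \<in> I \<Longrightarrow> A i \<in> U) \<Longrightarrow> (\<Union>i\<in>I. A i) \<in> U"
  unfolding universe_def by (elim conjE) simp

definition small :: "'u set set \<Rightarrow> 'a set \<Rightarrow> bool" where
  "small U A \<longleftrightarrow> (\<exists>e :: 'a \<Rightarrow> 'u. inj_on e A \<and> e ` A \<in> U)"

lemma small_inj:
  assumes U: "universe U" and B: "small U B" and f: "inj_on f A" "f ` A \<subseteq> B"
  shows "small U A"
proof -
  obtain e where e: "inj_on e B" "e ` B \<in> U" using B unfolding small_def by blast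
  have "inj_on (e \<circ> f) A" using f e inj_on_subset comp_inj_on by blast
  moreover have "(e \<circ> f) ` A \<subseteq> e ` B" using f by auto
  then have "(e \<circ> f) ` A \<in> U" using universe_subset[OF U e(2)] by blast
  ultimately show ?thesis unfolding small_def by blast
qed

lemma small_subset: "universe U \<Longrightarrow> small U B \<Longrightarrow> A \<subseteq> B \<Longrightarrow> small U A"
  by (rule small_inj[of U B id]) auto

lemma small_mem: "A \<in> U \<Longrightarrow> small U A"
  unfolding small_def by (intro exI[of _ id]) auto

lemma small_countable:
  assumes U: "universe U" and A: "countable A" shows "small U A"
proof -
  obtain N where N: "N \<in> U" "infinite N" using universe_infinite[OF U] by (elim bexE)
  obtain f :: "nat \<Rightarrow> 'a" where f: "inj f" "range f \<subseteq> N" using infinite_countable_subset[OF N(2)] by blast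
  have "inj_on (f \<circ> to_nat_on A) A"
    using comp_inj_on[OF inj_on_to_nat_on[OF A] inj_on_subset[OF f(1) subset_UNIV]] .
  moreover have "(f \<circ> to_nat_on A) ` A \<subseteq> N" using f(2) by auto
  ultimately show ?thesis using small_inj[OF U small_mem[OF N(1)]] by blast
qed

text \<open>All the fibres and the index set embed into one infinite small set \<open>W\<close>, so the sum embeds into
  \<open>W \<times> W\<close>, which is equipotent to \<open>W\<close>.\<close>

lemma small_Sigma:
  assumes U: "universe U" and I: "small U I" and A: "\<And>i. i \<in> I \<Longrightarrow> small U (A i)"
  shows "small U (Sigma I A)"
proof -
  obtain e where e: "inj_on e I" "e ` I \<in> U" using I unfolding small_def by blast
  obtain d where d: "\<And>i. i \<in> I \<Longrightarrow> inj_on (d i) (A i)" "\<And>i. i \<in> I \<Longrightarrow> d i ` A i \<in> U"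
    using A unfolding small_def by metis
  have Union: "(\<Union>j\<in>J. B j) \<in> U" if "J \<in> U" "\<And>j. j \<in> J \<Longrightarrow> B j \<in> U" for J B
    using universe_UN[OF U that(1)] that(2) by blast
  obtain N where N: "N \<in> U" "infinite N" using universe_infinite[OF U] by (elim bexE)
  \<comment> \<open>A union of two sets is a union indexed by a two-element subset of \<open>N\<close>.\<close>
  have Un: "X \<union> Y \<in> U" if "X \<in> U" "Y \<in> U" for X Y
  proof -
    obtain a b where "a \<in> N" "b \<in> N" "a \<noteq> b"
      using N(2) by (metis finite.emptyI finite.insertI finite_subset insertI1 subsetI singletonI)
    then have "{a, b} \<in> U" using universe_subset[OF U N(1)] by simp
    then have "(\<Union>j\<in>{a, b}. if j = a then X else Y) \<in> U" using that by (intro Union) auto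
    moreover have "(\<Union>j\<in>{a, b}. if j = a then X else Y) = X \<union> Y" using \<open>a \<noteq> b\<close> by auto
    ultimately show ?thesis by simp
  qed
  have "(\<Union>j\<in>e ` I. d (inv_into I e j) ` A (inv_into I e j)) \<in> U"
    using e d(2) by (intro Union) (auto simp: inv_into_into)
  moreover define W where "W = (\<Union>j\<in>e ` I. d (inv_into I e j) ` A (inv_into I e j)) \<union> e ` I \<union> N"
  ultimately have W: "W \<in> U" "infinite W" using Un e(2) N by auto
  obtain p where p: "bij_betw p (W \<times> W) W"
    using card_of_Times_same_infinite[OF W(2)] card_of_ordIso by blast
  let ?f = "\<lambda>(i, a). (e i, d i a)"
  have "inj_on ?f (Sigma I A)"
  proof (rule inj_onI, clarsimp)
    fix i a i' a' assume *: "i \<in> I" "a \<in> A i" "i' \<in> I" "a' \<in> A i'" "e i = e i'" "d i a = d i' a'"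
    then have "i = i'" using e(1) by (auto dest: inj_onD)
    then show "i = i' \<and> a = a'" using * d(1)[of i] by (auto dest: inj_onD)
  qed
  moreover have sub: "?f ` Sigma I A \<subseteq> W \<times> W"
    using e(1) by (auto simp: W_def)
  ultimately have "inj_on (p \<circ> ?f) (Sigma I A)"
    using p unfolding bij_betw_def by (meson comp_inj_on inj_on_subset)
  moreover have "(p \<circ> ?f) ` Sigma I A \<subseteq> W"
    using sub p unfolding bij_betw_def by fastforce
  ultimately show ?thesis using small_inj[OF U small_mem[OF W(1)]] by blast
qed

lemma small_lists:
  assumes U: "universe U" and A: "small U A"
  shows "small U (lists A)"
proof -
  have n: "small U {xs \<in> lists A. length xs = n}" for n
  proof (induction n)
    case 0
    have "{xs \<in> lists A. length xs = 0} = {[]}" by auto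
    then show ?case using small_countable[OF U, of "{[]}"] by simp
  next
    case (Suc n)
    show ?case
    proof (rule small_inj[OF U])
      show "small U (A \<times> {xs \<in> lists A. length xs = n})" by (intro small_Sigma[OF U A] Suc)
      show "inj_on (\<lambda>xs. (hd xs, tl xs)) {xs \<in> lists A. length xs = Suc n}"
      proof (rule inj_on_inverseI)
        show "case_prod (#) (hd xs, tl xs) = xs" if "xs \<in> {xs \<in> lists A. length xs = Suc n}" for xs
          using that by (cases xs) auto
      qed
      show "(\<lambda>xs. (hd xs, tl xs)) ` {xs \<in> lists A. length xs = Suc n} \<subseteq> A \<times> {xs \<in> lists A. length xs = n}"
      proof (rule image_subsetI)
        show "(hd xs, tl xs) \<in> A \<times> {xs \<in> lists A. length xs = n}"
          if "xs \<in> {xs \<in> lists A. length xs = Suc n}" for xs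
          using that by (cases xs) auto
      qed
    qed
  qed
  show ?thesis
  proof (rule small_inj[OF U])
    show "small U (Sigma UNIV (\<lambda>n. {xs \<in> lists A. length xs = n}))"
      by (intro small_Sigma[OF U] n small_countable[OF U]) simp
    show "inj_on (\<lambda>xs. (length xs, xs)) (lists A)" by (rule inj_onI) simp
  qed auto
qed

section \<open>Adjoints of functors on a category with a dense family\<close>

subsection \<open>Colimits indexed by small categories\<close>

lemma ftor_comp_inclusion: "ftor_comp inclusion F = F"
  by (cases F) (simp add: ftor_comp_def inclusion_def)

text \<open>Colimit preservation speaks of index categories whose objects and arrows are elements of \<open>'u\<close>;
  an index category of any other small size has an isomorphic copy of this kind.\<close>

lemma preserves_colimit_small_index:
  fixes J :: "('i, 'j) cat" and U :: "'u set set"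
  assumes F: "preserves_small_colimits U C E F" and J: "category J"
    and small: "small U (Obj J)" "small U (Arr J)"
    and D: "is_functor J C D" and colim: "is_colimit C J D c \<iota>"
  shows "is_colimit E J (ftor_comp F D) (fobj F c) (\<lambda>j. farr F (\<iota> j))"
proof -
  obtain o' where o': "inj_on o' (Obj J)" "o' ` Obj J \<in> U" using small(1) unfolding small_def by blast
  obtain r where r: "inj_on r (Arr J)" "r ` Arr J \<in> U" using small(2) unfolding small_def by blast
  define oi where "oi = inv_into (Obj J) o'"
  define ri where "ri = inv_into (Arr J) r"
  have oi: "oi (o' X) = X" if "X \<in> Obj J" for X using o'(1) that by (simp add: oi_def)
  have ri: "ri (r f) = f" if "f \<in> Arr J" for f using r(1) that by (simp add: ri_def)
  define J' where "J' = \<lparr>Obj = o' ` Obj J, Arr = r ` Arr J, Src = \<lambda>u. o' (Src J (ri u)),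
    Tgt = \<lambda>u. o' (Tgt J (ri u)), Idn = \<lambda>u. r (Idn J (oi u)), Cmp = \<lambda>v u. r (Cmp J (ri v) (ri u))\<rparr>"
  have Arr: "f \<in> Arr J" if "f \<in> hom J X Y" for f X Y using that by (simp add: hom_def)
  have ends: "Src J f \<in> Obj J" "Tgt J f \<in> Obj J" if "f \<in> Arr J" for f
    using J that unfolding category_def by blast+
  have o'_eq: "o' X = o' Y \<longleftrightarrow> X = Y" if "X \<in> Obj J" "Y \<in> Obj J" for X Y
    using inj_on_eq_iff[OF o'(1) that] .
  have in_hom': "r f \<in> hom J' (o' X) (o' Y) \<longleftrightarrow> f \<in> hom J X Y"
    if "X \<in> Obj J" "Y \<in> Obj J" "f \<in> Arr J" for X Y f
    using that o'_eq[OF ends(1)[OF that(3)] that(1)] o'_eq[OF ends(2)[OF that(3)] that(2)] ri[OF that(3)]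
    by (simp add: hom_def J'_def)
  have hom': "hom J' (o' X) (o' Y) = r ` hom J X Y" if "X \<in> Obj J" "Y \<in> Obj J" for X Y
  proof (intro equalityI subsetI)
    fix u assume u: "u \<in> hom J' (o' X) (o' Y)"
    then obtain f where "f \<in> Arr J" "u = r f" by (auto simp: hom_def J'_def)
    then show "u \<in> r ` hom J X Y" using in_hom'[OF that, of f] u by simp
  next
    fix u assume "u \<in> r ` hom J X Y"
    then obtain f where f: "f \<in> hom J X Y" "u = r f" by blast
    then show "u \<in> hom J' (o' X) (o' Y)" using in_hom'[OF that Arr[OF f(1)]] by simp
  qed
  have homD: "\<exists>X Y f. X \<in> Obj J \<and> Y \<in> Obj J \<and> f \<in> hom J X Y \<and> u = r f \<and> X' = o' X \<and> Y' = o' Y"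
    if u: "u \<in> hom J' X' Y'" for u X' Y'
  proof -
    obtain f where "f \<in> Arr J" "u = r f" using u by (auto simp: hom_def J'_def)
    then show ?thesis using u ends[of f] ri[of f]
      by (intro exI[of _ "Src J f"] exI[of _ "Tgt J f"] exI[of _ f]) (auto simp: hom_def J'_def)
  qed
  have Obj': "Obj J' = o' ` Obj J" and Idn': "Idn J' u = r (Idn J (oi u))"
    and Cmp': "Cmp J' v u = r (Cmp J (ri v) (ri u))" for u v by (simp_all add: J'_def)
  have J': "category J'"
    unfolding category_def
  proof (intro conjI ballI allI impI)
    show "Src J' u \<in> Obj J'" "Tgt J' u \<in> Obj J'" if "u \<in> Arr J'" for u
      using that ends ri by (auto simp: J'_def)
    show "Idn J' u \<in> hom J' u u" if "u \<in> Obj J'" for u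
      using that Idn_hom[OF J] by (auto simp: Obj' Idn' hom' oi)
  next
    fix X' Y' Z' u v assume u: "u \<in> hom J' X' Y'" and v: "v \<in> hom J' Y' Z'"
    obtain X Y f where f: "X \<in> Obj J" "Y \<in> Obj J" "f \<in> hom J X Y" "u = r f" "X' = o' X" "Y' = o' Y"
      using homD[OF u] by blast
    obtain Y1 Z g where g: "Y1 \<in> Obj J" "Z \<in> Obj J" "g \<in> hom J Y1 Z" "v = r g" "Y' = o' Y1" "Z' = o' Z"
      using homD[OF v] by blast
    have "g \<in> hom J Y Z" using f g o'_eq by auto
    then show "Cmp J' v u \<in> hom J' X' Z'"
      using f g Cmp_hom[OF J f(3)] by (auto simp: Cmp' hom' ri Arr)
  next
    fix X' Y' u assume u: "u \<in> hom J' X' Y'"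
    obtain X Y f where f: "X \<in> Obj J" "Y \<in> Obj J" "f \<in> hom J X Y" "u = r f" "X' = o' X" "Y' = o' Y"
      using homD[OF u] by blast
    show "Cmp J' u (Idn J' X') = u" "Cmp J' (Idn J' Y') u = u"
      using f(4-6) Cmp_Idn_left[OF J f(3)] Cmp_Idn_right[OF J f(3)] ri[OF Arr[OF f(3)]]
        ri[OF Arr[OF Idn_hom[OF J f(1)]]] ri[OF Arr[OF Idn_hom[OF J f(2)]]] oi[OF f(1)] oi[OF f(2)]
      by (simp_all add: Cmp' Idn')
  next
    fix W' X' Y' Z' u v w assume u: "u \<in> hom J' W' X'" and v: "v \<in> hom J' X' Y'" and w: "w \<in> hom J' Y' Z'"
    obtain W X f where f: "W \<in> Obj J" "X \<in> Obj J" "f \<in> hom J W X" "u = r f" "W' = o' W" "X' = o' X"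
      using homD[OF u] by blast
    obtain X1 Y g where g: "X1 \<in> Obj J" "Y \<in> Obj J" "g \<in> hom J X1 Y" "v = r g" "X' = o' X1" "Y' = o' Y"
      using homD[OF v] by blast
    obtain Y1 Z h where h: "Y1 \<in> Obj J" "Z \<in> Obj J" "h \<in> hom J Y1 Z" "w = r h" "Y' = o' Y1" "Z' = o' Z"
      using homD[OF w] by blast
    have gh: "g \<in> hom J X Y" "h \<in> hom J Y Z" using f g h o'_eq by auto
    show "Cmp J' w (Cmp J' v u) = Cmp J' (Cmp J' w v) u"
      using f(3,4) g(4) h(4) gh Cmp_assoc[OF J f(3) gh] Arr[OF Cmp_hom[OF J f(3) gh(1)]] Arr[OF Cmp_hom[OF J gh]]
      by (auto simp: Cmp' ri Arr)
  qed
  define D' where "D' = \<lparr>fobj = fobj D \<circ> oi, farr = farr D \<circ> ri\<rparr>"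
  have fobj_D': "fobj D' (o' X) = fobj D X" if "X \<in> Obj J" for X using that by (simp add: D'_def oi)
  have farr_D': "farr D' (r f) = farr D f" if "f \<in> Arr J" for f using that by (simp add: D'_def ri)
  have D': "is_functor J' C D'"
    unfolding is_functor_def
  proof (intro conjI ballI allI impI)
    show "fobj D' u \<in> Obj C" "farr D' (Idn J' u) = Idn C (fobj D' u)" if "u \<in> Obj J'" for u
      using that functor_obj[OF D] functor_Idn[OF D] Arr[OF Idn_hom[OF J]]
      by (auto simp: Obj' Idn' fobj_D' oi farr_D')
  next
    fix X' Y' u assume u: "u \<in> hom J' X' Y'"
    obtain X Y f where f: "X \<in> Obj J" "Y \<in> Obj J" "f \<in> hom J X Y" "u = r f" "X' = o' X" "Y' = o' Y"
      using homD[OF u] by blast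
    show "farr D' u \<in> hom C (fobj D' X') (fobj D' Y')"
      using f functor_hom[OF D f(3)] by (simp add: fobj_D' farr_D' Arr)
  next
    fix X' Y' Z' u v assume u: "u \<in> hom J' X' Y'" and v: "v \<in> hom J' Y' Z'"
    obtain X Y f where f: "X \<in> Obj J" "Y \<in> Obj J" "f \<in> hom J X Y" "u = r f" "X' = o' X" "Y' = o' Y"
      using homD[OF u] by blast
    obtain Y1 Z g where g: "Y1 \<in> Obj J" "Z \<in> Obj J" "g \<in> hom J Y1 Z" "v = r g" "Y' = o' Y1" "Z' = o' Z"
      using homD[OF v] by blast
    have "g \<in> hom J Y Z" using f g o'_eq by auto
    then show "farr D' (Cmp J' v u) = Cmp C (farr D' v) (farr D' u)"
      using f(3,4) g(4) functor_Cmp[OF D f(3)] Arr[OF Cmp_hom[OF J f(3)]]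
      by (simp add: Cmp' farr_D' Arr ri)
  qed
  \<comment> \<open>Cocones over the copy and over the original diagram correspond by reindexing along \<open>o'\<close>. The
    functor \<open>H\<close> lets this apply both to \<open>D\<close> (with the identity) and to its image under \<open>F\<close>.\<close>
  have cocone: "cocone B J' (ftor_comp H D') b \<kappa> \<longleftrightarrow> cocone B J (ftor_comp H D) b (\<kappa> \<circ> o')"
    for B :: "('x, 'y) cat" and H b \<kappa>
  proof -
    have "(\<forall>i j f. f \<in> hom J' i j \<longrightarrow> Cmp B (\<kappa> j) (farr H (farr D' f)) = \<kappa> i) \<longleftrightarrow>
        (\<forall>i j f. f \<in> hom J i j \<longrightarrow> Cmp B (\<kappa> (o' j)) (farr H (farr D f)) = \<kappa> (o' i))" (is "?L \<longleftrightarrow> ?R")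
    proof
      assume ?L
      show ?R
      proof (intro allI impI)
        fix i j f assume f: "f \<in> hom J i j"
        have "r f \<in> hom J' (o' i) (o' j)" using f hom'[OF hom_objs[OF J f]] by blast
        then show "Cmp B (\<kappa> (o' j)) (farr H (farr D f)) = \<kappa> (o' i)" 
          using \<open>?L\<close> farr_D'[OF Arr[OF f]] by metis
      qed
    next
      assume ?R
      show ?L
      proof (intro allI impI)
        fix i' j' u assume u: "u \<in> hom J' i' j'"
        obtain i j f where f: "f \<in> hom J i j" "u = r f" "i' = o' i" "j' = o' j" using homD[OF u] by blast
        then show "Cmp B (\<kappa> j') (farr H (farr D' u)) = \<kappa> i'"
          using \<open>?R\<close> farr_D'[OF Arr[OF f(1)]] by simp
      qed
    qed
    then show ?thesis unfolding cocone_def by (auto simp: Obj' fobj_D')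
  qed
  have oi_comp: "cocone B J G b \<kappa> \<longleftrightarrow> cocone B J G b (\<kappa> \<circ> oi \<circ> o')" for B :: "('x, 'y) cat" and G b \<kappa>
  proof -
    have "Cmp B ((\<kappa> \<circ> oi \<circ> o') j) k = (\<kappa> \<circ> oi \<circ> o') i \<longleftrightarrow> Cmp B (\<kappa> j) k = \<kappa> i"
      if "f \<in> hom J i j" for i j k f using hom_objs[OF J that] by (simp add: oi)
    then show ?thesis unfolding cocone_def by (auto simp: oi)
  qed
  have colimit: "is_colimit B J' (ftor_comp H D') b (\<kappa> \<circ> oi) \<longleftrightarrow> is_colimit B J (ftor_comp H D) b \<kappa>"
    for B :: "('x, 'y) cat" and H b \<kappa>
  proof -
    let ?univ = "\<lambda>c' \<kappa>'. \<exists>!h. h \<in> hom B b c' \<and> (\<forall>j\<in>Obj J. Cmp B h (\<kappa> j) = \<kappa>' j)"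
    let ?K = "ftor_comp H D"
    have univ_oi: "?univ c' (\<kappa>' \<circ> oi \<circ> o') = ?univ c' \<kappa>'" for c' \<kappa>'
    proof -
      have "(\<forall>j\<in>Obj J. Cmp B h (\<kappa> j) = (\<kappa>' \<circ> oi \<circ> o') j) = (\<forall>j\<in>Obj J. Cmp B h (\<kappa> j) = \<kappa>' j)"
        for h by (simp add: oi)
      then show ?thesis by (simp only:)
    qed
    have "(\<forall>c' \<kappa>'. cocone B J ?K c' (\<kappa>' \<circ> o') \<longrightarrow> ?univ c' (\<kappa>' \<circ> o')) \<longleftrightarrow>
        (\<forall>c' \<kappa>'. cocone B J ?K c' \<kappa>' \<longrightarrow> ?univ c' \<kappa>')" (is "?L \<longleftrightarrow> ?R")
    proof (intro iffI allI impI)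
      fix c' \<kappa>' assume L: ?L and c: "cocone B J ?K c' \<kappa>'"
      have "?univ c' ((\<kappa>' \<circ> oi) \<circ> o')" by (rule L[rule_format]) (rule oi_comp[THEN iffD1, OF c])
      then show "?univ c' \<kappa>'" by (simp only: univ_oi)
    next
      fix c' \<kappa>' assume R: ?R and c: "cocone B J ?K c' (\<kappa>' \<circ> o')"
      show "?univ c' (\<kappa>' \<circ> o')" by (rule R[rule_format, OF c])
    qed
    moreover have "(\<forall>j\<in>Obj J'. Cmp B h ((\<kappa> \<circ> oi) j) = \<kappa>' j) \<longleftrightarrow>
        (\<forall>j\<in>Obj J. Cmp B h (\<kappa> j) = (\<kappa>' \<circ> o') j)" for h \<kappa>' by (simp add: Obj' oi)
    ultimately show ?thesis
      unfolding is_colimit_def cocone oi_comp[of B ?K b \<kappa>] by (simp only:)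
  qed
  have "is_colimit C J' D' c (\<iota> \<circ> oi)"
    using colim colimit[of C inclusion c \<iota>] unfolding ftor_comp_inclusion by (simp only:)
  moreover have "Obj J' \<in> U" "Arr J' \<in> U" using o'(2) r(2) by (simp_all add: J'_def)
  ultimately have "is_colimit E J' (ftor_comp F D') (fobj F c) (\<lambda>j. farr F ((\<iota> \<circ> oi) j))"
    using F J' D' unfolding preserves_small_colimits_def by blast
  moreover have "(\<lambda>j. farr F ((\<iota> \<circ> oi) j)) = (\<lambda>j. farr F (\<iota> j)) \<circ> oi" by auto
  ultimately show ?thesis using colimit by metis
qed

subsection \<open>Dense families\<close>

text \<open>The comma category of the family \<open>Q\<close> over \<open>X\<close>: its objects are the arrows \<open>e\<close> from some \<open>Q a\<close> to
  \<open>X\<close>, and an arrow from \<open>(a, d)\<close> to \<open>(b, e)\<close> is some \<open>f\<close> with \<open>e \<circ> f = d\<close>. Arrows carry their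
  source and target, as \<open>f\<close> alone does not determine them.\<close>

definition over_cat :: "('o, 'a) cat \<Rightarrow> ('i \<Rightarrow> 'o) \<Rightarrow> 'o \<Rightarrow>
    ('i \<times> 'a, ('i \<times> 'a) \<times> 'a \<times> ('i \<times> 'a)) cat" where
  "over_cat C Q X =
     \<lparr>Obj = {(a, e). e \<in> hom C (Q a) X},
      Arr = {((a, d), f, (b, e)) | a d f b e. f \<in> hom C (Q a) (Q b) \<and> e \<in> hom C (Q b) X \<and> d = Cmp C e f},
      Src = fst,
      Tgt = (\<lambda>(_, _, y). y),
      Idn = (\<lambda>(a, e). ((a, e), Idn C (Q a), (a, e))),
      Cmp = (\<lambda>(_, g, z) (x, f, _). (x, Cmp C g f, z))\<rparr>"

definition over_dom :: "('i \<Rightarrow> 'o) \<Rightarrow> ('i \<times> 'a, ('i \<times> 'a) \<times> 'a \<times> ('i \<times> 'a), 'o, 'a) ftor" where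
  "over_dom Q = \<lparr>fobj = (\<lambda>(a, _). Q a), farr = (\<lambda>(_, f, _). f)\<rparr>"

text \<open>Every object is the colimit of the generators over it, with the objects of the comma category
  themselves as the legs of the cocone.\<close>

definition dense :: "('o, 'a) cat \<Rightarrow> ('i \<Rightarrow> 'o) \<Rightarrow> bool" where
  "dense C Q \<longleftrightarrow> (\<forall>X\<in>Obj C. is_colimit C (over_cat C Q X) (over_dom Q) X snd)"

lemma hom_over_cat:
  assumes "category C"
  shows "u \<in> hom (over_cat C Q X) x y \<longleftrightarrow> (\<exists>a f b e. u = (x, f, y) \<and> x = (a, Cmp C e f) \<and> y = (b, e) \<and>
    f \<in> hom C (Q a) (Q b) \<and> e \<in> hom C (Q b) X)"
  unfolding hom_def[of "over_cat C Q X"] by (auto simp: over_cat_def)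

lemma Obj_over_cat: "x \<in> Obj (over_cat C Q X) \<longleftrightarrow> snd x \<in> hom C (Q (fst x)) X"
  by (auto simp: over_cat_def)

lemma over_cat_ops:
  "Idn (over_cat C Q X) (a, e) = ((a, e), Idn C (Q a), (a, e))"
  "Cmp (over_cat C Q X) (y, g, z) (x, f, y') = (x, Cmp C g f, z)"
  by (simp_all add: over_cat_def)

lemma category_over_cat:
  assumes C: "category C" shows "category (over_cat C Q X)"
  unfolding category_def
proof (intro conjI ballI allI impI)
  show "Src (over_cat C Q X) u \<in> Obj (over_cat C Q X)" "Tgt (over_cat C Q X) u \<in> Obj (over_cat C Q X)"
    if "u \<in> Arr (over_cat C Q X)" for u
    using that by (auto simp: over_cat_def intro: Cmp_hom[OF C])
  show "Idn (over_cat C Q X) x \<in> hom (over_cat C Q X) x x" if "x \<in> Obj (over_cat C Q X)" for x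
    using that hom_objs(1)[OF C, of "snd x"]
    by (cases x) (simp add: hom_over_cat[OF C] Obj_over_cat over_cat_ops Cmp_Idn_right[OF C] Idn_hom[OF C])
qed (auto simp: hom_over_cat[OF C] over_cat_ops Cmp_Idn_left[OF C] Cmp_Idn_right[OF C] Cmp_assoc[OF C]
    intro: Cmp_hom[OF C])

lemma functor_over_dom:
  assumes C: "category C" shows "is_functor (over_cat C Q X) C (over_dom Q)"
  unfolding is_functor_def
  by (auto simp: hom_over_cat[OF C]) (auto simp: over_cat_def over_dom_def dest: hom_objs[OF C])

lemma cocone_over_cat:
  assumes C: "category C"
  shows "cocone D (over_cat C Q X) (ftor_comp F (over_dom Q)) Y \<iota> \<longleftrightarrow> Y \<in> Obj D \<and>
     (\<forall>a e. e \<in> hom C (Q a) X \<longrightarrow> \<iota> (a, e) \<in> hom D (fobj F (Q a)) Y) \<and>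
     (\<forall>a b f e. f \<in> hom C (Q a) (Q b) \<longrightarrow> e \<in> hom C (Q b) X \<longrightarrow>
        Cmp D (\<iota> (b, e)) (farr F f) = \<iota> (a, Cmp C e f))"
  unfolding cocone_def hom_over_cat[OF C] by (auto simp: over_cat_def over_dom_def)

lemma small_over_cat:
  assumes U: "universe U" and A: "small U (UNIV :: 'i set)"
    and homs: "\<And>a Y. Y \<in> Obj C \<Longrightarrow> small U (hom C (Q a) Y)" and Q: "\<And>a :: 'i. Q a \<in> Obj C" and X: "X \<in> Obj C"
  shows "small U (Obj (over_cat C Q X))" "small U (Arr (over_cat C Q X))"
proof -
  show Ob: "small U (Obj (over_cat C Q X))"
    by (rule small_subset[OF U small_Sigma[OF U A homs[OF X]]]) (auto simp: over_cat_def)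
  show "small U (Arr (over_cat C Q X))"
  proof (rule small_inj[OF U])
    show "small U (Sigma UNIV (\<lambda>b. hom C (Q b) X \<times> Sigma UNIV (\<lambda>a. hom C (Q a) (Q b))))"
      by (intro small_Sigma[OF U] A homs Q X)
    show "inj_on (\<lambda>((a, _), f, (b, e)). (b, e, a, f)) (Arr (over_cat C Q X))"
      by (auto simp: over_cat_def inj_on_def)
    show "(\<lambda>((a, _), f, (b, e)). (b, e, a, f)) ` Arr (over_cat C Q X) \<subseteq>
        Sigma UNIV (\<lambda>b. hom C (Q b) X \<times> Sigma UNIV (\<lambda>a. hom C (Q a) (Q b)))"
      by (auto simp: over_cat_def)
  qed
qed

lemma ex1_equality: "\<exists>!x. P x \<Longrightarrow> P x \<Longrightarrow> P y \<Longrightarrow> x = y"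
  by blast

text \<open>Let the arrows from the generators to \<open>G\<close> correspond by \<open>\<psi>\<close> to those from their images to \<open>Y\<close>. Then
  cocones from the generators over \<open>X\<close> to \<open>G\<close> correspond to cocones from their images to \<open>Y\<close>. As
  \<open>X\<close> and \<open>F X\<close> are the colimits, arrows from \<open>X\<close> to \<open>G\<close> correspond to arrows from \<open>F X\<close> to \<open>Y\<close>.\<close>

lemma couniversal_arrow_if_dense:
  assumes C: "category C" and D: "category D" and F: "is_functor C D F"
    and dense: "dense C Q"
    and pres: "\<And>X. X \<in> Obj C \<Longrightarrow>
      is_colimit D (over_cat C Q X) (ftor_comp F (over_dom Q)) (fobj F X) (\<lambda>x. farr F (snd x))"
    and Q: "\<And>a. Q a \<in> Obj C" and Y: "Y \<in> Obj D" and G: "G \<in> Obj C"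
    and bij: "\<And>a. bij_betw (\<psi> a) (hom C (Q a) G) (hom D (fobj F (Q a)) Y)"
    and nat: "\<And>a b f e. f \<in> hom C (Q a) (Q b) \<Longrightarrow> e \<in> hom C (Q b) G \<Longrightarrow>
      \<psi> a (Cmp C e f) = Cmp D (\<psi> b e) (farr F f)"
  shows "\<exists>\<epsilon>. couniversal_arrow C D F Y G \<epsilon>"
proof -
  note cocone = cocone_over_cat[OF C]
  have cocone_id: "cocone C (over_cat C Q X) (over_dom Q) Z \<iota> \<longleftrightarrow> Z \<in> Obj C \<and>
     (\<forall>a e. e \<in> hom C (Q a) X \<longrightarrow> \<iota> (a, e) \<in> hom C (Q a) Z) \<and>
     (\<forall>a b f e. f \<in> hom C (Q a) (Q b) \<longrightarrow> e \<in> hom C (Q b) X \<longrightarrow>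
        Cmp C (\<iota> (b, e)) f = \<iota> (a, Cmp C e f))" for X Z \<iota>
    using cocone[of C Q X inclusion Z \<iota>] unfolding ftor_comp_inclusion by (simp add: inclusion_def)
  have ex_C: "\<exists>!g. g \<in> hom C X Z \<and> (\<forall>a e. e \<in> hom C (Q a) X \<longrightarrow> Cmp C g e = \<iota> (a, e))"
    if "X \<in> Obj C" "cocone C (over_cat C Q X) (over_dom Q) Z \<iota>" for X Z \<iota>
  proof -
    have "\<exists>!g. g \<in> hom C X Z \<and> (\<forall>x\<in>Obj (over_cat C Q X). Cmp C g (snd x) = \<iota> x)"
      using dense that unfolding dense_def is_colimit_def by blast
    then show ?thesis by (simp add: over_cat_def)
  qed
  have ex_D: "\<exists>!h. h \<in> hom D (fobj F X) Z \<and> (\<forall>a e. e \<in> hom C (Q a) X \<longrightarrow> Cmp D h (farr F e) = \<iota> (a, e))"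
    if "X \<in> Obj C" "cocone D (over_cat C Q X) (ftor_comp F (over_dom Q)) Z \<iota>" for X Z \<iota>
  proof -
    have "\<exists>!h. h \<in> hom D (fobj F X) Z \<and> (\<forall>x\<in>Obj (over_cat C Q X). Cmp D h (farr F (snd x)) = \<iota> x)"
      using pres[OF that(1)] that(2) unfolding is_colimit_def by blast
    then show ?thesis by (simp add: over_cat_def)
  qed
  have \<psi>: "\<psi> a e \<in> hom D (fobj F (Q a)) Y" if "e \<in> hom C (Q a) G" for a e
    using bij[of a] that by (auto dest: bij_betwE)
  have cocone_\<psi>: "cocone D (over_cat C Q G) (ftor_comp F (over_dom Q)) Y (\<lambda>(a, e). \<psi> a e)"
    unfolding cocone using Y \<psi> nat by simp
  \<comment> \<open>The bijection \<open>\<psi>\<close> itself is a cocone under the images of the generators over \<open>G\<close>.\<close>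
  obtain \<epsilon> where \<epsilon>: "\<epsilon> \<in> hom D (fobj F G) Y"
    "\<And>a e. e \<in> hom C (Q a) G \<Longrightarrow> Cmp D \<epsilon> (farr F e) = \<psi> a e"
    using ex1_implies_ex[OF ex_D[OF G cocone_\<psi>]] by auto
  have transpose: "Cmp D (Cmp D \<epsilon> (farr F g)) (farr F e) = \<psi> a (Cmp C g e)"
    if g: "g \<in> hom C X G" and e: "e \<in> hom C (Q a) X" for X g a e
    using \<epsilon>(2)[OF Cmp_hom[OF C e g]] functor_Cmp[OF F e g]
      Cmp_assoc[OF D functor_hom[OF F e] functor_hom[OF F g] \<epsilon>(1)] by simp
  have "\<exists>!g. g \<in> hom C X G \<and> Cmp D \<epsilon> (farr F g) = h"
    if X: "X \<in> Obj C" and h: "h \<in> hom D (fobj F X) Y" for X h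
  proof -
    \<comment> \<open>The cocone that \<open>h\<close> induces on the images of the generators, transported along \<open>\<psi>\<close>.\<close>
    define \<kappa> where "\<kappa> = (\<lambda>(a, e). inv_into (hom C (Q a) G) (\<psi> a) (Cmp D h (farr F e)))"
    have he: "Cmp D h (farr F e) \<in> hom D (fobj F (Q a)) Y" if "e \<in> hom C (Q a) X" for a e
      using Cmp_hom[OF D functor_hom[OF F that] h] .
    have \<kappa>: "\<kappa> (a, e) \<in> hom C (Q a) G" "\<psi> a (\<kappa> (a, e)) = Cmp D h (farr F e)"
      if "e \<in> hom C (Q a) X" for a e
      using he[OF that] bij[of a] by (auto simp: \<kappa>_def bij_betw_def intro: inv_into_into f_inv_into_f)
    have inj: "d = e" if "d \<in> hom C (Q a) G" "e \<in> hom C (Q a) G" "\<psi> a d = \<psi> a e" for a d e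
      using bij[of a] that by (auto simp: bij_betw_def dest: inj_onD)
    have "Cmp C (\<kappa> (b, e)) f = \<kappa> (a, Cmp C e f)"
      if f: "f \<in> hom C (Q a) (Q b)" and e: "e \<in> hom C (Q b) X" for a b f e
    proof (rule inj)
      have ef: "Cmp C e f \<in> hom C (Q a) X" using Cmp_hom[OF C f e] .
      show "Cmp C (\<kappa> (b, e)) f \<in> hom C (Q a) G" using Cmp_hom[OF C f \<kappa>(1)[OF e]] .
      show "\<kappa> (a, Cmp C e f) \<in> hom C (Q a) G" using \<kappa>(1)[OF ef] .
      show "\<psi> a (Cmp C (\<kappa> (b, e)) f) = \<psi> a (\<kappa> (a, Cmp C e f))"
        using nat[OF f \<kappa>(1)[OF e]] \<kappa>(2)[OF e] \<kappa>(2)[OF ef] functor_Cmp[OF F f e]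
          Cmp_assoc[OF D functor_hom[OF F f] functor_hom[OF F e] h] by simp
    qed
    then have "cocone C (over_cat C Q X) (over_dom Q) G \<kappa>"
      unfolding cocone_id using G \<kappa>(1) by simp
    from ex_C[OF X this] obtain g where g: "g \<in> hom C X G"
      and g\<kappa>: "\<And>a e. e \<in> hom C (Q a) X \<Longrightarrow> Cmp C g e = \<kappa> (a, e)"
      and g_uniq: "\<And>k. k \<in> hom C X G \<Longrightarrow> (\<And>a e. e \<in> hom C (Q a) X \<Longrightarrow> Cmp C k e = \<kappa> (a, e)) \<Longrightarrow> k = g"
      by (elim ex1E) auto
    have "cocone D (over_cat C Q X) (ftor_comp F (over_dom Q)) Y (\<lambda>(a, e). Cmp D h (farr F e))"
      unfolding cocone using Y he functor_Cmp[OF F] Cmp_assoc[OF D functor_hom[OF F] functor_hom[OF F] h]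
      by simp
    note uniq_D = ex1_equality[OF ex_D[OF X this]]
    have h_uniq: "k = h"
      if "k \<in> hom D (fobj F X) Y" "\<And>a e. e \<in> hom C (Q a) X \<Longrightarrow> Cmp D k (farr F e) = Cmp D h (farr F e)" for k
      by (rule uniq_D) (use that h in simp_all)
    show ?thesis
    proof (rule ex1I[of _ g])
      have "Cmp D \<epsilon> (farr F g) = h"
        using h_uniq[OF Cmp_hom[OF D functor_hom[OF F g] \<epsilon>(1)]] transpose[OF g] g\<kappa> \<kappa>(2) by simp
      then show "g \<in> hom C X G \<and> Cmp D \<epsilon> (farr F g) = h" using g by simp
      fix k assume k: "k \<in> hom C X G \<and> Cmp D \<epsilon> (farr F k) = h"
      show "k = g"
      proof (rule g_uniq)
        show "k \<in> hom C X G" using k by simp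
        fix a e assume e: "e \<in> hom C (Q a) X"
        have kG: "k \<in> hom C X G" and kh: "Cmp D \<epsilon> (farr F k) = h" using k by auto
        have "\<psi> a (Cmp C k e) = \<psi> a (\<kappa> (a, e))" using transpose[OF kG e] \<kappa>(2)[OF e] kh by simp
        then show "Cmp C k e = \<kappa> (a, e)" using inj[OF Cmp_hom[OF C e kG] \<kappa>(1)[OF e]] by simp
      qed
    qed
  qed
  then show ?thesis using G \<epsilon>(1) unfolding couniversal_arrow_def by blast
qed

section \<open>The categories of labelled symmetric precubical sets and of transition systems\<close>

subsection \<open>Presheaf morphisms\<close>

lemma psh_hom_cell: "psh_hom K L \<eta> \<Longrightarrow> x \<in> cells K n \<Longrightarrow> \<eta> n x \<in> cells L n"
  unfolding psh_hom_def by (elim conjE allE) (erule PiE_mem)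

lemma psh_hom_ext:
  assumes "psh_hom K L \<eta>" "psh_hom K M \<theta>" "\<And>n x. x \<in> cells K n \<Longrightarrow> \<eta> n x = \<theta> n x"
  shows "\<eta> = \<theta>"
proof
  fix n
  have "\<eta> n \<in> extensional (cells K n)" "\<theta> n \<in> extensional (cells K n)"
    using assms(1,2) by (auto simp: psh_hom_def PiE_def)
  then show "\<eta> n = \<theta> n" using assms(3) by (rule extensionalityI)
qed

lemma psh_hom_act:
  "psh_hom K L \<eta> \<Longrightarrow> (m, f, n) \<in> box \<Longrightarrow> x \<in> cells K n \<Longrightarrow>
     \<eta> m (act K (m, f, n) x) = act L (m, f, n) (\<eta> n x)"
  unfolding psh_hom_def by simp

lemma psh_homI:
  assumes "\<And>n x. x \<in> cells K n \<Longrightarrow> \<eta> n x \<in> cells L n"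
    and "\<And>n x. x \<notin> cells K n \<Longrightarrow> \<eta> n x = undefined"
    and "\<And>m f n x. (m, f, n) \<in> box \<Longrightarrow> x \<in> cells K n \<Longrightarrow> \<eta> m (act K (m, f, n) x) = act L (m, f, n) (\<eta> n x)"
  shows "psh_hom K L \<eta>"
  unfolding psh_hom_def using assms by auto

lemma psh_act_cell:
  "sym_precubical_set K \<Longrightarrow> (m, f, n) \<in> box \<Longrightarrow> x \<in> cells K n \<Longrightarrow> act K (m, f, n) x \<in> cells K m"
  unfolding sym_precubical_set_def by (elim conjE) blast

lemma psh_act_id:
  "sym_precubical_set K \<Longrightarrow> x \<in> cells K n \<Longrightarrow> act K (n, \<lambda>\<epsilon>\<in>vert n. \<epsilon>, n) x = x"
  unfolding sym_precubical_set_def by (elim conjE) blast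

lemma psh_act_comp:
  "sym_precubical_set K \<Longrightarrow> (l, f, m) \<in> box \<Longrightarrow> (m, g, n) \<in> box \<Longrightarrow> x \<in> cells K n \<Longrightarrow>
     act K (l, compose (vert l) g f, n) x = act K (l, f, m) (act K (m, g, n) x)"
  unfolding sym_precubical_set_def by (elim conjE) blast

lemma psh_comp_apply [simp]: "x \<in> cells K n \<Longrightarrow> psh_comp K \<theta> \<eta> n x = \<theta> n (\<eta> n x)"
  by (simp add: psh_comp_def compose_def)

lemma psh_comp_hom:
  assumes K: "sym_precubical_set K" and \<eta>: "psh_hom K L \<eta>" and \<theta>: "psh_hom L M \<theta>"
  shows "psh_hom K M (psh_comp K \<theta> \<eta>)"
proof (rule psh_homI)
  show "psh_comp K \<theta> \<eta> n x \<in> cells M n" if "x \<in> cells K n" for n x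
    using that psh_hom_cell[OF \<theta> psh_hom_cell[OF \<eta> that]] by simp
  show "psh_comp K \<theta> \<eta> n x = undefined" if "x \<notin> cells K n" for n x
    using that by (simp add: psh_comp_def compose_def)
  show "psh_comp K \<theta> \<eta> m (act K (m, f, n) x) = act M (m, f, n) (psh_comp K \<theta> \<eta> n x)"
    if f: "(m, f, n) \<in> box" and x: "x \<in> cells K n" for m f n x
    using psh_act_cell[OF K f x] x psh_hom_act[OF \<eta> f x] psh_hom_act[OF \<theta> f psh_hom_cell[OF \<eta> x]] by simp
qed

subsection \<open>Labelled symmetric precubical sets\<close>

lemma labelled_spsD:
  assumes "labelled_sps X"
  shows "sym_precubical_set (fst X)" "psh_hom (fst X) words (snd X)"
    "x \<in> cells (fst X) n \<Longrightarrow> length (snd X n x) = n"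
    "(m, f, n) \<in> box \<Longrightarrow> x \<in> cells (fst X) n \<Longrightarrow>
       snd X m (act (fst X) (m, f, n) x) = act words (m, f, n) (snd X n x)"
proof -
  show K: "sym_precubical_set (fst X)" and l: "psh_hom (fst X) words (snd X)"
    using assms by (auto simp: labelled_sps_def)
  show "length (snd X n x) = n" if "x \<in> cells (fst X) n"
    using psh_hom_cell[OF l that] by (simp add: words_def)
  show "snd X m (act (fst X) (m, f, n) x) = act words (m, f, n) (snd X n x)"
    if "(m, f, n) \<in> box" "x \<in> cells (fst X) n"
    using psh_hom_act[OF l that] .
qed

lemma lps_homD:
  assumes "lps_hom X Y \<eta>"
  shows "psh_hom (fst X) (fst Y) \<eta>" "x \<in> cells (fst X) n \<Longrightarrow> snd Y n (\<eta> n x) = snd X n x"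
proof -
  show "psh_hom (fst X) (fst Y) \<eta>" using assms by (simp add: lps_hom_def)
  show "snd Y n (\<eta> n x) = snd X n x" if "x \<in> cells (fst X) n"
    using assms psh_comp_apply[OF that, of "snd Y" \<eta>] by (simp add: lps_hom_def)
qed

lemma lps_homI:
  assumes X: "\<And>n x. x \<notin> cells (fst X) n \<Longrightarrow> snd X n x = undefined" and \<eta>: "psh_hom (fst X) (fst Y) \<eta>"
    and l: "\<And>n x. x \<in> cells (fst X) n \<Longrightarrow> snd Y n (\<eta> n x) = snd X n x"
  shows "lps_hom X Y \<eta>"
  unfolding lps_hom_def
proof (intro conjI \<eta> ext)
  show "psh_comp (fst X) (snd Y) \<eta> n x = snd X n x" for n x
    using X l by (cases "x \<in> cells (fst X) n") (simp_all add: psh_comp_def compose_def)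
qed

lemma label_undefined: "labelled_sps X \<Longrightarrow> x \<notin> cells (fst X) n \<Longrightarrow> snd X n x = undefined"
  unfolding labelled_sps_def psh_hom_def by (elim conjE allE) (erule PiE_arb)

lemma Obj_LPS: "X \<in> Obj (LPS U) \<longleftrightarrow> labelled_sps X \<and> (\<forall>n. cells (fst X) n \<in> U)"
  by (simp add: LPS_def Let_def)

lemma hom_LPS: "f \<in> hom (LPS U) X Y \<longleftrightarrow>
    X \<in> Obj (LPS U) \<and> Y \<in> Obj (LPS U) \<and> (\<exists>\<eta>. f = (X, \<eta>, Y) \<and> lps_hom X Y \<eta>)"
  by (auto simp: hom_def LPS_def Let_def)

lemma LPS_ops:
  "Idn (LPS U) X = (X, \<lambda>n. \<lambda>x\<in>cells (fst X) n. x, X)"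
  "Cmp (LPS U) (Y', \<theta>, Z) (X, \<eta>, Y) = (X, psh_comp (fst X) \<theta> \<eta>, Z)"
  by (simp_all add: LPS_def Let_def)

lemma lps_hom_comp:
  assumes X: "labelled_sps X" and \<eta>: "lps_hom X Y \<eta>" and \<theta>: "lps_hom Y Z \<theta>"
  shows "lps_hom X Z (psh_comp (fst X) \<theta> \<eta>)"
proof (rule lps_homI)
  note h = lps_homD(1)[OF \<eta>] lps_homD(1)[OF \<theta>]
  show "psh_hom (fst X) (fst Z) (psh_comp (fst X) \<theta> \<eta>)"
    using psh_comp_hom[OF labelled_spsD(1)[OF X] h] .
  show "snd Z n (psh_comp (fst X) \<theta> \<eta> n x) = snd X n x" if "x \<in> cells (fst X) n" for n x
    using that lps_homD(2)[OF \<eta> that] lps_homD(2)[OF \<theta> psh_hom_cell[OF h(1) that]] by simp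
qed (rule label_undefined[OF X])

lemma lps_hom_id:
  assumes X: "labelled_sps X"
  shows "lps_hom X X (\<lambda>n. \<lambda>x\<in>cells (fst X) n. x)"
proof (rule lps_homI)
  show "psh_hom (fst X) (fst X) (\<lambda>n. \<lambda>x\<in>cells (fst X) n. x)"
    by (rule psh_homI) (use psh_act_cell[OF labelled_spsD(1)[OF X]] in simp_all)
qed (use label_undefined[OF X] in simp_all)

lemma category_LPS: "category (LPS U :: (('u, 'l) lps, ('u, 'l) lps_arr) cat)"
  unfolding category_def
proof (intro conjI ballI allI impI)
  show "Src (LPS U) f \<in> Obj (LPS U)" "Tgt (LPS U) f \<in> Obj (LPS U)"
    if "f \<in> Arr (LPS U)" for f :: "('u, 'l) lps_arr"
    using that by (auto simp: LPS_def Let_def)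
next
  fix X :: "('u, 'l) lps" assume X: "X \<in> Obj (LPS U)"
  then show "Idn (LPS U) X \<in> hom (LPS U) X X"
    using lps_hom_id[of X] by (simp add: hom_LPS LPS_ops Obj_LPS)
next
  fix X Y Z :: "('u, 'l) lps" and f g
  assume f: "f \<in> hom (LPS U) X Y" and g: "g \<in> hom (LPS U) Y Z"
  obtain \<eta> where \<eta>: "f = (X, \<eta>, Y)" "lps_hom X Y \<eta>" and X: "X \<in> Obj (LPS U)" using f by (auto simp: hom_LPS)
  obtain \<theta> where \<theta>: "g = (Y, \<theta>, Z)" "lps_hom Y Z \<theta>" and Z: "Z \<in> Obj (LPS U)" using g by (auto simp: hom_LPS)
  show "Cmp (LPS U) g f \<in> hom (LPS U) X Z"
    using lps_hom_comp[OF _ \<eta>(2) \<theta>(2)] X Z by (simp add: \<eta>(1) \<theta>(1) hom_LPS LPS_ops Obj_LPS)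
next
  fix X Y :: "('u, 'l) lps" and f assume f: "f \<in> hom (LPS U) X Y"
  obtain \<eta> where \<eta>: "f = (X, \<eta>, Y)" "lps_hom X Y \<eta>" and X: "labelled_sps X" and Y: "labelled_sps Y"
    using f by (auto simp: hom_LPS Obj_LPS)
  note h = lps_homD(1)[OF \<eta>(2)]
  have "psh_comp (fst X) \<eta> (\<lambda>n. \<lambda>x\<in>cells (fst X) n. x) = \<eta>"
    by (rule psh_hom_ext[OF lps_homD(1)[OF lps_hom_comp[OF X lps_hom_id[OF X] \<eta>(2)]] h]) simp
  moreover have "psh_comp (fst X) (\<lambda>n. \<lambda>x\<in>cells (fst Y) n. x) \<eta> = \<eta>"
    by (rule psh_hom_ext[OF lps_homD(1)[OF lps_hom_comp[OF X \<eta>(2) lps_hom_id[OF Y]]] h])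
      (simp add: psh_hom_cell[OF h])
  ultimately show "Cmp (LPS U) f (Idn (LPS U) X) = f" "Cmp (LPS U) (Idn (LPS U) Y) f = f"
    by (simp_all add: \<eta>(1) LPS_ops)
next
  fix W X Y Z :: "('u, 'l) lps" and f g h
  assume f: "f \<in> hom (LPS U) W X" and g: "g \<in> hom (LPS U) X Y" and h: "h \<in> hom (LPS U) Y Z"
  obtain \<eta> where \<eta>: "f = (W, \<eta>, X)" "lps_hom W X \<eta>" and W: "labelled_sps W" and X: "labelled_sps X"
    using f by (auto simp: hom_LPS Obj_LPS)
  obtain \<theta> where \<theta>: "g = (X, \<theta>, Y)" "lps_hom X Y \<theta>" using g by (auto simp: hom_LPS)
  obtain \<zeta> where \<zeta>: "h = (Y, \<zeta>, Z)" "lps_hom Y Z \<zeta>" using h by (auto simp: hom_LPS)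
  have "psh_comp (fst W) \<zeta> (psh_comp (fst W) \<theta> \<eta>) = psh_comp (fst W) (psh_comp (fst X) \<zeta> \<theta>) \<eta>"
  proof (rule psh_hom_ext)
    show "psh_hom (fst W) (fst Z) (psh_comp (fst W) \<zeta> (psh_comp (fst W) \<theta> \<eta>))"
      using lps_homD(1)[OF lps_hom_comp[OF W lps_hom_comp[OF W \<eta>(2) \<theta>(2)] \<zeta>(2)]] .
    show "psh_hom (fst W) (fst Z) (psh_comp (fst W) (psh_comp (fst X) \<zeta> \<theta>) \<eta>)"
      using lps_homD(1)[OF lps_hom_comp[OF W \<eta>(2) lps_hom_comp[OF X \<theta>(2) \<zeta>(2)]]] .
  qed (simp add: psh_hom_cell[OF lps_homD(1)[OF \<eta>(2)]])
  then show "Cmp (LPS U) h (Cmp (LPS U) g f) = Cmp (LPS U) (Cmp (LPS U) h g) f"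
    by (simp add: \<eta>(1) \<theta>(1) \<zeta>(1) LPS_ops)
qed

abbreviation arr_map :: "'o \<times> 'm \<times> 'o \<Rightarrow> 'm" where
  "arr_map f \<equiv> fst (snd f)"

lemma arr_map_LPS:
  assumes "f \<in> hom (LPS U) X Y"
  shows "f = (X, arr_map f, Y)" "labelled_sps X" "labelled_sps Y"
    "psh_hom (fst X) (fst Y) (arr_map f)"
    "x \<in> cells (fst X) n \<Longrightarrow> arr_map f n x \<in> cells (fst Y) n"
    "x \<in> cells (fst X) n \<Longrightarrow> snd Y n (arr_map f n x) = snd X n x"
    "(m, k, n) \<in> box \<Longrightarrow> x \<in> cells (fst X) n \<Longrightarrow>
       arr_map f m (act (fst X) (m, k, n) x) = act (fst Y) (m, k, n) (arr_map f n x)"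
proof -
  obtain \<eta> where \<eta>: "f = (X, \<eta>, Y)" "lps_hom X Y \<eta>" using assms by (auto simp: hom_LPS)
  note h = lps_homD(1)[OF \<eta>(2)]
  show "f = (X, arr_map f, Y)" "labelled_sps X" "labelled_sps Y" "psh_hom (fst X) (fst Y) (arr_map f)"
    using assms \<eta>(1) h by (simp_all add: hom_LPS Obj_LPS)
  show "x \<in> cells (fst X) n \<Longrightarrow> arr_map f n x \<in> cells (fst Y) n"
    "x \<in> cells (fst X) n \<Longrightarrow> snd Y n (arr_map f n x) = snd X n x"
    "(m, k, n) \<in> box \<Longrightarrow> x \<in> cells (fst X) n \<Longrightarrow>
       arr_map f m (act (fst X) (m, k, n) x) = act (fst Y) (m, k, n) (arr_map f n x)"
    using psh_hom_cell[OF h] psh_hom_act[OF h] lps_homD(2)[OF \<eta>(2)] by (simp_all add: \<eta>(1))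
qed

lemma arr_map_Cmp_LPS:
  assumes "f \<in> hom (LPS U) X Y" "g \<in> hom (LPS U) Y Z" "x \<in> cells (fst X) n"
  shows "arr_map (Cmp (LPS U) g f) n x = arr_map g n (arr_map f n x)"
proof -
  have "Cmp (LPS U) g f = Cmp (LPS U) (Y, arr_map g, Z) (X, arr_map f, Y)"
    using arr_map_LPS(1)[OF assms(1)] arr_map_LPS(1)[OF assms(2)] by simp
  then show ?thesis using assms(3) by (simp add: LPS_ops)
qed

lemma arr_eq_LPS:
  assumes f: "f \<in> hom (LPS U) X Y" and g: "g \<in> hom (LPS U) X Y"
    and "\<And>n x. x \<in> cells (fst X) n \<Longrightarrow> arr_map f n x = arr_map g n x"
  shows "f = g"
  using psh_hom_ext[OF arr_map_LPS(4)[OF f] arr_map_LPS(4)[OF g] assms(3)]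
    arr_map_LPS(1)[OF f] arr_map_LPS(1)[OF g] by metis

subsection \<open>Transition systems\<close>

lemma whdts_transD:
  assumes "whdts X" "(\<alpha>, us, \<beta>) \<in> trans X"
  shows "\<alpha> \<in> states X" "\<beta> \<in> states X" "set us \<subseteq> actions X"
  using assms unfolding whdts_def by auto

lemma whdts_homD:
  assumes "whdts_hom X Y f"
  shows "fst f \<in> states X \<rightarrow>\<^sub>E states Y" "snd f \<in> actions X \<rightarrow>\<^sub>E actions Y"
    "s \<in> states X \<Longrightarrow> fst f s \<in> states Y" "u \<in> actions X \<Longrightarrow> snd f u \<in> actions Y"
    "u \<in> actions X \<Longrightarrow> lab Y (snd f u) = lab X u"
    "(\<alpha>, us, \<beta>) \<in> trans X \<Longrightarrow> (fst f \<alpha>, map (snd f) us, fst f \<beta>) \<in> trans Y"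
proof -
  show h: "fst f \<in> states X \<rightarrow>\<^sub>E states Y" "snd f \<in> actions X \<rightarrow>\<^sub>E actions Y"
    using assms by (auto simp: whdts_hom_def)
  show "s \<in> states X \<Longrightarrow> fst f s \<in> states Y" "u \<in> actions X \<Longrightarrow> snd f u \<in> actions Y"
    using h by (auto dest: PiE_mem)
qed (use assms in \<open>simp_all add: whdts_hom_def\<close>)

lemma Obj_WHDTS: "X \<in> Obj (WHDTS U) \<longleftrightarrow> whdts X \<and> states X \<in> U \<and> actions X \<in> U"
  by (simp add: WHDTS_def Let_def)

lemma hom_WHDTS: "f \<in> hom (WHDTS U) X Y \<longleftrightarrow>
    X \<in> Obj (WHDTS U) \<and> Y \<in> Obj (WHDTS U) \<and> (\<exists>\<phi>. f = (X, \<phi>, Y) \<and> whdts_hom X Y \<phi>)"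
  by (auto simp: hom_def WHDTS_def Let_def)

lemma WHDTS_ops:
  "Idn (WHDTS U) X = (X, (\<lambda>s\<in>states X. s, \<lambda>u\<in>actions X. u), X)"
  "Cmp (WHDTS U) (Y', g, Z) (X, f, Y) =
     (X, (compose (states X) (fst g) (fst f), compose (actions X) (snd g) (snd f)), Z)"
  by (simp_all add: WHDTS_def Let_def)

lemma whdts_hom_comp:
  assumes X: "whdts X" and f: "whdts_hom X Y f" and g: "whdts_hom Y Z g"
  shows "whdts_hom X Z (compose (states X) (fst g) (fst f), compose (actions X) (snd g) (snd f))"
  unfolding whdts_hom_def fst_conv snd_conv
proof (intro conjI ballI allI impI)
  show "compose (states X) (fst g) (fst f) \<in> states X \<rightarrow>\<^sub>E states Z"
    "compose (actions X) (snd g) (snd f) \<in> actions X \<rightarrow>\<^sub>E actions Z"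
    using whdts_homD(3,4)[OF f] whdts_homD(3,4)[OF g] by (simp_all add: compose_def)
  show "lab Z (compose (actions X) (snd g) (snd f) u) = lab X u" if "u \<in> actions X" for u
    using that whdts_homD(5)[OF f that] whdts_homD(5)[OF g whdts_homD(4)[OF f that]] by (simp add: compose_eq)
next
  fix \<alpha> us \<beta> assume t: "(\<alpha>, us, \<beta>) \<in> trans X"
  have us: "map (compose (actions X) (snd g) (snd f)) us = map (snd g) (map (snd f) us)"
    using whdts_transD(3)[OF X t] by (auto simp: compose_eq)
  show "(compose (states X) (fst g) (fst f) \<alpha>, map (compose (actions X) (snd g) (snd f)) us,
      compose (states X) (fst g) (fst f) \<beta>) \<in> trans Z"
    using whdts_homD(6)[OF g whdts_homD(6)[OF f t]] whdts_transD(1,2)[OF X t]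
    unfolding us by (simp add: compose_eq)
qed

lemma whdts_hom_id:
  assumes X: "whdts X" shows "whdts_hom X X (\<lambda>s\<in>states X. s, \<lambda>u\<in>actions X. u)"
  unfolding whdts_hom_def fst_conv snd_conv
proof (intro conjI ballI allI impI)
  fix \<alpha> us \<beta> assume t: "(\<alpha>, us, \<beta>) \<in> trans X"
  have "map (\<lambda>u\<in>actions X. u) us = us" using whdts_transD(3)[OF X t] by (intro map_idI) auto
  then show "((\<lambda>s\<in>states X. s) \<alpha>, map (\<lambda>u\<in>actions X. u) us, (\<lambda>s\<in>states X. s) \<beta>) \<in> trans X"
    using whdts_transD(1,2)[OF X t] t by simp
qed auto

lemma category_WHDTS: "category (WHDTS U :: (('u, 'u, 'l) ts, ('u, 'l) ts_arr) cat)"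
  unfolding category_def
proof (intro conjI ballI allI impI)
  show "Src (WHDTS U) f \<in> Obj (WHDTS U)" "Tgt (WHDTS U) f \<in> Obj (WHDTS U)"
    if "f \<in> Arr (WHDTS U)" for f :: "('u, 'l) ts_arr"
    using that by (auto simp: WHDTS_def Let_def)
next
  fix X :: "('u, 'u, 'l) ts" assume X: "X \<in> Obj (WHDTS U)"
  then show "Idn (WHDTS U) X \<in> hom (WHDTS U) X X"
    using whdts_hom_id[of X] by (simp add: hom_WHDTS WHDTS_ops Obj_WHDTS)
next
  fix X Y Z :: "('u, 'u, 'l) ts" and f g
  assume f: "f \<in> hom (WHDTS U) X Y" and g: "g \<in> hom (WHDTS U) Y Z"
  obtain \<phi> where \<phi>: "f = (X, \<phi>, Y)" "whdts_hom X Y \<phi>" and X: "X \<in> Obj (WHDTS U)"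
    using f by (auto simp: hom_WHDTS)
  obtain \<psi> where \<psi>: "g = (Y, \<psi>, Z)" "whdts_hom Y Z \<psi>" and Z: "Z \<in> Obj (WHDTS U)"
    using g by (auto simp: hom_WHDTS)
  show "Cmp (WHDTS U) g f \<in> hom (WHDTS U) X Z"
    using whdts_hom_comp[OF _ \<phi>(2) \<psi>(2)] X Z by (simp add: \<phi>(1) \<psi>(1) hom_WHDTS WHDTS_ops Obj_WHDTS)
next
  fix X Y :: "('u, 'u, 'l) ts" and f assume f: "f \<in> hom (WHDTS U) X Y"
  obtain \<phi> where \<phi>: "f = (X, \<phi>, Y)" "whdts_hom X Y \<phi>" using f by (auto simp: hom_WHDTS)
  note h = whdts_homD(1,2)[OF \<phi>(2)]
  have e: "fst \<phi> \<in> extensional (states X)" "snd \<phi> \<in> extensional (actions X)"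
    using h by (simp_all add: PiE_def)
  have r: "compose (states X) (fst \<phi>) (\<lambda>s\<in>states X. s) = fst \<phi>"
    "compose (actions X) (snd \<phi>) (\<lambda>u\<in>actions X. u) = snd \<phi>"
    using e by (auto simp: compose_def extensional_def)
  have l: "compose (states X) (\<lambda>s\<in>states Y. s) (fst \<phi>) = fst \<phi>"
    "compose (actions X) (\<lambda>u\<in>actions Y. u) (snd \<phi>) = snd \<phi>"
    using e whdts_homD(3,4)[OF \<phi>(2)] by (auto simp: compose_def extensional_def)
  show "Cmp (WHDTS U) f (Idn (WHDTS U) X) = f" "Cmp (WHDTS U) (Idn (WHDTS U) Y) f = f"
    by (simp_all add: \<phi>(1) WHDTS_ops r l)
next
  fix W X Y Z :: "('u, 'u, 'l) ts" and f g h
  assume f: "f \<in> hom (WHDTS U) W X" and g: "g \<in> hom (WHDTS U) X Y" and h: "h \<in> hom (WHDTS U) Y Z"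
  obtain \<phi> where \<phi>: "f = (W, \<phi>, X)" "whdts_hom W X \<phi>" using f by (auto simp: hom_WHDTS)
  obtain \<psi> where \<psi>: "g = (X, \<psi>, Y)" using g by (auto simp: hom_WHDTS)
  obtain \<chi> where \<chi>: "h = (Y, \<chi>, Z)" using h by (auto simp: hom_WHDTS)
  show "Cmp (WHDTS U) h (Cmp (WHDTS U) g f) = Cmp (WHDTS U) (Cmp (WHDTS U) h g) f"
    using whdts_homD(3,4)[OF \<phi>(2)]
    by (simp add: \<phi>(1) \<psi> \<chi> WHDTS_ops compose_def restrict_def fun_eq_iff)
qed

lemma arr_map_WHDTS:
  assumes "f \<in> hom (WHDTS U) X Y"
  shows "f = (X, arr_map f, Y)" "whdts_hom X Y (arr_map f)"
proof -
  obtain \<phi> where "f = (X, \<phi>, Y)" "whdts_hom X Y \<phi>" using assms by (auto simp: hom_WHDTS)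
  then show "f = (X, arr_map f, Y)" "whdts_hom X Y (arr_map f)" by simp_all
qed

lemma arr_map_Cmp_WHDTS:
  assumes "f \<in> hom (WHDTS U) X Y" "g \<in> hom (WHDTS U) Y Z"
  shows "s \<in> states X \<Longrightarrow> fst (arr_map (Cmp (WHDTS U) g f)) s = fst (arr_map g) (fst (arr_map f) s)"
    "u \<in> actions X \<Longrightarrow> snd (arr_map (Cmp (WHDTS U) g f)) u = snd (arr_map g) (snd (arr_map f) u)"
proof -
  have "Cmp (WHDTS U) g f = Cmp (WHDTS U) (Y, arr_map g, Z) (X, arr_map f, Y)"
    using arr_map_WHDTS(1)[OF assms(1)] arr_map_WHDTS(1)[OF assms(2)] by simp
  then show "s \<in> states X \<Longrightarrow> fst (arr_map (Cmp (WHDTS U) g f)) s = fst (arr_map g) (fst (arr_map f) s)"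
    "u \<in> actions X \<Longrightarrow> snd (arr_map (Cmp (WHDTS U) g f)) u = snd (arr_map g) (snd (arr_map f) u)"
    by (simp_all add: WHDTS_ops compose_eq)
qed

lemma arr_eq_WHDTS:
  assumes f: "f \<in> hom (WHDTS U) X Y" and g: "g \<in> hom (WHDTS U) X Y"
    and "\<And>s. s \<in> states X \<Longrightarrow> fst (arr_map f) s = fst (arr_map g) s"
    and "\<And>u. u \<in> actions X \<Longrightarrow> snd (arr_map f) u = snd (arr_map g) u"
  shows "f = g"
proof -
  note hf = whdts_homD(1,2)[OF arr_map_WHDTS(2)[OF f]] and hg = whdts_homD(1,2)[OF arr_map_WHDTS(2)[OF g]]
  have "arr_map f = arr_map g"
    using PiE_ext[OF hf(1) hg(1) assms(3)] PiE_ext[OF hf(2) hg(2) assms(4)] by (rule prod_eqI)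
  then show ?thesis using arr_map_WHDTS(1)[OF f] arr_map_WHDTS(1)[OF g] by metis
qed

text \<open>An arrow out of a finite transition system is determined by finitely many values.\<close>

lemma small_hom_WHDTS:
  assumes U: "universe U" and fin: "finite (states X)" "finite (actions X)" and Y: "Y \<in> Obj (WHDTS U)"
  shows "small U (hom (WHDTS U) X Y)"
proof -
  obtain ss us where ss: "set ss = states X" and us: "set us = actions X"
    using fin finite_list by metis
  let ?v = "\<lambda>h. (map (fst (arr_map h)) ss, map (snd (arr_map h)) us)"
  show ?thesis
  proof (rule small_inj[OF U])
    have "small U (states Y)" "small U (actions Y)" using Y by (auto simp: Obj_WHDTS intro: small_mem)
    then show "small U (lists (states Y) \<times> lists (actions Y))"
      by (intro small_Sigma[OF U] small_lists[OF U])
    show "inj_on ?v (hom (WHDTS U) X Y)"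
    proof (rule inj_onI)
      fix f g assume f: "f \<in> hom (WHDTS U) X Y" and g: "g \<in> hom (WHDTS U) X Y" and "?v f = ?v g"
      then have "\<forall>s\<in>set ss. fst (arr_map f) s = fst (arr_map g) s"
        "\<forall>u\<in>set us. snd (arr_map f) u = snd (arr_map g) u"
        by (simp_all add: map_eq_conv)
      then show "f = g" using ss us by (intro arr_eq_WHDTS[OF f g]) simp_all
    qed
    show "?v ` hom (WHDTS U) X Y \<subseteq> lists (states Y) \<times> lists (actions Y)"
    proof (rule image_subsetI)
      fix h assume h: "h \<in> hom (WHDTS U) X Y"
      show "?v h \<in> lists (states Y) \<times> lists (actions Y)"
        using whdts_homD(3,4)[OF arr_map_WHDTS(2)[OF h]] by (simp add: ss us in_lists_conv_set)
    qed
  qed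
qed

section \<open>Labelled cubes\<close>

subsection \<open>Morphisms of cubes\<close>

lemma box_extensional: "(m, f, n) \<in> box \<Longrightarrow> f \<in> vert m \<rightarrow>\<^sub>E vert n"
proof (induction m f n rule: box.induct)
  case (box_face i n \<alpha>)
  then show ?case by (intro PiE_I) (auto simp: face_def vert_def)
next
  case (box_swap i n)
  then show ?case by (intro PiE_I) (auto simp: swap_def vert_def)
next
  case (box_comp l f m g n)
  then show ?case by (auto simp: compose_def dest: PiE_mem)
qed auto

lemma compose_id_box:
  assumes "(m, f, n) \<in> box"
  shows "compose (vert m) (\<lambda>\<epsilon>\<in>vert n. \<epsilon>) f = f" "compose (vert m) f (\<lambda>\<epsilon>\<in>vert m. \<epsilon>) = f"
proof -
  have f: "f \<in> extensional (vert m)" "\<And>\<epsilon>. \<epsilon> \<in> vert m \<Longrightarrow> f \<epsilon> \<in> vert n"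
    using box_extensional[OF assms] by (auto simp: PiE_def)
  then show "compose (vert m) (\<lambda>\<epsilon>\<in>vert n. \<epsilon>) f = f" "compose (vert m) f (\<lambda>\<epsilon>\<in>vert m. \<epsilon>) = f"
    by (auto simp: compose_def extensional_def)
qed

lemma hat_inv_face:
  assumes "i \<le> n" "k < n"
  shows "hat_inv n (face n i \<alpha>) (Suc n) k = (if k < i then k else Suc k)"
proof -
  have h: "hat n (face n i \<alpha>) j =
      (if j < i then Coord j else if j = i then (if \<alpha> then Plus_Inf else Minus_Inf)
       else Coord (j - 1))" if "j < Suc n" for j
    by (rule hat_eqI) (use that assms in \<open>auto simp: face_def vert_def nth_append nth_Cons'\<close>)
  show ?thesis unfolding hat_inv_def
    by (rule the_equality) (use assms in \<open>auto simp: h split: if_splits\<close>)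
qed

lemma act_words_id:
  assumes "length w = n" shows "act words (n, \<lambda>\<epsilon>\<in>vert n. \<epsilon>, n) w = w"
proof -
  have h: "hat n (\<lambda>\<epsilon>\<in>vert n. \<epsilon>) j = Coord j" if "j < n" for j
    by (rule hat_eqI) (use that in \<open>auto simp: vert_def\<close>)
  have "hat_inv n (\<lambda>\<epsilon>\<in>vert n. \<epsilon>) n k = k" if "k < n" for k
    unfolding hat_inv_def by (rule the_equality) (use that in \<open>auto simp: h\<close>)
  then show ?thesis using assms by (auto simp: words_def intro!: nth_equalityI)
qed

lemma length_act_words: "length (act words (m, f, n) w) = m"
  by (simp add: words_def)

lemma nth_act_words: "i < m \<Longrightarrow> act words (m, f, n) w ! i = w ! hat_inv m f n i"
  by (simp add: words_def)

subsection \<open>Uniqueness of fillings\<close>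

text \<open>A lift is determined by the image of the top cell of the cube. The square prescribes the label
  and the faces of that image, so uniqueness of lifts reduces to: a cell is determined by its label
  and its faces.\<close>

lemma HDA_paradigm_if_determined_by_faces:
  assumes X: "labelled_sps X"
    and det: "\<And>n x y. x \<in> cells (fst X) (Suc n) \<Longrightarrow> y \<in> cells (fst X) (Suc n) \<Longrightarrow> n \<ge> 1 \<Longrightarrow>
      snd X (Suc n) x = snd X (Suc n) y \<Longrightarrow>
      (\<And>i \<alpha>. i \<le> n \<Longrightarrow> act (fst X) (n, face n i \<alpha>, Suc n) x = act (fst X) (n, face n i \<alpha>, Suc n) y) \<Longrightarrow>
      x = y"
  shows "HDA_paradigm X"
  unfolding HDA_paradigm_def
proof (intro allI impI)
  fix p :: nat and a b k k'
  assume p: "p \<ge> 2"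
    and k: "psh_hom (std_cube p) (fst X) k \<and> (\<forall>n. \<forall>x\<in>cells (boundary p) n. k n x = a n x) \<and>
           (\<forall>n. \<forall>x\<in>cells (std_cube p) n. snd X n (k n x) = b n x)"
    and k': "psh_hom (std_cube p) (fst X) k' \<and> (\<forall>n. \<forall>x\<in>cells (boundary p) n. k' n x = a n x) \<and>
           (\<forall>n. \<forall>x\<in>cells (std_cube p) n. snd X n (k' n x) = b n x)"
  obtain n where n: "p = Suc n" "n \<ge> 1" using p by (cases p) auto
  define top where "top = (\<lambda>\<epsilon>\<in>vert p. \<epsilon>)"
  have top: "top \<in> cells (std_cube p) p" by (simp add: std_cube_def top_def box_id)
  have act_top: "act (std_cube p) (m, f, p) top = f" if "(m, f, p) \<in> box" for m f
    using compose_id_box(1)[OF that] by (simp add: std_cube_def top_def)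
  have lift: "l m f = act (fst X) (m, f, p) (l p top)"
    if "psh_hom (std_cube p) (fst X) l" "(m, f, p) \<in> box" for l m f
    using psh_hom_act[OF that top] act_top[OF that(2)] by simp
  have hk: "psh_hom (std_cube p) (fst X) k" and hk': "psh_hom (std_cube p) (fst X) k'" using k k' by auto
  have "k (Suc n) top = k' (Suc n) top"
  proof (rule det)
    show "k (Suc n) top \<in> cells (fst X) (Suc n)" "k' (Suc n) top \<in> cells (fst X) (Suc n)"
      using psh_hom_cell[OF hk top] psh_hom_cell[OF hk' top] by (simp_all add: n)
    show "snd X (Suc n) (k (Suc n) top) = snd X (Suc n) (k' (Suc n) top)"
      using k k' top by (simp add: n)
    fix i \<alpha> assume "i \<le> n"
    then have f: "(n, face n i \<alpha>, p) \<in> box" using box_face n by simp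
    then have "face n i \<alpha> \<in> cells (boundary p) n" by (simp add: boundary_def std_cube_def n)
    then have "k n (face n i \<alpha>) = k' n (face n i \<alpha>)" using k k' by simp
    then show "act (fst X) (n, face n i \<alpha>, Suc n) (k (Suc n) top) =
        act (fst X) (n, face n i \<alpha>, Suc n) (k' (Suc n) top)"
      using lift[OF hk f] lift[OF hk' f] by (simp add: n)
  qed (rule n(2))
  then have e: "k p top = k' p top" by (simp add: n)
  show "k = k'"
  proof (rule psh_hom_ext[OF hk hk'])
    fix m f assume "f \<in> cells (std_cube p) m"
    then have "(m, f, p) \<in> box" by (simp add: std_cube_def)
    then show "k m f = k' m f" using lift[OF hk] lift[OF hk'] e by simp
  qed
qed

text \<open>A realization together with the data whose existence it asserts: the copies \<open>Q a\<close> of the labelled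
  cubes and the identifications \<open>\<theta> a\<close> of their realizations with \<open>ts_cube a\<close>.\<close>

locale realization =
  fixes U :: "'u set set"
    and T :: "(('u, 'l) lps, ('u, 'l) lps_arr, ('u, 'u, 'l) ts, ('u, 'l) ts_arr) ftor"
    and Q :: "'l list \<Rightarrow> ('u, 'l) lps"
    and q :: "'l list \<Rightarrow> nat \<Rightarrow> (bool list \<Rightarrow> bool list) \<Rightarrow> 'u"
    and \<theta> :: "'l list \<Rightarrow> (bool list \<Rightarrow> 'u) \<times> ('l \<times> nat \<Rightarrow> 'u)"
  assumes U: "universe U" and labels: "small_type U TYPE('l)"
    and T: "is_functor (LPS U) (WHDTS U) T"
    and T_colimits: "preserves_small_colimits U (LPS U) (WHDTS U) T"
    and Q: "Q a \<in> Obj (LPS U)"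
    and q: "lps_iso (labelled_cube a) (Q a) (q a)"
    and \<theta>: "whdts_iso (ts_cube a) (fobj T (Q a)) (\<theta> a)"
    and cube_maps: "lps_hom (labelled_cube a) (labelled_cube b) F \<Longrightarrow> (Q a, G, Q b) \<in> Arr (LPS U) \<Longrightarrow>
      \<forall>n. \<forall>x\<in>cells (fst (labelled_cube a)) n. G n (q a n x) = q b n (F n x) \<Longrightarrow>
      farr T (Q a, G, Q b) = (fobj T (Q a), (t0, t1), fobj T (Q b)) \<Longrightarrow>
      (\<forall>\<epsilon>\<in>states (ts_cube a).
         t0 (fst (\<theta> a) \<epsilon>) = fst (\<theta> b) (fst (ts_cube_map a b (box_map (length a) F)) \<epsilon>)) \<and>
      (\<forall>u\<in>actions (ts_cube a).
         t1 (snd (\<theta> a) u) = snd (\<theta> b) (snd (ts_cube_map a b (box_map (length a) F)) u))"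
begin

subsection \<open>Cubes represent cells\<close>

text \<open>The top cell of the cube, which generates it.\<close>

definition gen :: "'l list \<Rightarrow> 'u" where
  "gen a = q a (length a) (\<lambda>\<epsilon>\<in>vert (length a). \<epsilon>)"

lemma labelled_Q: "labelled_sps (Q a)"
  using Q[of a] by (simp add: Obj_LPS)

lemma q_eq:
  assumes f: "(m, f, length a) \<in> box"
  shows "q a m f = act (fst (Q a)) (m, f, length a) (gen a)"
proof -
  have h: "psh_hom (std_cube (length a)) (fst (Q a)) (q a)"
    using q[of a] by (simp add: lps_iso_def lps_hom_def labelled_cube_def)
  have "(\<lambda>\<epsilon>\<in>vert (length a). \<epsilon>) \<in> cells (std_cube (length a)) (length a)"
    by (simp add: std_cube_def box_id)
  from psh_hom_act[OF h f this] show ?thesis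
    using compose_id_box(1)[OF f] by (simp add: gen_def std_cube_def)
qed

lemma q_label:
  assumes f: "(m, f, length a) \<in> box"
  shows "snd (Q a) m (q a m f) = act words (m, f, length a) a"
proof -
  have "lps_hom (labelled_cube a) (Q a) (q a)" using q[of a] by (simp add: lps_iso_def)
  from lps_homD(2)[OF this, of f m] f show ?thesis by (simp add: labelled_cube_def std_cube_def)
qed

lemma gen_cell: "gen a \<in> cells (fst (Q a)) (length a)"
proof -
  have h: "psh_hom (std_cube (length a)) (fst (Q a)) (q a)"
    using q[of a] by (simp add: lps_iso_def lps_hom_def labelled_cube_def)
  show ?thesis using psh_hom_cell[OF h] by (simp add: gen_def std_cube_def box_id)
qed

lemma gen_label: "snd (Q a) (length a) (gen a) = a"
  using q_label[OF box_id, of a] by (simp add: gen_def act_words_id)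

lemma Q_cell_label:
  assumes f: "(m, f, length a) \<in> box"
  shows "snd (Q a) m (act (fst (Q a)) (m, f, length a) (gen a)) = act words (m, f, length a) a"
  using q_label[OF f] q_eq[OF f] by simp

lemma Q_cells:
  assumes "y \<in> cells (fst (Q a)) m"
  shows "\<exists>!f. (m, f, length a) \<in> box \<and> act (fst (Q a)) (m, f, length a) (gen a) = y"
proof -
  obtain r where r: "lps_hom (Q a) (labelled_cube a) r"
    and rq: "\<And>n x. x \<in> cells (fst (labelled_cube a)) n \<Longrightarrow> r n (q a n x) = x"
    and qr: "\<And>n y. y \<in> cells (fst (Q a)) n \<Longrightarrow> q a n (r n y) = y"
    using q[of a] by (auto simp: lps_iso_def)
  have cube: "f \<in> cells (fst (labelled_cube a)) m \<longleftrightarrow> (m, f, length a) \<in> box" for m f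
    by (simp add: labelled_cube_def std_cube_def)
  have "(m, r m y, length a) \<in> box"
    using psh_hom_cell[OF lps_homD(1)[OF r] assms] by (simp add: cube)
  then show ?thesis
    using qr[OF assms] rq q_eq by (intro ex1I[of _ "r m y"]) (auto simp: cube)
qed

text \<open>The labels of the cells of a cube are the faces of its word. As these labels form a morphism of
  presheaves, the words are a presheaf.\<close>

lemma act_words_comp:
  fixes a :: "'l list"
  assumes g: "(l, g, m) \<in> box" and f: "(m, f, length a) \<in> box"
  shows "act words (l, compose (vert l) f g, length a) a = act words (l, g, m) (act words (m, f, length a) a)"
proof -
  note L = labelled_spsD[OF labelled_Q[of a]]
  have "act words (l, compose (vert l) f g, length a) a =
      snd (Q a) l (act (fst (Q a)) (l, g, m) (act (fst (Q a)) (m, f, length a) (gen a)))"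
    using Q_cell_label[OF box_comp[OF g f]] psh_act_comp[OF L(1) g f gen_cell] by simp
  also have "\<dots> = act words (l, g, m) (act words (m, f, length a) a)"
    using L(4)[OF g psh_act_cell[OF L(1) f gen_cell]] Q_cell_label[OF f] by simp
  finally show ?thesis .
qed

lemma arr_eq_Q:
  assumes d: "d \<in> hom (LPS U) (Q a) X" and e: "e \<in> hom (LPS U) (Q a) X"
    and eq: "arr_map d (length a) (gen a) = arr_map e (length a) (gen a)"
  shows "d = e"
proof (rule arr_eq_LPS[OF d e])
  fix m y assume "y \<in> cells (fst (Q a)) m"
  then obtain f where f: "(m, f, length a) \<in> box" "act (fst (Q a)) (m, f, length a) (gen a) = y"
    using ex1_implies_ex[OF Q_cells] by blast
  show "arr_map d m y = arr_map e m y"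
    using arr_map_LPS(7)[OF d f(1) gen_cell] arr_map_LPS(7)[OF e f(1) gen_cell] f(2) eq by simp
qed

text \<open>An arrow out of a cube is determined by the image of the generator, which can be any cell \<open>x\<close> with the
  same label: send the cell obtained from the generator by \<open>f\<close> to the one obtained from \<open>x\<close> by \<open>f\<close>.\<close>

lemma yoneda:
  assumes X: "X \<in> Obj (LPS U)" and x: "x \<in> cells (fst X) n"
  shows "\<exists>!e. e \<in> hom (LPS U) (Q (snd X n x)) X \<and> arr_map e n (gen (snd X n x)) = x"
proof -
  have LX: "labelled_sps X" using X by (simp add: Obj_LPS)
  note SX = labelled_spsD[OF LX]
  note SQ = labelled_spsD[OF labelled_Q]
  define a where "a = snd X n x"
  have n: "length a = n" using SX(3)[OF x] by (simp add: a_def)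
  \<comment> \<open>The morphism of cubes by which the cell \<open>y\<close> arises from the generator.\<close>
  define b where "b m y = (THE f. (m, f, n) \<in> box \<and> act (fst (Q a)) (m, f, n) (gen a) = y)" for m y
  have b: "(m, b m y, n) \<in> box" "act (fst (Q a)) (m, b m y, n) (gen a) = y" if "y \<in> cells (fst (Q a)) m" for m y
    using theI'[OF Q_cells[OF that]] by (simp_all add: b_def n)
  have b_act: "b m (act (fst (Q a)) (m, f, n) (gen a)) = f" if f: "(m, f, n) \<in> box" for m f
  proof -
    have "act (fst (Q a)) (m, f, n) (gen a) \<in> cells (fst (Q a)) m"
      using psh_act_cell[OF SQ(1), of m f n "gen a" a] gen_cell[of a] f by (simp add: n)
    from the1_equality[OF Q_cells[OF this]] show ?thesis using f by (simp add: b_def n)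
  qed
  define \<eta> where "\<eta> m = (\<lambda>y\<in>cells (fst (Q a)) m. act (fst X) (m, b m y, n) x)" for m
  have "lps_hom (Q a) X \<eta>"
  proof (rule lps_homI)
    show "psh_hom (fst (Q a)) (fst X) \<eta>"
    proof (rule psh_homI)
      show "\<eta> m y \<in> cells (fst X) m" if "y \<in> cells (fst (Q a)) m" for m y
        using psh_act_cell[OF SX(1) b(1)[OF that] x] that by (simp add: \<eta>_def)
      show "\<eta> m y = undefined" if "y \<notin> cells (fst (Q a)) m" for m y using that by (simp add: \<eta>_def)
      fix l g m y assume g: "(l, g, m) \<in> box" and y: "y \<in> cells (fst (Q a)) m"
      have "act (fst (Q a)) (l, compose (vert l) (b m y) g, n) (gen a) = act (fst (Q a)) (l, g, m) y"
        using psh_act_comp[OF SQ(1) g b(1)[OF y], of "gen a" a] gen_cell[of a] b(2)[OF y] by (simp add: n)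
      then have "b l (act (fst (Q a)) (l, g, m) y) = compose (vert l) (b m y) g"
        using b_act[OF box_comp[OF g b(1)[OF y]]] by simp
      then show "\<eta> l (act (fst (Q a)) (l, g, m) y) = act (fst X) (l, g, m) (\<eta> m y)"
        using psh_act_cell[OF SQ(1) g y] psh_act_comp[OF SX(1) g b(1)[OF y] x] y by (simp add: \<eta>_def)
    qed
    show "snd X m (\<eta> m y) = snd (Q a) m y" if y: "y \<in> cells (fst (Q a)) m" for m y
      using SX(4)[OF b(1)[OF y] x] Q_cell_label[of m "b m y" a] b[OF y] y by (simp add: \<eta>_def n a_def[symmetric])
  qed (rule label_undefined[OF labelled_Q])
  then have e: "(Q a, \<eta>, X) \<in> hom (LPS U) (Q a) X" using Q X by (simp add: hom_LPS)
  have "b n (gen a) = (\<lambda>\<epsilon>\<in>vert n. \<epsilon>)"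
    using b_act[OF box_id] psh_act_id[OF SQ(1) gen_cell[of a]] by (simp add: n)
  then have "\<eta> n (gen a) = x"
    using gen_cell[of a] psh_act_id[OF SX(1) x] by (simp add: \<eta>_def n)
  then have x': "arr_map (Q a, \<eta>, X) n (gen a) = x" by simp
  show ?thesis
    unfolding a_def[symmetric]
  proof (rule ex1I[of _ "(Q a, \<eta>, X)"])
    show "(Q a, \<eta>, X) \<in> hom (LPS U) (Q a) X \<and> arr_map (Q a, \<eta>, X) n (gen a) = x" using e x' by simp
    fix d assume d: "d \<in> hom (LPS U) (Q a) X \<and> arr_map d n (gen a) = x"
    show "d = (Q a, \<eta>, X)" by (rule arr_eq_Q[OF _ e]) (use d x' n in simp_all)
  qed
qed

definition classify :: "('u, 'l) lps \<Rightarrow> nat \<Rightarrow> 'u \<Rightarrow> ('u, 'l) lps_arr" where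
  "classify X n x = (THE e. e \<in> hom (LPS U) (Q (snd X n x)) X \<and> arr_map e n (gen (snd X n x)) = x)"

lemma classify:
  assumes "X \<in> Obj (LPS U)" "x \<in> cells (fst X) n"
  shows "classify X n x \<in> hom (LPS U) (Q (snd X n x)) X" "arr_map (classify X n x) n (gen (snd X n x)) = x"
  using theI'[OF yoneda[OF assms]] by (simp_all add: classify_def)

lemma classify_eqI:
  assumes e: "e \<in> hom (LPS U) (Q a) X" and x: "arr_map e (length a) (gen a) = x" and n: "length a = n"
  shows "x \<in> cells (fst X) n" "snd X n x = a" "classify X n x = e"
proof -
  have X: "X \<in> Obj (LPS U)" using e by (simp add: hom_LPS)
  show c: "x \<in> cells (fst X) n" using arr_map_LPS(5)[OF e gen_cell] x n by simp
  show l: "snd X n x = a" using arr_map_LPS(6)[OF e gen_cell] gen_label[of a] x n by simp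
  show "classify X n x = e"
    using the1_equality[OF yoneda[OF X c]] e x n unfolding classify_def l by blast
qed

text \<open>Under the identification of \<open>Q a\<close> with the labelled cube of \<open>a\<close>, this is composition with \<open>f\<close>.\<close>

definition cube_arr :: "'l list \<Rightarrow> nat \<Rightarrow> (bool list \<Rightarrow> bool list) \<Rightarrow> ('u, 'l) lps_arr" where
  "cube_arr a m f = classify (Q a) m (act (fst (Q a)) (m, f, length a) (gen a))"

lemma cube_arr:
  assumes f: "(m, f, length a) \<in> box"
  shows "cube_arr a m f \<in> hom (LPS U) (Q (act words (m, f, length a) a)) (Q a)"
    "arr_map (cube_arr a m f) m (gen (act words (m, f, length a) a)) = act (fst (Q a)) (m, f, length a) (gen a)"
  using classify[OF Q psh_act_cell[OF labelled_spsD(1)[OF labelled_Q] f gen_cell]]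
  unfolding Q_cell_label[OF f] cube_arr_def by simp_all

lemma arr_map_comp_cube_arr:
  assumes e: "e \<in> hom (LPS U) (Q a) X" and f: "(m, f, length a) \<in> box"
  shows "arr_map (Cmp (LPS U) e (cube_arr a m f)) m (gen (act words (m, f, length a) a)) =
    act (fst X) (m, f, length a) (arr_map e (length a) (gen a))"
  using arr_map_Cmp_LPS[OF cube_arr(1)[OF f] e, of "gen (act words (m, f, length a) a)" m]
    gen_cell[of "act words (m, f, length a) a"] cube_arr(2)[OF f] arr_map_LPS(7)[OF e f gen_cell]
  by (simp add: length_act_words)

lemma cube_arr_id: "cube_arr a (length a) (\<lambda>\<epsilon>\<in>vert (length a). \<epsilon>) = Idn (LPS U) (Q a)"
proof (rule arr_eq_Q)
  show "cube_arr a (length a) (\<lambda>\<epsilon>\<in>vert (length a). \<epsilon>) \<in> hom (LPS U) (Q a) (Q a)"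
    using cube_arr(1)[OF box_id, of a] by (simp add: act_words_id)
  show "Idn (LPS U) (Q a) \<in> hom (LPS U) (Q a) (Q a)" using Idn_hom[OF category_LPS Q] .
  show "arr_map (cube_arr a (length a) (\<lambda>\<epsilon>\<in>vert (length a). \<epsilon>)) (length a) (gen a) =
      arr_map (Idn (LPS U) (Q a)) (length a) (gen a)"
    using cube_arr(2)[OF box_id, of a] psh_act_id[OF labelled_spsD(1)[OF labelled_Q] gen_cell[of a]] gen_cell[of a]
    by (simp add: act_words_id LPS_ops)
qed

lemma cube_arr_comp:
  assumes g: "(l, g, m) \<in> box" and f: "(m, f, length a) \<in> box"
  shows "cube_arr a l (compose (vert l) f g) =
    Cmp (LPS U) (cube_arr a m f) (cube_arr (act words (m, f, length a) a) l g)"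
proof -
  let ?b = "act words (m, f, length a) a"
  have b: "length ?b = m" by (rule length_act_words)
  have g': "(l, g, length ?b) \<in> box" using g b by simp
  have w: "act words (l, compose (vert l) f g, length a) a = act words (l, g, length ?b) ?b"
    using act_words_comp[OF g f] b by simp
  note h = cube_arr(1)[OF box_comp[OF g f], unfolded w]
  show ?thesis
  proof (rule arr_eq_Q[OF h Cmp_hom[OF category_LPS cube_arr(1)[OF g'] cube_arr(1)[OF f]]])
    let ?c = "act words (l, g, length ?b) ?b"
    have c: "length ?c = l" by (rule length_act_words)
    show "arr_map (cube_arr a l (compose (vert l) f g)) (length ?c) (gen ?c) =
        arr_map (Cmp (LPS U) (cube_arr a m f) (cube_arr ?b l g)) (length ?c) (gen ?c)"
      using cube_arr(2)[OF box_comp[OF g f]] arr_map_comp_cube_arr[OF cube_arr(1)[OF f] g'] cube_arr(2)[OF f]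
        psh_act_comp[OF labelled_spsD(1)[OF labelled_Q] g f gen_cell[of a]]
      by (simp add: w length_act_words)
  qed
qed

text \<open>The image of the generator of \<open>Q a\<close> is a cell of \<open>Q b\<close>, so it comes from the generator of \<open>Q b\<close> by a
  morphism of cubes.\<close>

lemma arr_between_cubes:
  assumes f: "f \<in> hom (LPS U) (Q a) (Q b)"
  obtains k where "(length a, k, length b) \<in> box" "a = act words (length a, k, length b) b"
    "f = cube_arr b (length a) k"
proof -
  have y: "arr_map f (length a) (gen a) \<in> cells (fst (Q b)) (length a)" using arr_map_LPS(5)[OF f gen_cell] .
  obtain k where k: "(length a, k, length b) \<in> box"
    "act (fst (Q b)) (length a, k, length b) (gen b) = arr_map f (length a) (gen a)"
    using ex1_implies_ex[OF Q_cells[OF y]] by blast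
  have "a = act words (length a, k, length b) b"
    using arr_map_LPS(6)[OF f gen_cell] gen_label[of a] Q_cell_label[OF k(1)] k(2) by simp
  moreover have "f = cube_arr b (length a) k"
    unfolding cube_arr_def k(2) using classify_eqI(3)[OF f refl refl] by simp
  ultimately show thesis using that k(1) by blast
qed

subsection \<open>Density of the cubes\<close>

lemma classify_act:
  assumes X: "X \<in> Obj (LPS U)" and f: "(m, f, n) \<in> box" and x: "x \<in> cells (fst X) n"
  shows "classify X m (act (fst X) (m, f, n) x) = Cmp (LPS U) (classify X n x) (cube_arr (snd X n x) m f)"
proof -
  have LX: "labelled_sps X" using X by (simp add: Obj_LPS)
  let ?a = "snd X n x"
  have n: "length ?a = n" using labelled_spsD(3)[OF LX x] .
  have f': "(m, f, length ?a) \<in> box" using f n by simp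
  note e = classify[OF X x]
  show ?thesis
    by (rule classify_eqI(3)[OF Cmp_hom[OF category_LPS cube_arr(1)[OF f'] e(1)]])
      (use arr_map_comp_cube_arr[OF e(1) f'] e(2) n in \<open>simp_all add: length_act_words\<close>)
qed

text \<open>A cocone \<open>\<iota>\<close> over the cubes of \<open>X\<close> is induced by exactly one arrow: it sends a cell \<open>x\<close> to the
  image of the generator under the leg at the arrow that classifies \<open>x\<close>.\<close>

lemma dense_cubes: "dense (LPS U) Q"
  unfolding dense_def is_colimit_def
proof (intro ballI conjI allI impI)
  fix X :: "('u, 'l) lps" assume X: "X \<in> Obj (LPS U)"
  have LX: "labelled_sps X" using X by (simp add: Obj_LPS)
  note SX = labelled_spsD[OF LX]
  have cocone: "cocone (LPS U) (over_cat (LPS U) Q X) (over_dom Q) Z \<iota> \<longleftrightarrow> Z \<in> Obj (LPS U) \<and>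
     (\<forall>a e. e \<in> hom (LPS U) (Q a) X \<longrightarrow> \<iota> (a, e) \<in> hom (LPS U) (Q a) Z) \<and>
     (\<forall>a b f e. f \<in> hom (LPS U) (Q a) (Q b) \<longrightarrow> e \<in> hom (LPS U) (Q b) X \<longrightarrow>
        Cmp (LPS U) (\<iota> (b, e)) f = \<iota> (a, Cmp (LPS U) e f))" for Z \<iota>
    using cocone_over_cat[OF category_LPS, of "LPS U" U Q X inclusion Z \<iota>]
    unfolding ftor_comp_inclusion by (simp add: inclusion_def)
  show "cocone (LPS U) (over_cat (LPS U) Q X) (over_dom Q) X snd"
    unfolding cocone using X by simp
  fix Z \<iota> assume "cocone (LPS U) (over_cat (LPS U) Q X) (over_dom Q) Z \<iota>"
  then have Z: "Z \<in> Obj (LPS U)"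
    and \<iota>: "\<And>a e. e \<in> hom (LPS U) (Q a) X \<Longrightarrow> \<iota> (a, e) \<in> hom (LPS U) (Q a) Z"
    and \<iota>_nat: "\<And>a b f e. f \<in> hom (LPS U) (Q a) (Q b) \<Longrightarrow> e \<in> hom (LPS U) (Q b) X \<Longrightarrow>
        Cmp (LPS U) (\<iota> (b, e)) f = \<iota> (a, Cmp (LPS U) e f)"
    unfolding cocone by blast+
  define \<gamma> where "\<gamma> n = (\<lambda>x\<in>cells (fst X) n.
      arr_map (\<iota> (snd X n x, classify X n x)) n (gen (snd X n x)))" for n
  have \<gamma>_cell: "\<gamma> n x \<in> cells (fst Z) n" "snd Z n (\<gamma> n x) = snd X n x" if x: "x \<in> cells (fst X) n" for n x
    using classify_eqI(1,2)[OF \<iota>[OF classify(1)[OF X x]] refl SX(3)[OF x]] x SX(3)[OF x] by (simp_all add: \<gamma>_def)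
  have "lps_hom X Z \<gamma>"
  proof (rule lps_homI)
    show "psh_hom (fst X) (fst Z) \<gamma>"
    proof (rule psh_homI)
      show "\<gamma> n x = undefined" if "x \<notin> cells (fst X) n" for n x using that by (simp add: \<gamma>_def)
      fix m f n x assume f: "(m, f, n) \<in> box" and x: "x \<in> cells (fst X) n"
      let ?a = "snd X n x"
      have n: "length ?a = n" using SX(3)[OF x] .
      have f': "(m, f, length ?a) \<in> box" using f n by simp
      have "\<iota> (act words (m, f, n) ?a, classify X m (act (fst X) (m, f, n) x)) =
          Cmp (LPS U) (\<iota> (?a, classify X n x)) (cube_arr ?a m f)"
        using \<iota>_nat[OF cube_arr(1)[OF f'] classify(1)[OF X x]] classify_act[OF X f x] n by simp
      then show "\<gamma> m (act (fst X) (m, f, n) x) = act (fst Z) (m, f, n) (\<gamma> n x)"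
        using arr_map_comp_cube_arr[OF \<iota>[OF classify(1)[OF X x]] f'] SX(4)[OF f x] psh_act_cell[OF SX(1) f x] x n
        by (simp add: \<gamma>_def)
    qed (rule \<gamma>_cell(1))
  qed (erule label_undefined[OF LX], erule \<gamma>_cell(2))
  then have g: "(X, \<gamma>, Z) \<in> hom (LPS U) X Z" using X Z by (simp add: hom_LPS)
  show "\<exists>!h. h \<in> hom (LPS U) X Z \<and> (\<forall>j\<in>Obj (over_cat (LPS U) Q X). Cmp (LPS U) h (snd j) = \<iota> j)"
  proof (rule ex1I[of _ "(X, \<gamma>, Z)"])
    have "Cmp (LPS U) (X, \<gamma>, Z) e = \<iota> (a, e)" if e: "e \<in> hom (LPS U) (Q a) X" for a e
    proof (rule arr_eq_Q[OF Cmp_hom[OF category_LPS e g] \<iota>[OF e]])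
      note c = classify_eqI[OF e refl refl]
      show "arr_map (Cmp (LPS U) (X, \<gamma>, Z) e) (length a) (gen a) = arr_map (\<iota> (a, e)) (length a) (gen a)"
        using arr_map_Cmp_LPS[OF e g gen_cell] c by (simp add: \<gamma>_def)
    qed
    then show "(X, \<gamma>, Z) \<in> hom (LPS U) X Z \<and>
        (\<forall>j\<in>Obj (over_cat (LPS U) Q X). Cmp (LPS U) (X, \<gamma>, Z) (snd j) = \<iota> j)"
      using g by (simp add: Obj_over_cat)
    fix h assume h: "h \<in> hom (LPS U) X Z \<and> (\<forall>j\<in>Obj (over_cat (LPS U) Q X). Cmp (LPS U) h (snd j) = \<iota> j)"
    then have hX: "h \<in> hom (LPS U) X Z" by simp
    show "h = (X, \<gamma>, Z)"
    proof (rule arr_eq_LPS[OF hX g])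
      fix n x assume x: "x \<in> cells (fst X) n"
      note e = classify[OF X x]
      have "(snd X n x, classify X n x) \<in> Obj (over_cat (LPS U) Q X)"
        using e(1) by (simp add: Obj_over_cat)
      from bspec[OF conjunct2[OF h] this]
      have "Cmp (LPS U) h (classify X n x) = \<iota> (snd X n x, classify X n x)" by simp
      then show "arr_map h n x = arr_map (X, \<gamma>, Z) n x"
        using arr_map_Cmp_LPS[OF e(1) hX, of "gen (snd X n x)" n] gen_cell[of "snd X n x"] SX(3)[OF x] e(2) x
        by (simp add: \<gamma>_def)
    qed
  qed
qed

lemma small_words: "small U (UNIV :: 'l list set)"
proof -
  have "small U (UNIV :: 'l set)" using labels by (auto simp: small_type_def small_def)
  from small_lists[OF U this] show ?thesis by simp
qed

lemma small_hom_Q: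
  assumes X: "X \<in> Obj (LPS U)" shows "small U (hom (LPS U) (Q a) X)"
proof (rule small_inj[OF U])
  show "small U (cells (fst X) (length a))" using X by (auto simp: Obj_LPS intro: small_mem)
  show "inj_on (\<lambda>e. arr_map e (length a) (gen a)) (hom (LPS U) (Q a) X)"
    by (rule inj_onI) (rule arr_eq_Q)
  show "(\<lambda>e. arr_map e (length a) (gen a)) ` hom (LPS U) (Q a) X \<subseteq> cells (fst X) (length a)"
    using arr_map_LPS(5)[OF _ gen_cell] by (rule image_subsetI)
qed

text \<open>By the Yoneda lemma the arrows from cubes to \<open>X\<close> are no more numerous than the cells of \<open>X\<close>, so the
  canonical diagram is small and \<open>T\<close> preserves its colimit.\<close>

lemma T_preserves_density:
  assumes X: "X \<in> Obj (LPS U)"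
  shows "is_colimit (WHDTS U) (over_cat (LPS U) Q X) (ftor_comp T (over_dom Q)) (fobj T X) (\<lambda>x. farr T (snd x))"
proof (rule preserves_colimit_small_index[OF T_colimits category_over_cat[OF category_LPS]])
  show "small U (Obj (over_cat (LPS U) Q X))" "small U (Arr (over_cat (LPS U) Q X))"
    using small_over_cat[OF U small_words, of "LPS U" Q X] small_hom_Q Q X by simp_all
  show "is_functor (over_cat (LPS U) Q X) (LPS U) (over_dom Q)" by (rule functor_over_dom[OF category_LPS])
  show "is_colimit (LPS U) (over_cat (LPS U) Q X) (over_dom Q) X snd"
    using dense_cubes X by (simp add: dense_def)
qed

section \<open>The nerve of a transition system\<close>

subsection \<open>Realized cubes\<close>

definition TQ :: "'l list \<Rightarrow> ('u, 'u, 'l) ts" where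
  "TQ a = fobj T (Q a)"

lemma states_TQ: "states (TQ a) = fst (\<theta> a) ` vert (length a)"
  and actions_TQ: "actions (TQ a) = (\<lambda>i. snd (\<theta> a) (a ! i, i)) ` {..<length a}"
proof -
  obtain g where h: "whdts_hom (ts_cube a) (TQ a) (\<theta> a)" and g: "whdts_hom (TQ a) (ts_cube a) g"
    and inv: "\<And>s. s \<in> states (TQ a) \<Longrightarrow> fst (\<theta> a) (fst g s) = s"
      "\<And>u. u \<in> actions (TQ a) \<Longrightarrow> snd (\<theta> a) (snd g u) = u"
    using \<theta>[of a] unfolding whdts_iso_def TQ_def[symmetric] by blast
  have "fst (\<theta> a) ` states (ts_cube a) = states (TQ a)"
    using whdts_homD(3)[OF h] whdts_homD(3)[OF g] inv(1) by (force intro!: image_eqI)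
  then show "states (TQ a) = fst (\<theta> a) ` vert (length a)" by (simp add: ts_cube_def)
  have "snd (\<theta> a) ` actions (ts_cube a) = actions (TQ a)"
    using whdts_homD(4)[OF h] whdts_homD(4)[OF g] inv(2) by (force intro!: image_eqI)
  moreover have "actions (ts_cube a) = (\<lambda>i. (a ! i, i)) ` {..<length a}" by (auto simp: ts_cube_def)
  ultimately show "actions (TQ a) = (\<lambda>i. snd (\<theta> a) (a ! i, i)) ` {..<length a}"
    by (simp add: image_image)
qed

lemma finite_TQ: "finite (states (TQ a))" "finite (actions (TQ a))"
proof -
  have "finite (vert n)" for n
    using finite_lists_length_eq[of "UNIV :: bool set" n] by (simp add: vert_def)
  then show "finite (states (TQ a))" "finite (actions (TQ a))"
    by (simp_all add: states_TQ actions_TQ)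
qed

definition real_arr :: "'l list \<Rightarrow> nat \<Rightarrow> (bool list \<Rightarrow> bool list) \<Rightarrow> ('u, 'l) ts_arr" where
  "real_arr a m f = farr T (cube_arr a m f)"

lemma real_arr:
  assumes "(m, f, length a) \<in> box"
  shows "real_arr a m f \<in> hom (WHDTS U) (TQ (act words (m, f, length a) a)) (TQ a)"
  unfolding real_arr_def TQ_def using functor_hom[OF T cube_arr(1)[OF assms]] .

text \<open>The description of \<open>T\<close> on the maps of labelled cubes, expressed for \<open>cube_arr\<close>: the map \<open>F\<close>, which is
  composition with \<open>f\<close>, corresponds to \<open>cube_arr a m f\<close> under the isomorphisms \<open>q\<close>.\<close>

lemma real_arr_formula:
  assumes f: "(m, f, length a) \<in> box"
  defines "b \<equiv> act words (m, f, length a) a"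
  shows "\<epsilon> \<in> vert m \<Longrightarrow> fst (arr_map (real_arr a m f)) (fst (\<theta> b) \<epsilon>) = fst (\<theta> a) (f \<epsilon>)"
    and "i < m \<Longrightarrow> snd (arr_map (real_arr a m f)) (snd (\<theta> b) (b ! i, i)) =
           snd (\<theta> a) (b ! i, hat_inv m f (length a) i)"
proof -
  have b: "length b = m" unfolding b_def by (rule length_act_words)
  define F where "F k = (\<lambda>g\<in>{g. (k, g, m) \<in> box}. compose (vert k) f g)" for k
  define G where "G = arr_map (cube_arr a m f)"
  have cube: "cells (fst (labelled_cube c)) k = {g. (k, g, length c) \<in> box}"
    "snd (labelled_cube c) k = (\<lambda>g\<in>{g. (k, g, length c) \<in> box}. act words (k, g, length c) c)"
    "act (fst (labelled_cube c)) (l, g, k) h = compose (vert l) h g" for c :: "'l list" and k l g h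
    by (simp_all add: labelled_cube_def std_cube_def)
  have F: "lps_hom (labelled_cube b) (labelled_cube a) F"
  proof (rule lps_homI)
    show "psh_hom (fst (labelled_cube b)) (fst (labelled_cube a)) F"
    proof (rule psh_homI)
      show "F k g \<in> cells (fst (labelled_cube a)) k" if "g \<in> cells (fst (labelled_cube b)) k" for k g
        using that box_comp[OF _ f] by (simp add: cube F_def b)
      show "F k g = undefined" if "g \<notin> cells (fst (labelled_cube b)) k" for k g
        using that by (simp add: cube F_def b)
      fix l h k g assume h: "(l, h, k) \<in> box" and g: "g \<in> cells (fst (labelled_cube b)) k"
      have g': "(k, g, m) \<in> box" using g by (simp add: cube b)
      have "h \<in> vert l \<rightarrow> vert k" using box_extensional[OF h] by (simp add: PiE_def)
      then have "compose (vert l) f (compose (vert l) g h) = compose (vert l) (compose (vert k) f g) h"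
        by (rule compose_assoc)
      then show "F l (act (fst (labelled_cube b)) (l, h, k) g) = act (fst (labelled_cube a)) (l, h, k) (F k g)"
        using g' box_comp[OF h g'] by (simp add: cube F_def)
    qed
    show "snd (labelled_cube a) k (F k g) = snd (labelled_cube b) k g"
      if "g \<in> cells (fst (labelled_cube b)) k" for k g
      using that box_comp[OF _ f, of k g] act_words_comp[OF _ f, of k g]
      by (simp add: cube F_def b) (simp add: b_def)
  qed (simp add: cube)
  have h: "(Q b, G, Q a) \<in> hom (LPS U) (Q b) (Q a)"
    using cube_arr(1)[OF f] arr_map_LPS(1)[OF cube_arr(1)[OF f]] unfolding G_def b_def by simp
  have c: "cube_arr a m f = (Q b, G, Q a)"
    using arr_map_LPS(1)[OF cube_arr(1)[OF f]] unfolding G_def b_def .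
  have Fq: "\<forall>k. \<forall>g\<in>cells (fst (labelled_cube b)) k. G k (q b k g) = q a k (F k g)"
  proof (intro allI ballI)
    fix k g assume "g \<in> cells (fst (labelled_cube b)) k"
    then have g: "(k, g, m) \<in> box" by (simp add: cube b)
    have gb: "(k, g, length b) \<in> box" using g b by simp
    have "G k (q b k g) = act (fst (Q a)) (k, g, m) (G m (gen b))"
      using arr_map_LPS(7)[OF h gb gen_cell] q_eq[OF gb] b by simp
    also have "G m (gen b) = act (fst (Q a)) (m, f, length a) (gen a)"
      unfolding G_def b_def by (rule cube_arr(2)[OF f])
    also have "act (fst (Q a)) (k, g, m) \<dots> = q a k (F k g)"
      using psh_act_comp[OF labelled_spsD(1)[OF labelled_Q] g f gen_cell] q_eq[OF box_comp[OF g f]] g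
      by (simp add: F_def)
    finally show "G k (q b k g) = q a k (F k g)" .
  qed
  have rh: "real_arr a m f \<in> hom (WHDTS U) (TQ b) (TQ a)" unfolding b_def by (rule real_arr[OF f])
  have r: "farr T (Q b, G, Q a) =
      (fobj T (Q b), (fst (arr_map (real_arr a m f)), snd (arr_map (real_arr a m f))), fobj T (Q a))"
    using arr_map_WHDTS(1)[OF rh] by (simp add: real_arr_def c TQ_def)
  have "(Q b, G, Q a) \<in> Arr (LPS U)" using h by (simp add: hom_def)
  note formula = cube_maps[OF F this Fq r]
  have top: "box_map m F = f"
    using compose_id_box(2)[OF f] by (simp add: box_map_def F_def box_id)
  show "fst (arr_map (real_arr a m f)) (fst (\<theta> b) \<epsilon>) = fst (\<theta> a) (f \<epsilon>)" if "\<epsilon> \<in> vert m"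
    using formula that by (simp add: ts_cube_def ts_cube_map_def top b)
  show "snd (arr_map (real_arr a m f)) (snd (\<theta> b) (b ! i, i)) =
      snd (\<theta> a) (b ! i, hat_inv m f (length a) i)" if "i < m"
  proof -
    have "(b ! i, i) \<in> actions (ts_cube b)" using that b by (auto simp: ts_cube_def)
    then show ?thesis using formula by (simp add: ts_cube_map_def top b)
  qed
qed

text \<open>Every state of a cube of positive dimension lies on a face, and so does every action as soon as
  the dimension is at least \<open>2\<close>: the first action lies on the faces that fix the second coordinate,
  the others on the faces that fix the first one.\<close>

lemma determined_on_faces:
  assumes a: "length a = Suc n" and n: "n \<ge> 1"
    and g: "g \<in> hom (WHDTS U) (TQ a) Y" and h: "h \<in> hom (WHDTS U) (TQ a) Y"
    and eq: "\<And>i \<alpha>. i \<le> n \<Longrightarrow>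
      Cmp (WHDTS U) g (real_arr a n (face n i \<alpha>)) = Cmp (WHDTS U) h (real_arr a n (face n i \<alpha>))"
  shows "g = h"
proof (rule arr_eq_WHDTS[OF g h])
  define b where "b i \<alpha> = act words (n, face n i \<alpha>, length a) a" for i \<alpha>
  have b: "length (b i \<alpha>) = n" for i \<alpha> unfolding b_def by (rule length_act_words)
  have f: "(n, face n i \<alpha>, length a) \<in> box" if "i \<le> n" for i \<alpha> using box_face[OF that] a by simp
  have r: "real_arr a n (face n i \<alpha>) \<in> hom (WHDTS U) (TQ (b i \<alpha>)) (TQ a)" if "i \<le> n" for i \<alpha>
    unfolding b_def by (rule real_arr[OF f[OF that]])
  note formula = real_arr_formula[OF f, folded b_def]
  {
    fix s assume "s \<in> states (TQ a)"
    then obtain \<epsilon> where \<epsilon>: "length \<epsilon> = Suc n" "s = fst (\<theta> a) \<epsilon>" by (auto simp: states_TQ vert_def a)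
    obtain \<alpha> \<delta> where \<delta>: "\<epsilon> = \<alpha> # \<delta>" "length \<delta> = n" using \<epsilon>(1) by (cases \<epsilon>) auto
    let ?s = "fst (\<theta> (b 0 \<alpha>)) \<delta>"
    have v: "\<delta> \<in> vert n" using \<delta>(2) by (simp add: vert_def)
    have s': "?s \<in> states (TQ (b 0 \<alpha>))" using v by (simp add: states_TQ b)
    have "s = fst (arr_map (real_arr a n (face n 0 \<alpha>))) ?s"
      using formula(1)[of 0 \<delta> \<alpha>] v \<epsilon>(2) \<delta>(1) by (simp add: face_def)
    then show "fst (arr_map g) s = fst (arr_map h) s"
      using arr_map_Cmp_WHDTS(1)[OF r[of 0] g s'] arr_map_Cmp_WHDTS(1)[OF r[of 0] h s'] eq[of 0] by simp
  next
    fix u assume "u \<in> actions (TQ a)"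
    then obtain k where k: "k < Suc n" "u = snd (\<theta> a) (a ! k, k)" by (auto simp: actions_TQ a)
    obtain i j where i: "i \<le> n" and j: "j < n" and hat: "hat_inv n (face n i False) (Suc n) j = k"
    proof (cases k)
      case 0
      then show thesis using that[of 1 0] n hat_inv_face[of 1 n 0] by simp
    next
      case (Suc l)
      then show thesis using that[of 0 l] k(1) hat_inv_face[of 0 n l] by simp
    qed
    let ?u = "snd (\<theta> (b i False)) (b i False ! j, j)"
    have u': "?u \<in> actions (TQ (b i False))" using j by (simp add: actions_TQ b)
    have "b i False ! j = a ! k" unfolding b_def using hat a by (simp add: nth_act_words[OF j])
    then have "u = snd (arr_map (real_arr a n (face n i False))) ?u"
      using formula(2)[OF i j, of False] k(2) hat a by simp
    then show "snd (arr_map g) u = snd (arr_map h) u"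
      using arr_map_Cmp_WHDTS(2)[OF r[OF i] g u'] arr_map_Cmp_WHDTS(2)[OF r[OF i] h u'] eq[OF i] by simp
  }
qed

lemma real_arr_id: "real_arr a (length a) (\<lambda>\<epsilon>\<in>vert (length a). \<epsilon>) = Idn (WHDTS U) (TQ a)"
  unfolding real_arr_def cube_arr_id TQ_def by (rule functor_Idn[OF T Q])

lemma real_arr_comp:
  assumes g: "(l, g, m) \<in> box" and f: "(m, f, length a) \<in> box"
  shows "real_arr a l (compose (vert l) f g) =
    Cmp (WHDTS U) (real_arr a m f) (real_arr (act words (m, f, length a) a) l g)"
  unfolding real_arr_def cube_arr_comp[OF g f]
  by (rule functor_Cmp[OF T cube_arr(1) cube_arr(1)[OF f]]) (simp add: length_act_words g)

subsection \<open>The nerve represents the arrows out of realized cubes\<close>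

text \<open>A cell of the nerve of \<open>Y\<close> is a word \<open>a\<close> together with an arrow from the realized cube of \<open>a\<close>
  to \<open>Y\<close>, encoded as an element of \<open>'u\<close>.\<close>

definition singular :: "('u, 'u, 'l) ts \<Rightarrow> ('l list \<times> ('u, 'l) ts_arr) set" where
  "singular Y = {(a, h). h \<in> hom (WHDTS U) (TQ a) Y}"

definition encode :: "('u, 'u, 'l) ts \<Rightarrow> 'l list \<times> ('u, 'l) ts_arr \<Rightarrow> 'u" where
  "encode Y = (SOME e. inj_on e (singular Y) \<and> e ` singular Y \<in> U)"

definition decode :: "('u, 'u, 'l) ts \<Rightarrow> 'u \<Rightarrow> 'l list \<times> ('u, 'l) ts_arr" where
  "decode Y = inv_into (singular Y) (encode Y)"

definition nerve_cells :: "('u, 'u, 'l) ts \<Rightarrow> nat \<Rightarrow> 'u set" where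
  "nerve_cells Y n = encode Y ` {(a, h). length a = n \<and> h \<in> hom (WHDTS U) (TQ a) Y}"

definition nerve_act :: "('u, 'u, 'l) ts \<Rightarrow> box_arr \<Rightarrow> 'u \<Rightarrow> 'u" where
  "nerve_act Y = (\<lambda>(m, f, n) x. case decode Y x of (a, h) \<Rightarrow>
     encode Y (act words (m, f, n) a, Cmp (WHDTS U) h (real_arr a m f)))"

definition nerve :: "('u, 'u, 'l) ts \<Rightarrow> ('u, 'l) lps" where
  "nerve Y = (\<lparr>cells = nerve_cells Y, act = nerve_act Y\<rparr>,
     \<lambda>n. \<lambda>x\<in>nerve_cells Y n. fst (decode Y x))"

lemma encode:
  assumes Y: "Y \<in> Obj (WHDTS U)"
  shows "inj_on (encode Y) (singular Y)" "encode Y ` singular Y \<in> U"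
proof -
  have "small U (Sigma UNIV (\<lambda>a. hom (WHDTS U) (TQ a) Y))"
    by (intro small_Sigma[OF U] small_words small_hom_WHDTS[OF U finite_TQ Y])
  moreover have "singular Y = Sigma UNIV (\<lambda>a. hom (WHDTS U) (TQ a) Y)" by (auto simp: singular_def)
  ultimately have "\<exists>e :: _ \<Rightarrow> 'u. inj_on e (singular Y) \<and> e ` singular Y \<in> U"
    by (simp add: small_def)
  from someI_ex[OF this] show "inj_on (encode Y) (singular Y)" "encode Y ` singular Y \<in> U"
    by (simp_all add: encode_def)
qed

lemma decode_encode:
  "Y \<in> Obj (WHDTS U) \<Longrightarrow> h \<in> hom (WHDTS U) (TQ a) Y \<Longrightarrow> decode Y (encode Y (a, h)) = (a, h)"
  unfolding decode_def by (rule inv_into_f_f[OF encode(1)]) (simp_all add: singular_def)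

lemma nerve_cellE:
  assumes "x \<in> cells (fst (nerve Y)) n"
  obtains a h where "x = encode Y (a, h)" "length a = n" "h \<in> hom (WHDTS U) (TQ a) Y"
  using assms by (auto simp: nerve_def nerve_cells_def)

lemma nerve_simps:
  assumes Y: "Y \<in> Obj (WHDTS U)" and h: "h \<in> hom (WHDTS U) (TQ a) Y" and n: "length a = n"
  shows "encode Y (a, h) \<in> cells (fst (nerve Y)) n"
    "snd (nerve Y) n (encode Y (a, h)) = a"
    "act (fst (nerve Y)) (m, f, n) (encode Y (a, h)) =
       encode Y (act words (m, f, n) a, Cmp (WHDTS U) h (real_arr a m f))"
proof -
  show c: "encode Y (a, h) \<in> cells (fst (nerve Y)) n" using h n by (auto simp: nerve_def nerve_cells_def)
  then show "snd (nerve Y) n (encode Y (a, h)) = a"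
    by (simp add: nerve_def decode_encode[OF Y h])
  show "act (fst (nerve Y)) (m, f, n) (encode Y (a, h)) =
      encode Y (act words (m, f, n) a, Cmp (WHDTS U) h (real_arr a m f))"
    by (simp add: nerve_def nerve_act_def decode_encode[OF Y h])
qed

lemma Obj_nerve:
  assumes Y: "Y \<in> Obj (WHDTS U)" shows "nerve Y \<in> Obj (LPS U)"
proof -
  let ?K = "fst (nerve Y)"
  have comp: "Cmp (WHDTS U) h (real_arr a m f) \<in> hom (WHDTS U) (TQ (act words (m, f, length a) a)) Y"
    if "(m, f, length a) \<in> box" "h \<in> hom (WHDTS U) (TQ a) Y" for m f a h
    using Cmp_hom[OF category_WHDTS real_arr[OF that(1)] that(2)] .
  have act_cell: "act ?K (m, f, n) x \<in> cells ?K m" if f: "(m, f, n) \<in> box" and x: "x \<in> cells ?K n" for m f n x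
    using x
  proof (rule nerve_cellE)
    fix a h assume *: "x = encode Y (a, h)" "length a = n" "h \<in> hom (WHDTS U) (TQ a) Y"
    have f': "(m, f, length a) \<in> box" using f *(2) by simp
    show ?thesis
      using nerve_simps(3)[OF Y *(3,2)] nerve_simps(1)[OF Y comp[OF f' *(3)] length_act_words] *(1,2) by simp
  qed
  have psh: "sym_precubical_set ?K"
    unfolding sym_precubical_set_def
  proof (intro conjI allI impI ballI)
    show "act ?K (m, f, n) \<in> cells ?K n \<rightarrow> cells ?K m" if "(m, f, n) \<in> box" for m f n
      using act_cell[OF that] by blast
    show "act ?K (n, \<lambda>\<epsilon>\<in>vert n. \<epsilon>, n) x = x" if x: "x \<in> cells ?K n" for n x
      using x
    proof (rule nerve_cellE)
      fix a h assume *: "x = encode Y (a, h)" "length a = n" "h \<in> hom (WHDTS U) (TQ a) Y"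
      show ?thesis
        using nerve_simps(3)[OF Y *(3,2)] act_words_id[OF *(2)] real_arr_id[of a]
          Cmp_Idn_right[OF category_WHDTS *(3)] *(1,2) by simp
    qed
    fix l m n g f x
    assume g: "(l, g, m) \<in> box" and f: "(m, f, n) \<in> box" and x: "x \<in> cells ?K n"
    from x show "act ?K (l, compose (vert l) f g, n) x = act ?K (l, g, m) (act ?K (m, f, n) x)"
    proof (rule nerve_cellE)
      fix a h assume *: "x = encode Y (a, h)" "length a = n" "h \<in> hom (WHDTS U) (TQ a) Y"
      let ?b = "act words (m, f, n) a"
      have f': "(m, f, length a) \<in> box" using f *(2) by simp
      have g': "(l, g, length ?b) \<in> box" using g by (simp add: length_act_words)
      have rb: "real_arr ?b l g \<in> hom (WHDTS U) (TQ (act words (l, g, length ?b) ?b)) (TQ ?b)"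
        by (rule real_arr[OF g'])
      have ra: "real_arr a m f \<in> hom (WHDTS U) (TQ ?b) (TQ a)" using real_arr[OF f'] *(2) by simp
      have hb: "Cmp (WHDTS U) h (real_arr a m f) \<in> hom (WHDTS U) (TQ ?b) Y" using comp[OF f' *(3)] *(2) by simp
      have "Cmp (WHDTS U) h (real_arr a l (compose (vert l) f g)) =
          Cmp (WHDTS U) (Cmp (WHDTS U) h (real_arr a m f)) (real_arr ?b l g)"
        using real_arr_comp[OF g f'] Cmp_assoc[OF category_WHDTS rb ra *(3)] *(2) by simp
      then show ?thesis
        using nerve_simps(3)[OF Y *(3,2)] nerve_simps(3)[OF Y hb length_act_words] act_words_comp[OF g f'] *(1,2)
        by simp
    qed
  qed
  have lab: "psh_hom ?K words (snd (nerve Y))"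
  proof (rule psh_homI)
    show "snd (nerve Y) n x \<in> cells words n" if x: "x \<in> cells ?K n" for n x
      using x by (rule nerve_cellE) (use nerve_simps(2)[OF Y] in \<open>simp add: words_def\<close>)
    show "snd (nerve Y) n x = undefined" if "x \<notin> cells ?K n" for n x
      using that by (simp add: nerve_def)
    fix m f n x assume f: "(m, f, n) \<in> box" and x: "x \<in> cells ?K n"
    from x show "snd (nerve Y) m (act ?K (m, f, n) x) = act words (m, f, n) (snd (nerve Y) n x)"
    proof (rule nerve_cellE)
      fix a h assume *: "x = encode Y (a, h)" "length a = n" "h \<in> hom (WHDTS U) (TQ a) Y"
      have f': "(m, f, length a) \<in> box" using f *(2) by simp
      show ?thesis
        using nerve_simps(2,3)[OF Y *(3,2)] nerve_simps(2)[OF Y comp[OF f' *(3)] length_act_words] *(1,2) by simp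
    qed
  qed
  have "cells ?K n \<in> U" for n
  proof (rule universe_subset[OF U encode(2)[OF Y]])
    show "cells ?K n \<subseteq> encode Y ` singular Y"
      by (auto simp: nerve_def nerve_cells_def singular_def)
  qed
  then show ?thesis using psh lab by (simp add: Obj_LPS labelled_sps_def)
qed

text \<open>Two cells of the nerve with the same label and the same faces are two arrows out of one realized cube
  that agree on its faces.\<close>

lemma HDA_paradigm_nerve:
  assumes Y: "Y \<in> Obj (WHDTS U)" shows "HDA_paradigm (nerve Y)"
proof (rule HDA_paradigm_if_determined_by_faces)
  show "labelled_sps (nerve Y)" using Obj_nerve[OF Y] by (simp add: Obj_LPS)
  let ?K = "fst (nerve Y)"
  fix n x y
  assume x: "x \<in> cells ?K (Suc n)" and y: "y \<in> cells ?K (Suc n)" and n: "n \<ge> 1"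
    and label: "snd (nerve Y) (Suc n) x = snd (nerve Y) (Suc n) y"
    and faces: "\<And>i \<alpha>. i \<le> n \<Longrightarrow> act ?K (n, face n i \<alpha>, Suc n) x = act ?K (n, face n i \<alpha>, Suc n) y"
  obtain a g where g: "x = encode Y (a, g)" "length a = Suc n" "g \<in> hom (WHDTS U) (TQ a) Y"
    using nerve_cellE[OF x] .
  obtain a' h where h': "y = encode Y (a', h)" "length a' = Suc n" "h \<in> hom (WHDTS U) (TQ a') Y"
    using nerve_cellE[OF y] .
  have "a' = a" using label nerve_simps(2)[OF Y g(3,2)] nerve_simps(2)[OF Y h'(3,2)] g(1) h'(1) by simp
  then have h: "y = encode Y (a, h)" "h \<in> hom (WHDTS U) (TQ a) Y" using h' by simp_all
  have "g = h"
  proof (rule determined_on_faces[OF g(2) n g(3) h(2)])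
    fix i \<alpha> assume i: "i \<le> n"
    let ?b = "act words (n, face n i \<alpha>, Suc n) a" and ?r = "real_arr a n (face n i \<alpha>)"
    have "(n, face n i \<alpha>, length a) \<in> box" using box_face[OF i] g(2) by simp
    from real_arr[OF this] have r: "?r \<in> hom (WHDTS U) (TQ ?b) (TQ a)" using g(2) by simp
    have "encode Y (?b, Cmp (WHDTS U) g ?r) = encode Y (?b, Cmp (WHDTS U) h ?r)"
      using faces[OF i, of \<alpha>] nerve_simps(3)[OF Y g(3,2)] nerve_simps(3)[OF Y h(2) g(2)] g(1) h(1) by simp
    from arg_cong[OF this, of "decode Y"] show "Cmp (WHDTS U) g ?r = Cmp (WHDTS U) h ?r"
      unfolding decode_encode[OF Y Cmp_hom[OF category_WHDTS r g(3)]]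
        decode_encode[OF Y Cmp_hom[OF category_WHDTS r h(2)]] by simp
  qed
  then show "x = y" using g(1) h(1) by simp
qed

text \<open>By the Yoneda lemma, an arrow \<open>e\<close> from the cube of \<open>a\<close> to the nerve is a cell with label \<open>a\<close>, that is an
  arrow \<open>\<psi> a e\<close> from the realized cube to \<open>Y\<close>. Density of the cubes extends this from cubes to all objects.\<close>

theorem nerve_couniversal:
  assumes Y: "Y \<in> Obj (WHDTS U)"
  shows "\<exists>\<epsilon>. couniversal_arrow (LPS U) (WHDTS U) T Y (nerve Y) \<epsilon>"
proof -
  define \<psi> where "\<psi> a e = snd (decode Y (arr_map e (length a) (gen a)))" for a :: "'l list" and e :: "('u, 'l) lps_arr"
  note N = Obj_nerve[OF Y]
  have cell: "arr_map e (length a) (gen a) = encode Y (a, \<psi> a e)" "\<psi> a e \<in> hom (WHDTS U) (TQ a) Y"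
    if e: "e \<in> hom (LPS U) (Q a) (nerve Y)" for a e
  proof -
    obtain b h where h: "arr_map e (length a) (gen a) = encode Y (b, h)" "length b = length a"
      "h \<in> hom (WHDTS U) (TQ b) Y"
      using nerve_cellE[OF arr_map_LPS(5)[OF e gen_cell]] .
    have "b = a"
      using arr_map_LPS(6)[OF e gen_cell] gen_label[of a] nerve_simps(2)[OF Y h(3,2)] h(1) by simp
    then show "arr_map e (length a) (gen a) = encode Y (a, \<psi> a e)" "\<psi> a e \<in> hom (WHDTS U) (TQ a) Y"
      using h decode_encode[OF Y h(3)] by (simp_all add: \<psi>_def)
  qed
  have \<psi>_eq: "\<psi> a e = h" if "arr_map e (length a) (gen a) = encode Y (a, h)" "h \<in> hom (WHDTS U) (TQ a) Y" for a e h
    using decode_encode[OF Y that(2)] that(1) by (simp add: \<psi>_def)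
  show ?thesis
  proof (rule couniversal_arrow_if_dense[OF category_LPS category_WHDTS T dense_cubes T_preserves_density Q Y N])
    fix a :: "'l list"
    show "bij_betw (\<psi> a) (hom (LPS U) (Q a) (nerve Y)) (hom (WHDTS U) (fobj T (Q a)) Y)"
      unfolding bij_betw_def TQ_def[symmetric]
    proof (intro conjI equalityI subsetI)
      show "inj_on (\<psi> a) (hom (LPS U) (Q a) (nerve Y))"
      proof (rule inj_onI)
        fix d e assume d: "d \<in> hom (LPS U) (Q a) (nerve Y)" and e: "e \<in> hom (LPS U) (Q a) (nerve Y)"
          and "\<psi> a d = \<psi> a e"
        then show "d = e" using cell(1)[OF d] cell(1)[OF e] by (intro arr_eq_Q[OF d e]) simp
      qed
      show "h \<in> hom (WHDTS U) (TQ a) Y" if "h \<in> \<psi> a ` hom (LPS U) (Q a) (nerve Y)" for h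
        using that cell(2) by auto
      fix h assume h: "h \<in> hom (WHDTS U) (TQ a) Y"
      note s = nerve_simps[OF Y h refl]
      note c = classify[OF N s(1), unfolded s(2)]
      have "\<psi> a (classify (nerve Y) (length a) (encode Y (a, h))) = h" using \<psi>_eq[OF c(2) h] .
      then show "h \<in> \<psi> a ` hom (LPS U) (Q a) (nerve Y)" using c(1) by (metis image_eqI)
    qed
  next
    fix a b :: "'l list" and f e
    assume f: "f \<in> hom (LPS U) (Q a) (Q b)" and e: "e \<in> hom (LPS U) (Q b) (nerve Y)"
    obtain k where k: "(length a, k, length b) \<in> box" "a = act words (length a, k, length b) b"
      "f = cube_arr b (length a) k" using arr_between_cubes[OF f] .
    have Tf: "farr T f \<in> hom (WHDTS U) (TQ a) (TQ b)" using functor_hom[OF T f] by (simp add: TQ_def)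
    have r: "real_arr b (length a) k = farr T f" by (simp add: real_arr_def k(3)[symmetric])
    have "arr_map (Cmp (LPS U) e f) (length a) (gen a) =
        act (fst (nerve Y)) (length a, k, length b) (arr_map e (length b) (gen b))"
      using arr_map_comp_cube_arr[OF e k(1)] k(2,3) by simp
    also have "\<dots> = encode Y (a, Cmp (WHDTS U) (\<psi> b e) (farr T f))"
      using nerve_simps(3)[OF Y cell(2)[OF e] refl] cell(1)[OF e] k(2) r by simp
    finally show "\<psi> a (Cmp (LPS U) e f) = Cmp (WHDTS U) (\<psi> b e) (farr T f)"
      by (rule \<psi>_eq) (rule Cmp_hom[OF category_WHDTS Tf cell(2)[OF e]])
  qed
qed

end

section \<open>The factorization\<close>

text \<open>The functor \<open>Tbar\<close> is \<open>T\<close> itself, regarded as a functor on the full subcategory.\<close>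

theorem theorem9p5:
  fixes U :: "'u set set"
    and T :: "(('u, 'l) lps, ('u, 'l) lps_arr, ('u, 'u, 'l) ts, ('u, 'l) ts_arr) ftor"
    and Sh :: "(('u, 'l) lps, ('u, 'l) lps_arr, ('u, 'l) lps, ('u, 'l) lps_arr) ftor"
  assumes "universe U" and "small_type U TYPE('l)"
    and "is_realization U T"
    and "adjunction (LPS U) (HDA U) Sh inclusion"
  shows "\<exists>Tbar. is_functor (HDA U) (WHDTS U) Tbar \<and>
           naturally_isomorphic (LPS U) (WHDTS U) T (ftor_comp Tbar Sh) \<and>
           (\<forall>F. is_functor (HDA U) (WHDTS U) F \<and>
                naturally_isomorphic (LPS U) (WHDTS U) T (ftor_comp F Sh) \<longrightarrow>
                naturally_isomorphic (HDA U) (WHDTS U) F Tbar) \<and>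
           is_left_adjoint (HDA U) (WHDTS U) Tbar"
proof -
  obtain Q q \<theta> where "realization U T Q q \<theta>"
    using assms(1-3) unfolding is_realization_def realization_def by (elim conjE exE) blast
  then interpret realization U T Q q \<theta> .
  have cu: "\<exists>G \<epsilon>. HDA_paradigm G \<and> couniversal_arrow (LPS U) (WHDTS U) T Y G \<epsilon>"
    if "Y \<in> Obj (WHDTS U)" for Y
    using nerve_couniversal[OF that] HDA_paradigm_nerve[OF that] by blast
  note factorization =
    factorization_through_reflection[OF category_LPS category_WHDTS T assms(4)[unfolded HDA_def] cu]
  show ?thesis
    using factorization unfolding HDA_def[symmetric] by (intro exI[of _ T]) blast
qed

end
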